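(* Let $C^{4n+4}$ ($n\geq 1$) be a hyperkähler cone over a 3-Sasakian manifold $M^{4n+3}$, and let $\iota\colon M \hookrightarrow C$, $\iota(x) = (1,x)$. Let $P \to C$ be a principal $G$-bundle, and let $A$ be a dilation-invariant connection on $P$ that is in temporal gauge. Then $A$ is an $\mathrm{Sp}(n+1)$-instanton on $P \to C$ if and only if $\iota^*A$ is a tri-contact instanton on $\iota^*P \to M$.
   Context: Hyperkähler cone: $(C^{4n+4},g_C)=(\mathbb{R}^+\times M, dr^2+r^2g_M)$ with a conical hyperkähler structure $(g_C,(I_C,J_C,K_C))$, $I_CJ_C=K_C$; the link $(M^{4n+3},g_M)$, identified with $\{1\}\times M$, is then called 3-Sasakian. Put $\omega_1=g_C(I_C\cdot,\cdot)$, $\omega_2=g_C(J_C\cdot,\cdot)$, $\omega_3=g_C(K_C\cdot,\cdot)$. $\mathrm{Sp}(n+1)$-instanton on $C$: a connection $A$ whose curvature $F_A$ is of type $(1,1)$ with respect to each of $I_C,J_C,K_C$ and satisfies $F_A\wedge\omega_p^{2n+1}=0$ for $p=1,2,3$. Tri-contact instanton: let $\alpha_p=(r\partial_r\lrcorner\omega_p)|_M\in\Omega^1(M)$ for $p=1,2,3$, and $\widetilde{\mathsf H}=\ker(\alpha_1,\alpha_2,\alpha_3)\subset TM$, a rank $4n$ subbundle preserved by $I_C,J_C,K_C$. Let $\widetilde W\subset\Lambda^2(\widetilde{\mathsf H}^* )\subset\Lambda^2(T^*M)$ be the bundle of real 2-forms on $\widetilde{\mathsf H}$ (extended by zero on $\widetilde{\mathsf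 H}^\perp$) of type $(1,1)$ with respect to each of $I_C,J_C,K_C$ restricted to $\widetilde{\mathsf H}$ (these are automatically primitive with respect to each). A connection on a principal bundle $P'\to M$ is a tri-contact instanton if its curvature is a section of $\widetilde W\otimes\mathrm{ad}_{P'}$. Temporal gauge and dilation invariance: let $\iota_r:M\to C$, $\iota_r(x)=(r,x)$, and let $\mathfrak g$ be the Lie algebra of $G$. Along $\iota_r^*P$ write $A=B_r+h_r\,dr$, with $B_r$ a connection on $\iota_r^*P$ and $h_r:\iota_r^*P\to\mathfrak g$ a $G$-equivariant function. $A$ is in temporal gauge if $h_r=0$ for all $r$; in that case $F_A=F_{B_r}-\partial_rB_r\wedge dr$. A connection in temporal gauge is dilation-invariant if $\partial_rB_r=0$. *)

theory Defs
  imports "HOL-Analysis.Analysis" "HOL-Algebra.Group"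
begin

section \<open>Smooth maps between open subsets of normed spaces\<close>

text \<open>All sets to which the following is applied are open.\<close>

primrec Ck_on :: "nat \<Rightarrow> 'a::real_normed_vector set \<Rightarrow> ('a \<Rightarrow> 'b::real_normed_vector) \<Rightarrow> bool" where
  "Ck_on 0 = (\<lambda>S f. continuous_on S f)"
| "Ck_on (Suc k) = (\<lambda>S f. (\<forall>x\<in>S. f differentiable (at x)) \<and>
     (\<forall>v. Ck_on k S (\<lambda>x. frechet_derivative f (at x) v)))"

definition smooth_on :: "'a::real_normed_vector set \<Rightarrow> ('a \<Rightarrow> 'b::real_normed_vector) \<Rightarrow> bool" where
  "smooth_on S f \<longleftrightarrow> (\<forall>k. Ck_on k S f)"


section \<open>Manifolds, tangent spaces, tangent maps\<close>

text \<open>A chart is a domain together with a coordinate map; the values of the coordinate map outside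
  the domain are irrelevant. A manifold is given by an atlas. Its underlying set is an open subset
  of a type that carries a Hausdorff second countable topology.\<close>

type_synonym ('a, 'e) chart = "'a set \<times> ('a \<Rightarrow> 'e)"
type_synonym ('a, 'e) atlas = "('a, 'e) chart set"

definition chart_inv :: "('a, 'e) chart \<Rightarrow> 'e \<Rightarrow> 'a" where
  "chart_inv c = inv_into (fst c) (snd c)"

definition points :: "('a, 'e) atlas \<Rightarrow> 'a set" where
  "points \<A> = (\<Union>c\<in>\<A>. fst c)"

definition smooth_atlas ::
  "('a::{t2_space,second_countable_topology}, 'e::real_normed_vector) atlas \<Rightarrow> bool" where
  "smooth_atlas \<A> \<longleftrightarrow>
     (\<forall>c\<in>\<A>. open (fst c) \<and> open (snd c ` fst c) \<and>
        homeomorphism (fst c) (snd c ` fst c) (snd c) (chart_inv c)) \<and>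
     (\<forall>c\<in>\<A>. \<forall>d\<in>\<A>. smooth_on (snd c ` (fst c \<inter> fst d)) (snd d \<circ> chart_inv c))"

definition smooth_map :: "('a::topological_space, 'e::real_normed_vector) atlas \<Rightarrow>
    ('b::topological_space, 'f::real_normed_vector) atlas \<Rightarrow> ('a \<Rightarrow> 'b) \<Rightarrow> bool" where
  "smooth_map \<A> \<B> f \<longleftrightarrow> f ` points \<A> \<subseteq> points \<B> \<and> continuous_on (points \<A>) f \<and>
     (\<forall>c\<in>\<A>. \<forall>d\<in>\<B>. smooth_on (snd c ` (fst c \<inter> f -` fst d)) (snd d \<circ> f \<circ> chart_inv c))"

definition diffeo :: "('a::topological_space, 'e::real_normed_vector) atlas \<Rightarrow>
    ('b::topological_space, 'f::real_normed_vector) atlas \<Rightarrow> ('a \<Rightarrow> 'b) \<Rightarrow> bool" where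
  "diffeo \<A> \<B> f \<longleftrightarrow> bij_betw f (points \<A>) (points \<B>) \<and>
     smooth_map \<A> \<B> f \<and> smooth_map \<B> \<A> (inv_into (points \<A>) f)"

definition restrict_atlas :: "('a, 'e) atlas \<Rightarrow> 'a set \<Rightarrow> ('a, 'e) atlas" where
  "restrict_atlas \<A> S = (\<lambda>c. (fst c \<inter> S, snd c)) ` \<A>"

definition prod_atlas :: "('a, 'e) atlas \<Rightarrow> ('b, 'f) atlas \<Rightarrow> ('a \<times> 'b, 'e \<times> 'f) atlas" where
  "prod_atlas \<A> \<B> = (\<lambda>(c, d). (fst c \<times> fst d, map_prod (snd c) (snd d))) ` (\<A> \<times> \<B>)"

definition half_line :: "(real, real) atlas" where
  "half_line = {({0<..}, \<lambda>r. r)}"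

text \<open>The tangent space at \<open>x\<close> is the model space \<open>'e\<close>: a tangent vector at \<open>x\<close> is represented
  by its components in one chart around \<open>x\<close> that is chosen once and for all. Thus a vector in \<open>'e\<close>
  has a meaning only relative to a point. In particular the chosen chart around a point of a
  product need not be the product of the chosen charts of the factors, so tangent vectors of
  a product are only ever decomposed by means of the tangent maps of the projections.\<close>

definition chart_at :: "('a, 'e) atlas \<Rightarrow> 'a \<Rightarrow> ('a, 'e) chart" where
  "chart_at \<A> x = (SOME c. c \<in> \<A> \<and> x \<in> fst c)"

definition tangent_map :: "('a, 'e::real_normed_vector) atlas \<Rightarrow>
    ('b, 'f::real_normed_vector) atlas \<Rightarrow> ('a \<Rightarrow> 'b) \<Rightarrow> 'a \<Rightarrow> 'e \<Rightarrow> 'f" where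
  "tangent_map \<A> \<B> f x =
     frechet_derivative (snd (chart_at \<B> (f x)) \<circ> f \<circ> chart_inv (chart_at \<A> x))
       (at (snd (chart_at \<A> x) x))"

text \<open>\<open>to_chart \<A> c x\<close> sends a tangent vector at \<open>x\<close> to its components in the chart \<open>c\<close>, and
  \<open>from_chart \<A> c y\<close> sends components in \<open>c\<close> to the tangent vector at the point with
  coordinates \<open>y\<close>.\<close>

definition to_chart :: "('a, 'e::real_normed_vector) atlas \<Rightarrow> ('a, 'e) chart \<Rightarrow> 'a \<Rightarrow> 'e \<Rightarrow> 'e" where
  "to_chart \<A> c x =
     frechet_derivative (snd c \<circ> chart_inv (chart_at \<A> x)) (at (snd (chart_at \<A> x) x))"

definition from_chart :: "('a, 'e::real_normed_vector) atlas \<Rightarrow> ('a, 'e) chart \<Rightarrow> 'e \<Rightarrow> 'e \<Rightarrow> 'e" where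
  "from_chart \<A> c y =
     frechet_derivative (snd (chart_at \<A> (chart_inv c y)) \<circ> chart_inv c) (at y)"


section \<open>Tensor fields\<close>

text \<open>Expressions in a chart of a vector field, a vector-valued 1-form, a bilinear form, and
  an endomorphism field.\<close>

definition vector_rep ::
  "('a, 'e::real_normed_vector) atlas \<Rightarrow> ('a, 'e) chart \<Rightarrow> ('a \<Rightarrow> 'e) \<Rightarrow> 'e \<Rightarrow> 'e" where
  "vector_rep \<A> c X y = to_chart \<A> c (chart_inv c y) (X (chart_inv c y))"

definition form1_rep :: "('a, 'e::real_normed_vector) atlas \<Rightarrow> ('a, 'e) chart \<Rightarrow>
    ('a \<Rightarrow> 'e \<Rightarrow> 'b) \<Rightarrow> 'e \<Rightarrow> 'e \<Rightarrow> 'b" where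
  "form1_rep \<A> c A y v = A (chart_inv c y) (from_chart \<A> c y v)"

definition bilin_rep :: "('a, 'e::real_normed_vector) atlas \<Rightarrow> ('a, 'e) chart \<Rightarrow>
    ('a \<Rightarrow> 'e \<Rightarrow> 'e \<Rightarrow> 'b) \<Rightarrow> 'e \<Rightarrow> 'e \<Rightarrow> 'e \<Rightarrow> 'b" where
  "bilin_rep \<A> c g y u v = g (chart_inv c y) (from_chart \<A> c y u) (from_chart \<A> c y v)"

definition endo_rep :: "('a, 'e::real_normed_vector) atlas \<Rightarrow> ('a, 'e) chart \<Rightarrow>
    ('a \<Rightarrow> 'e \<Rightarrow> 'e) \<Rightarrow> 'e \<Rightarrow> 'e \<Rightarrow> 'e" where
  "endo_rep \<A> c L y v =
     to_chart \<A> c (chart_inv c y) (L (chart_inv c y) (from_chart \<A> c y v))"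

definition smooth_form1 :: "('a, 'e::real_normed_vector) atlas \<Rightarrow>
    ('a \<Rightarrow> 'e \<Rightarrow> 'b::real_normed_vector) \<Rightarrow> bool" where
  "smooth_form1 \<A> A \<longleftrightarrow> (\<forall>x\<in>points \<A>. linear (A x)) \<and>
     (\<forall>c\<in>\<A>. \<forall>v. smooth_on (snd c ` fst c) (\<lambda>y. form1_rep \<A> c A y v))"

definition smooth_endo :: "('a, 'e::real_normed_vector) atlas \<Rightarrow> ('a \<Rightarrow> 'e \<Rightarrow> 'e) \<Rightarrow> bool" where
  "smooth_endo \<A> L \<longleftrightarrow> (\<forall>x\<in>points \<A>. linear (L x)) \<and>
     (\<forall>c\<in>\<A>. \<forall>v. smooth_on (snd c ` fst c) (\<lambda>y. endo_rep \<A> c L y v))"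

definition pullback1 :: "('a, 'e::real_normed_vector) atlas \<Rightarrow> ('b, 'f::real_normed_vector) atlas \<Rightarrow>
    ('a \<Rightarrow> 'b) \<Rightarrow> ('b \<Rightarrow> 'f \<Rightarrow> 'c) \<Rightarrow> 'a \<Rightarrow> 'e \<Rightarrow> 'c" where
  "pullback1 \<A> \<B> f A x v = A (f x) (tangent_map \<A> \<B> f x v)"

text \<open>Lie bracket and exterior derivative at \<open>x\<close> are computed in the chosen chart around \<open>x\<close>; there
  \<open>[X, Y] = DY(X) - DX(Y)\<close> and, for constant \<open>u\<close> and \<open>v\<close>,
  \<open>dA(u, v) = D\<^sub>u (A v) - D\<^sub>v (A u)\<close>.\<close>

definition lie_bracket :: "('a, 'e::real_normed_vector) atlas \<Rightarrow>
    ('a \<Rightarrow> 'e) \<Rightarrow> ('a \<Rightarrow> 'e) \<Rightarrow> 'a \<Rightarrow> 'e" where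
  "lie_bracket \<A> X Y x = (let c = chart_at \<A> x; y = snd c x in
     frechet_derivative (vector_rep \<A> c Y) (at y) (X x) -
     frechet_derivative (vector_rep \<A> c X) (at y) (Y x))"

definition ext_deriv1 :: "('a, 'e::real_normed_vector) atlas \<Rightarrow>
    ('a \<Rightarrow> 'e \<Rightarrow> 'b::real_normed_vector) \<Rightarrow> 'a \<Rightarrow> 'e \<Rightarrow> 'e \<Rightarrow> 'b" where
  "ext_deriv1 \<A> A x u v = (let c = chart_at \<A> x; y = snd c x in
     frechet_derivative (\<lambda>y. form1_rep \<A> c A y v) (at y) u -
     frechet_derivative (\<lambda>y. form1_rep \<A> c A y u) (at y) v)"


section \<open>Exterior algebra of a single tangent space\<close>

definition two_form :: "('e::real_vector \<Rightarrow> 'e \<Rightarrow> 'b::real_vector) \<Rightarrow> bool" where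
  "two_form \<beta> \<longleftrightarrow> bilinear \<beta> \<and> (\<forall>u. \<beta> u u = 0)"

text \<open>For wedge products, a \<open>k\<close>-form is a function of a sequence of vectors that only depends on
  its first \<open>k\<close> members. The first factor may be vector-valued.\<close>

definition wedge :: "nat \<Rightarrow> nat \<Rightarrow> ((nat \<Rightarrow> 'e) \<Rightarrow> 'b::real_vector) \<Rightarrow> ((nat \<Rightarrow> 'e) \<Rightarrow> real) \<Rightarrow>
    (nat \<Rightarrow> 'e) \<Rightarrow> 'b" where
  "wedge k l \<alpha> \<beta> v = (1 / (fact k * fact l)) *\<^sub>R
     (\<Sum>\<sigma> | \<sigma> permutes {..<k + l}.
        (of_int (sign \<sigma>) * \<beta> (\<lambda>i. v (\<sigma> (k + i)))) *\<^sub>R \<alpha> (\<lambda>i. v (\<sigma> i)))"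

definition as_form :: "('e \<Rightarrow> 'e \<Rightarrow> 'b) \<Rightarrow> (nat \<Rightarrow> 'e) \<Rightarrow> 'b" where
  "as_form \<beta> v = \<beta> (v 0) (v 1)"

primrec wedge_power :: "('e \<Rightarrow> 'e \<Rightarrow> real) \<Rightarrow> nat \<Rightarrow> (nat \<Rightarrow> 'e) \<Rightarrow> real" where
  "wedge_power \<omega> 0 = (\<lambda>_. 1)"
| "wedge_power \<omega> (Suc m) = wedge 2 (2 * m) (as_form \<omega>) (wedge_power \<omega> m)"

text \<open>Complexified vectors \<open>a + \<i> b\<close> are written as pairs \<open>(a, b)\<close>. Let \<open>L\<close> be a complex structure
  on the subspace \<open>V\<close>. Then \<open>holo V L\<close> and \<open>antiholo V L\<close> are the eigenspaces of the complexified
  \<open>L\<close> for \<open>\<i>\<close> and \<open>-\<i>\<close>, and a 2-form is of type (1,1) if its complex bilinear extension vanishes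
  on pairs of (1,0)-vectors and on pairs of (0,1)-vectors.\<close>

definition holo :: "'e::real_vector set \<Rightarrow> ('e \<Rightarrow> 'e) \<Rightarrow> ('e \<times> 'e) set" where
  "holo V L = {(a, b). a \<in> V \<and> b \<in> V \<and> L a = - b \<and> L b = a}"

definition antiholo :: "'e::real_vector set \<Rightarrow> ('e \<Rightarrow> 'e) \<Rightarrow> ('e \<times> 'e) set" where
  "antiholo V L = {(a, b). a \<in> V \<and> b \<in> V \<and> L a = b \<and> L b = - a}"

definition complexify :: "('e \<Rightarrow> 'e \<Rightarrow> 'b::real_vector) \<Rightarrow> 'e \<times> 'e \<Rightarrow> 'e \<times> 'e \<Rightarrow> 'b \<times> 'b" where
  "complexify \<beta> = (\<lambda>(a, b) (c, d). (\<beta> a c - \<beta> b d, \<beta> a d + \<beta> b c))"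

definition type11 ::
  "'e::real_vector set \<Rightarrow> ('e \<Rightarrow> 'e) \<Rightarrow> ('e \<Rightarrow> 'e \<Rightarrow> 'b::real_vector) \<Rightarrow> bool" where
  "type11 V L \<beta> \<longleftrightarrow>
     (\<forall>Z\<in>holo V L. \<forall>W\<in>holo V L. complexify \<beta> Z W = 0) \<and>
     (\<forall>Z\<in>antiholo V L. \<forall>W\<in>antiholo V L. complexify \<beta> Z W = 0)"


section \<open>Riemannian and hyperkaehler structures\<close>

definition riemannian_metric ::
  "('a, 'e::real_normed_vector) atlas \<Rightarrow> ('a \<Rightarrow> 'e \<Rightarrow> 'e \<Rightarrow> real) \<Rightarrow> bool" where
  "riemannian_metric \<A> g \<longleftrightarrow>
     (\<forall>x\<in>points \<A>. bilinear (g x) \<and> (\<forall>u v. g x u v = g x v u) \<and> (\<forall>u. u \<noteq> 0 \<longrightarrow> g x u u > 0)) \<and>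
     (\<forall>c\<in>\<A>. \<forall>u v. smooth_on (snd c ` fst c) (\<lambda>y. bilin_rep \<A> c g y u v))"

text \<open>The Levi-Civita connection in a chart, on constant vector fields, by the Koszul formula.\<close>

definition christoffel :: "('a, 'e::real_normed_vector) atlas \<Rightarrow> ('a, 'e) chart \<Rightarrow>
    ('a \<Rightarrow> 'e \<Rightarrow> 'e \<Rightarrow> real) \<Rightarrow> 'e \<Rightarrow> 'e \<Rightarrow> 'e \<Rightarrow> 'e" where
  "christoffel \<A> c g y u v = (THE w. \<forall>z. 2 * bilin_rep \<A> c g y w z =
      frechet_derivative (\<lambda>y. bilin_rep \<A> c g y v z) (at y) u
    + frechet_derivative (\<lambda>y. bilin_rep \<A> c g y u z) (at y) v
    - frechet_derivative (\<lambda>y. bilin_rep \<A> c g y u v) (at y) z)"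

text \<open>\<open>\<nabla>L = 0\<close> for the Levi-Civita connection of \<open>g\<close>.\<close>

definition parallel_endo :: "('a, 'e::real_normed_vector) atlas \<Rightarrow>
    ('a \<Rightarrow> 'e \<Rightarrow> 'e \<Rightarrow> real) \<Rightarrow> ('a \<Rightarrow> 'e \<Rightarrow> 'e) \<Rightarrow> bool" where
  "parallel_endo \<A> g L \<longleftrightarrow> (\<forall>c\<in>\<A>. \<forall>y\<in>snd c ` fst c. \<forall>u v.
     frechet_derivative (\<lambda>y. endo_rep \<A> c L y v) (at y) u
     + christoffel \<A> c g y u (endo_rep \<A> c L y v)
     - endo_rep \<A> c L y (christoffel \<A> c g y u v) = 0)"

definition kaehler_form :: "('a \<Rightarrow> 'e \<Rightarrow> 'e \<Rightarrow> real) \<Rightarrow> ('a \<Rightarrow> 'e \<Rightarrow> 'e) \<Rightarrow> 'a \<Rightarrow> 'e \<Rightarrow> 'e \<Rightarrow> real" where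
  "kaehler_form g L x u v = g x (L x u) v"

definition kaehler :: "('a, 'e::real_normed_vector) atlas \<Rightarrow>
    ('a \<Rightarrow> 'e \<Rightarrow> 'e \<Rightarrow> real) \<Rightarrow> ('a \<Rightarrow> 'e \<Rightarrow> 'e) \<Rightarrow> bool" where
  "kaehler \<A> g L \<longleftrightarrow> riemannian_metric \<A> g \<and> smooth_endo \<A> L \<and>
     (\<forall>x\<in>points \<A>. (\<forall>u. L x (L x u) = - u) \<and> (\<forall>u v. g x (L x u) (L x v) = g x u v)) \<and>
     parallel_endo \<A> g L"

definition hyperkaehler :: "('a, 'e::real_normed_vector) atlas \<Rightarrow> ('a \<Rightarrow> 'e \<Rightarrow> 'e \<Rightarrow> real) \<Rightarrow>
    ('a \<Rightarrow> 'e \<Rightarrow> 'e) \<Rightarrow> ('a \<Rightarrow> 'e \<Rightarrow> 'e) \<Rightarrow> ('a \<Rightarrow> 'e \<Rightarrow> 'e) \<Rightarrow> bool" where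
  "hyperkaehler \<A> g I J K \<longleftrightarrow> kaehler \<A> g I \<and> kaehler \<A> g J \<and> kaehler \<A> g K \<and>
     (\<forall>x\<in>points \<A>. \<forall>u. I x (J x u) = K x u)"


section \<open>Cones\<close>

abbreviation cone :: "('a, 'e) atlas \<Rightarrow> (real \<times> 'a, real \<times> 'e) atlas" where
  "cone \<M> \<equiv> prod_atlas half_line \<M>"

text \<open>\<open>dr\<^sup>2 + r\<^sup>2 g\<close>\<close>

definition cone_metric :: "('a, 'e::real_normed_vector) atlas \<Rightarrow> ('a \<Rightarrow> 'e \<Rightarrow> 'e \<Rightarrow> real) \<Rightarrow>
    real \<times> 'a \<Rightarrow> real \<times> 'e \<Rightarrow> real \<times> 'e \<Rightarrow> real" where
  "cone_metric \<M> g p u v =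
     tangent_map (cone \<M>) half_line fst p u * tangent_map (cone \<M>) half_line fst p v +
     (fst p)\<^sup>2 * g (snd p) (tangent_map (cone \<M>) \<M> snd p u) (tangent_map (cone \<M>) \<M> snd p v)"

definition dilation :: "real \<Rightarrow> real \<times> 'a \<Rightarrow> real \<times> 'a" where
  "dilation s = (\<lambda>(r, x). (s * r, x))"

definition dilation_invariant_endo :: "('a, 'e::real_normed_vector) atlas \<Rightarrow>
    (real \<times> 'a \<Rightarrow> real \<times> 'e \<Rightarrow> real \<times> 'e) \<Rightarrow> bool" where
  "dilation_invariant_endo \<M> L \<longleftrightarrow> (\<forall>s>0. \<forall>p\<in>points (cone \<M>). \<forall>u.
     tangent_map (cone \<M>) (cone \<M>) (dilation s) p (L p u) =
     L (dilation s p) (tangent_map (cone \<M>) (cone \<M>) (dilation s) p u))"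

text \<open>A conical hyperkaehler structure whose metric is the cone metric over \<open>(\<M>, g)\<close>, so that
  \<open>(\<M>, g)\<close> is 3-Sasakian. Dilation invariance of the complex structures is part of being
  conical; it is also a consequence of the other conditions.\<close>

definition hyperkaehler_cone :: "('a, 'e::real_normed_vector) atlas \<Rightarrow> ('a \<Rightarrow> 'e \<Rightarrow> 'e \<Rightarrow> real) \<Rightarrow>
    (real \<times> 'a \<Rightarrow> real \<times> 'e \<Rightarrow> real \<times> 'e) \<Rightarrow> (real \<times> 'a \<Rightarrow> real \<times> 'e \<Rightarrow> real \<times> 'e) \<Rightarrow>
    (real \<times> 'a \<Rightarrow> real \<times> 'e \<Rightarrow> real \<times> 'e) \<Rightarrow> bool" where
  "hyperkaehler_cone \<M> g I J K \<longleftrightarrow> riemannian_metric \<M> g \<and>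
     hyperkaehler (cone \<M>) (cone_metric \<M> g) I J K \<and>
     dilation_invariant_endo \<M> I \<and> dilation_invariant_endo \<M> J \<and> dilation_invariant_endo \<M> K"

definition slice :: "real \<Rightarrow> 'a \<Rightarrow> real \<times> 'a" where
  "slice r x = (r, x)"

text \<open>\<open>r \<partial>\<^sub>r\<close> at the point \<open>p\<close>\<close>

definition euler_field :: "('a, 'e::real_normed_vector) atlas \<Rightarrow> real \<times> 'a \<Rightarrow> real \<times> 'e" where
  "euler_field \<M> p = tangent_map half_line (cone \<M>) (\<lambda>r. (r, snd p)) (fst p) (fst p)"


section \<open>Lie groups\<close>

record ('h, 'g) lie_struct = "'h monoid" +
  atlas :: "('h, 'g) atlas"

text \<open>The model space is merely normed and finite-dimensional, rather than Euclidean in the sense of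
  \<open>euclidean_space\<close>, in order not to exclude groups of dimension zero. The Lie algebra is
  the tangent space at the unit, hence the type \<open>'g\<close>.\<close>

definition lie_group ::
  "('h::{t2_space,second_countable_topology}, 'g::real_normed_vector) lie_struct \<Rightarrow> bool" where
  "lie_group G \<longleftrightarrow> group G \<and> smooth_atlas (atlas G) \<and> points (atlas G) = carrier G \<and>
     (\<exists>S :: 'g set. finite S \<and> span S = UNIV) \<and>
     smooth_map (prod_atlas (atlas G) (atlas G)) (atlas G) (\<lambda>(a, b). a \<otimes>\<^bsub>G\<^esub> b) \<and>
     smooth_map (atlas G) (atlas G) (\<lambda>a. inv\<^bsub>G\<^esub> a)"

definition left_invariant_field :: "('h, 'g::real_normed_vector) lie_struct \<Rightarrow> 'g \<Rightarrow> 'h \<Rightarrow> 'g" where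
  "left_invariant_field G \<xi> a = tangent_map (atlas G) (atlas G) (\<lambda>b. a \<otimes>\<^bsub>G\<^esub> b) \<one>\<^bsub>G\<^esub> \<xi>"

definition lie_algebra_bracket :: "('h, 'g::real_normed_vector) lie_struct \<Rightarrow> 'g \<Rightarrow> 'g \<Rightarrow> 'g" where
  "lie_algebra_bracket G \<xi> \<eta> =
     lie_bracket (atlas G) (left_invariant_field G \<xi>) (left_invariant_field G \<eta>) \<one>\<^bsub>G\<^esub>"

definition Adj :: "('h, 'g::real_normed_vector) lie_struct \<Rightarrow> 'h \<Rightarrow> 'g \<Rightarrow> 'g" where
  "Adj G a = tangent_map (atlas G) (atlas G) (\<lambda>b. a \<otimes>\<^bsub>G\<^esub> b \<otimes>\<^bsub>G\<^esub> inv\<^bsub>G\<^esub> a) \<one>\<^bsub>G\<^esub>"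


section \<open>Principal bundles and connections\<close>

record ('p, 'q, 'b, 'h) bundle_struct =
  tot :: "('p, 'q) atlas"
  proj :: "'p \<Rightarrow> 'b"
  act :: "'p \<Rightarrow> 'h \<Rightarrow> 'p"

text \<open>Freeness and transitivity of the right action on the fibres follow from the equivariant local
  trivialisations.\<close>

definition principal_bundle ::
  "('h::{t2_space,second_countable_topology}, 'g::real_normed_vector) lie_struct \<Rightarrow>
   ('b::{t2_space,second_countable_topology}, 'e::real_normed_vector) atlas \<Rightarrow>
   ('p::{t2_space,second_countable_topology}, 'q::real_normed_vector, 'b, 'h) bundle_struct \<Rightarrow> bool" where
  "principal_bundle G \<B> P \<longleftrightarrow>
     lie_group G \<and> smooth_atlas \<B> \<and> smooth_atlas (tot P) \<and> smooth_map (tot P) \<B> (proj P) \<and>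
     smooth_map (prod_atlas (tot P) (atlas G)) (tot P) (\<lambda>(p, a). act P p a) \<and>
     (\<forall>p\<in>points (tot P). act P p \<one>\<^bsub>G\<^esub> = p \<and> (\<forall>a\<in>carrier G. proj P (act P p a) = proj P p \<and>
        (\<forall>b\<in>carrier G. act P (act P p a) b = act P p (a \<otimes>\<^bsub>G\<^esub> b)))) \<and>
     (\<forall>x\<in>points \<B>. \<exists>U \<tau>. open U \<and> x \<in> U \<and> U \<subseteq> points \<B> \<and>
        diffeo (restrict_atlas (tot P) (proj P -` U)) (prod_atlas (restrict_atlas \<B> U) (atlas G)) \<tau> \<and>
        (\<forall>p\<in>points (tot P). proj P p \<in> U \<longrightarrow> fst (\<tau> p) = proj P p \<and>
           (\<forall>a\<in>carrier G. \<tau> (act P p a) = (proj P p, snd (\<tau> p) \<otimes>\<^bsub>G\<^esub> a))))"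

definition connection :: "('h, 'g::real_normed_vector) lie_struct \<Rightarrow>
    ('p, 'q::real_normed_vector, 'b, 'h) bundle_struct \<Rightarrow> ('p \<Rightarrow> 'q \<Rightarrow> 'g) \<Rightarrow> bool" where
  "connection G P A \<longleftrightarrow> smooth_form1 (tot P) A \<and>
     (\<forall>p\<in>points (tot P).
        (\<forall>\<xi>. A p (tangent_map (atlas G) (tot P) (\<lambda>a. act P p a) \<one>\<^bsub>G\<^esub> \<xi>) = \<xi>) \<and>
        (\<forall>a\<in>carrier G. \<forall>X. A (act P p a) (tangent_map (tot P) (tot P) (\<lambda>p. act P p a) p X) =
           Adj G (inv\<^bsub>G\<^esub> a) (A p X)))"

text \<open>\<open>F = dA + (1/2) [A \<and> A]\<close>, as a form on the total space\<close>

definition curvature :: "('h, 'g::real_normed_vector) lie_struct \<Rightarrow>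
    ('p, 'q::real_normed_vector, 'b, 'h) bundle_struct \<Rightarrow> ('p \<Rightarrow> 'q \<Rightarrow> 'g) \<Rightarrow> 'p \<Rightarrow> 'q \<Rightarrow> 'q \<Rightarrow> 'g" where
  "curvature G P A p X Y = ext_deriv1 (tot P) A p X Y + lie_algebra_bracket G (A p X) (A p Y)"

text \<open>The curvature is a 2-form on the base with values in the adjoint bundle: any \<open>p\<close> in the fibre
  over \<open>x\<close> identifies that bundle's fibre at \<open>x\<close> with the Lie algebra, and the corresponding
  Lie algebra valued form \<open>\<beta>\<close> on the tangent space at \<open>x\<close> is the one whose pullback along the
  projection is the curvature at \<open>p\<close>. It is unique because the projection is a submersion.\<close>

definition represents_at :: "('b, 'e::real_normed_vector) atlas \<Rightarrow>
    ('p, 'q::real_normed_vector, 'b, 'h) bundle_struct \<Rightarrow>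
    ('p \<Rightarrow> 'q \<Rightarrow> 'q \<Rightarrow> 'g) \<Rightarrow> 'p \<Rightarrow> ('e \<Rightarrow> 'e \<Rightarrow> 'g) \<Rightarrow> bool" where
  "represents_at \<B> P F p \<beta> \<longleftrightarrow> (\<forall>X Y. F p X Y =
     \<beta> (tangent_map (tot P) \<B> (proj P) p X) (tangent_map (tot P) \<B> (proj P) p Y))"

text \<open>\<open>(Q, j)\<close> is the pullback of \<open>P\<close> along \<open>f\<close>: a principal bundle \<open>Q\<close> over the source of \<open>f\<close> together
  with an equivariant map \<open>j : Q \<rightarrow> P\<close> over \<open>f\<close>. This determines \<open>(Q, j)\<close> up to a unique isomorphism.
  The pullback connection is then the pullback of the connection form along \<open>j\<close>.\<close>

definition pullback_bundle ::
  "('h::{t2_space,second_countable_topology}, 'g::real_normed_vector) lie_struct \<Rightarrow>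
   ('a::{t2_space,second_countable_topology}, 'd::real_normed_vector) atlas \<Rightarrow> ('a \<Rightarrow> 'b) \<Rightarrow>
   ('p::topological_space, 'q::real_normed_vector, 'b, 'h) bundle_struct \<Rightarrow>
   ('s::{t2_space,second_countable_topology}, 't::real_normed_vector, 'a, 'h) bundle_struct \<Rightarrow>
   ('s \<Rightarrow> 'p) \<Rightarrow> bool" where
  "pullback_bundle G \<M> f P Q j \<longleftrightarrow> principal_bundle G \<M> Q \<and> smooth_map (tot Q) (tot P) j \<and>
     (\<forall>z\<in>points (tot Q). proj P (j z) = f (proj Q z) \<and>
        (\<forall>a\<in>carrier G. j (act Q z a) = act P (j z) a))"


section \<open>Temporal gauge and dilation invariance\<close>

text \<open>Writing \<open>A = B\<^sub>r + h\<^sub>r dr\<close>, and comparing \<open>B\<^sub>r\<close> for different \<open>r\<close>, presupposes an identification of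
  all the pullbacks of \<open>P\<close> to \<open>{r} \<times> M\<close> with a single bundle \<open>Q\<close> over \<open>M\<close>. It is given by an
  isomorphism \<open>\<Phi>\<close>, over the identity of the cone, from the bundle \<open>\<real>\<^sup>+ \<times> Q\<close> to \<open>P\<close>.\<close>

definition radial_identification ::
  "('h, 'g) lie_struct \<Rightarrow>
   ('p::topological_space, 'q::real_normed_vector, real \<times> 'a, 'h) bundle_struct \<Rightarrow>
   ('s::topological_space, 't::real_normed_vector, 'a, 'h) bundle_struct \<Rightarrow>
   (real \<times> 's \<Rightarrow> 'p) \<Rightarrow> bool" where
  "radial_identification G P Q \<Phi> \<longleftrightarrow> diffeo (prod_atlas half_line (tot Q)) (tot P) \<Phi> \<and>
     (\<forall>r>0. \<forall>z\<in>points (tot Q). proj P (\<Phi> (r, z)) = (r, proj Q z) \<and>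
        (\<forall>a\<in>carrier G. \<Phi> (r, act Q z a) = act P (\<Phi> (r, z)) a))"

text \<open>\<open>h\<^sub>r = A(\<partial>\<^sub>r)\<close>, and \<open>B\<^sub>r\<close> is the restriction of \<open>A\<close> to the slice of radius \<open>r\<close>.\<close>

definition gauge_h :: "('p, 'q::real_normed_vector, 'b, 'h) bundle_struct \<Rightarrow>
    (real \<times> 's \<Rightarrow> 'p) \<Rightarrow> ('p \<Rightarrow> 'q \<Rightarrow> 'g) \<Rightarrow> real \<Rightarrow> 's \<Rightarrow> 'g" where
  "gauge_h P \<Phi> A r z = A (\<Phi> (r, z)) (tangent_map half_line (tot P) (\<lambda>s. \<Phi> (s, z)) r 1)"

definition gauge_B :: "('p, 'q::real_normed_vector, 'b, 'h) bundle_struct \<Rightarrow>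
    ('s, 't::real_normed_vector, 'a, 'h) bundle_struct \<Rightarrow>
    (real \<times> 's \<Rightarrow> 'p) \<Rightarrow> ('p \<Rightarrow> 'q \<Rightarrow> 'g) \<Rightarrow> real \<Rightarrow> 's \<Rightarrow> 't \<Rightarrow> 'g" where
  "gauge_B P Q \<Phi> A r = pullback1 (tot Q) (tot P) (\<lambda>z. \<Phi> (r, z)) A"

definition temporal_gauge :: "('p, 'q::real_normed_vector, 'b, 'h) bundle_struct \<Rightarrow>
    ('s, 't, 'a, 'h) bundle_struct \<Rightarrow>
    (real \<times> 's \<Rightarrow> 'p) \<Rightarrow> ('p \<Rightarrow> 'q \<Rightarrow> 'g::real_normed_vector) \<Rightarrow> bool" where
  "temporal_gauge P Q \<Phi> A \<longleftrightarrow> (\<forall>r>0. \<forall>z\<in>points (tot Q). gauge_h P \<Phi> A r z = 0)"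

definition dilation_invariant :: "('p, 'q::real_normed_vector, 'b, 'h) bundle_struct \<Rightarrow>
    ('s, 't::real_normed_vector, 'a, 'h) bundle_struct \<Rightarrow>
    (real \<times> 's \<Rightarrow> 'p) \<Rightarrow> ('p \<Rightarrow> 'q \<Rightarrow> 'g::real_normed_vector) \<Rightarrow> bool" where
  "dilation_invariant P Q \<Phi> A \<longleftrightarrow> (\<forall>r>0. \<forall>z\<in>points (tot Q). \<forall>v.
     ((\<lambda>s. gauge_B P Q \<Phi> A s z v) has_vector_derivative 0) (at r))"


section \<open>Instantons\<close>


definition Sp_instanton :: "nat \<Rightarrow> ('a, 'e::real_normed_vector) atlas \<Rightarrow>
    ('a \<Rightarrow> 'e \<Rightarrow> 'e \<Rightarrow> real) \<Rightarrow> ('a \<Rightarrow> 'e \<Rightarrow> 'e) \<Rightarrow> ('a \<Rightarrow> 'e \<Rightarrow> 'e) \<Rightarrow> ('a \<Rightarrow> 'e \<Rightarrow> 'e) \<Rightarrow>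
    ('h, 'g::real_normed_vector) lie_struct \<Rightarrow> ('p, 'q::real_normed_vector, 'a, 'h) bundle_struct \<Rightarrow>
    ('p \<Rightarrow> 'q \<Rightarrow> 'g) \<Rightarrow> bool" where
  "Sp_instanton n \<C> g I J K G P A \<longleftrightarrow> (\<forall>p\<in>points (tot P). \<exists>\<beta>.
     represents_at \<C> P (curvature G P A) p \<beta> \<and> two_form \<beta> \<and>
     (\<forall>L\<in>{I, J, K}. type11 UNIV (L (proj P p)) \<beta> \<and>
        (\<forall>v. wedge 2 (2 * (2 * n + 1)) (as_form \<beta>)
               (wedge_power (kaehler_form g L (proj P p)) (2 * n + 1)) v = 0)))"

text \<open>\<open>\<alpha> = (r \<partial>\<^sub>r \<lrcorner> \<omega>)|\<^sub>M\<close> for the Kaehler form \<open>\<omega>\<close> of the complex structure \<open>L\<close> on the cone\<close>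

definition contact_form :: "('a, 'e::real_normed_vector) atlas \<Rightarrow> ('a \<Rightarrow> 'e \<Rightarrow> 'e \<Rightarrow> real) \<Rightarrow>
    (real \<times> 'a \<Rightarrow> real \<times> 'e \<Rightarrow> real \<times> 'e) \<Rightarrow> 'a \<Rightarrow> 'e \<Rightarrow> real" where
  "contact_form \<M> g L x v =
     kaehler_form (cone_metric \<M> g) L (slice 1 x) (euler_field \<M> (slice 1 x))
       (tangent_map \<M> (cone \<M>) (slice 1) x v)"

definition tri_horizontal :: "('a, 'e::real_normed_vector) atlas \<Rightarrow> ('a \<Rightarrow> 'e \<Rightarrow> 'e \<Rightarrow> real) \<Rightarrow>
    (real \<times> 'a \<Rightarrow> real \<times> 'e \<Rightarrow> real \<times> 'e) \<Rightarrow> (real \<times> 'a \<Rightarrow> real \<times> 'e \<Rightarrow> real \<times> 'e) \<Rightarrow>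
    (real \<times> 'a \<Rightarrow> real \<times> 'e \<Rightarrow> real \<times> 'e) \<Rightarrow> 'a \<Rightarrow> 'e set" where
  "tri_horizontal \<M> g I J K x = {v. \<forall>L\<in>{I, J, K}. contact_form \<M> g L x v = 0}"

text \<open>The complex structure induced on the horizontal subspace, which the tangent map of \<open>x \<mapsto> (1, x)\<close>
  embeds into the tangent space of the cone: as \<open>L\<close> preserves the image of the horizontal
  subspace, the tangent map of the projection to \<open>M\<close> brings the vector back.\<close>

definition link_endo :: "('a, 'e::real_normed_vector) atlas \<Rightarrow>
    (real \<times> 'a \<Rightarrow> real \<times> 'e \<Rightarrow> real \<times> 'e) \<Rightarrow> 'a \<Rightarrow> 'e \<Rightarrow> 'e" where
  "link_endo \<M> L x u = tangent_map (cone \<M>) \<M> snd (slice 1 x)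
     (L (slice 1 x) (tangent_map \<M> (cone \<M>) (slice 1) x u))"

text \<open>The fibre at \<open>x\<close> of the bundle of 2-forms in the definition of a tri-contact instanton, tensored
  with the coefficient space \<open>'b\<close>.\<close>

definition tri_contact_forms :: "('a, 'e::real_normed_vector) atlas \<Rightarrow> ('a \<Rightarrow> 'e \<Rightarrow> 'e \<Rightarrow> real) \<Rightarrow>
    (real \<times> 'a \<Rightarrow> real \<times> 'e \<Rightarrow> real \<times> 'e) \<Rightarrow> (real \<times> 'a \<Rightarrow> real \<times> 'e \<Rightarrow> real \<times> 'e) \<Rightarrow>
    (real \<times> 'a \<Rightarrow> real \<times> 'e \<Rightarrow> real \<times> 'e) \<Rightarrow> 'a \<Rightarrow> ('e \<Rightarrow> 'e \<Rightarrow> 'b::real_vector) set" where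
  "tri_contact_forms \<M> g I J K x = (let H = tri_horizontal \<M> g I J K x in
     {\<beta>. two_form \<beta> \<and> (\<forall>u. (\<forall>w\<in>H. g x u w = 0) \<longrightarrow> (\<forall>v. \<beta> u v = 0)) \<and>
         (\<forall>L\<in>{I, J, K}. type11 H (link_endo \<M> L x) \<beta>)})"

definition tri_contact_instanton :: "('a, 'e::real_normed_vector) atlas \<Rightarrow>
    ('a \<Rightarrow> 'e \<Rightarrow> 'e \<Rightarrow> real) \<Rightarrow>
    (real \<times> 'a \<Rightarrow> real \<times> 'e \<Rightarrow> real \<times> 'e) \<Rightarrow> (real \<times> 'a \<Rightarrow> real \<times> 'e \<Rightarrow> real \<times> 'e) \<Rightarrow>
    (real \<times> 'a \<Rightarrow> real \<times> 'e \<Rightarrow> real \<times> 'e) \<Rightarrow>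
    ('h, 'g::real_normed_vector) lie_struct \<Rightarrow> ('s, 't::real_normed_vector, 'a, 'h) bundle_struct \<Rightarrow>
    ('s \<Rightarrow> 't \<Rightarrow> 'g) \<Rightarrow> bool" where
  "tri_contact_instanton \<M> g I J K G Q B \<longleftrightarrow> (\<forall>z\<in>points (tot Q). \<exists>\<beta>.
     represents_at \<M> Q (curvature G Q B) z \<beta> \<and>
     \<beta> \<in> tri_contact_forms \<M> g I J K (proj Q z))"

end

theory Submission
  imports Defs
begin

text \<open>
  Let \<open>B = \<iota>\<^sup>*A\<close> be the connection on the link. The temporal gauge removes the radial component of \<open>A\<close>, and
  dilation invariance makes the remaining part independent of the radius, so \<open>A = \<Psi>\<^sup>*B\<close> for the map \<open>\<Psi> : P \<rightarrow> \<iota>\<^sup>*P\<close>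
  that forgets the radius (\<open>connection_eq\<close>). As the exterior derivative commutes with pullbacks
  (\<open>ext_deriv1_pullback\<close>), the curvatures satisfy \<open>F\<^sub>A = \<Psi>\<^sup>*F\<^sub>B\<close> (\<open>curvature_eq\<close>). On the base this means that the
  curvature of \<open>A\<close> is the pullback of the curvature of \<open>B\<close> along the projection of the cone to its link. In
  particular the latter is the restriction of the former, and the former annihilates the Euler field
  \<open>E = r \<partial>\<^sub>r\<close> (\<open>curvature_radial\<close>).

  The rest is linear algebra in a single tangent space of the cone. A 2-form \<open>\<beta>\<close> has type (1,1) for a complex
  structure \<open>L\<close> iff \<open>\<beta> (L u) (L v) = \<beta> u v\<close> for all \<open>u\<close> and \<open>v\<close> (\<open>type11_UNIV_iff\<close>). The vectors \<open>I E, J E, K E\<close> are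
  orthonormal at radius 1, tangent to the link, and dual to the contact forms, so the horizontal space of
  the link is the orthogonal complement of the quaternionic line spanned by \<open>E\<close>. If \<open>\<beta>\<close> has type (1,1) for \<open>I, J, K\<close>
  and annihilates \<open>E\<close>, then it annihilates this line and is a form on the horizontal space
  (\<open>tri_contact_restrict\<close>). Conversely, \<open>I, J, K\<close> preserve the line and its complement, so the lift of a
  tri-contact form has type (1,1) at radius 1 (\<open>tri_contact_lift\<close>), and by dilation at every radius.

  The condition \<open>\<beta> \<and> \<omega>\<^sub>L\<^bsup>2n+1\<^esup> = 0\<close> then holds automatically. Let \<open>M\<close> be one of \<open>I, J, K\<close> that anticommutes with \<open>L\<close>.
  It preserves \<open>\<beta>\<close> and reverses \<open>\<omega>\<^sub>L\<close>, so it reverses \<open>\<beta> \<and> \<omega>\<^sub>L\<^bsup>2n+1\<^esup>\<close>. But this form has top degree, so \<open>M\<close> multiplies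
  it by the determinant of \<open>M\<close>, which is positive because \<open>M\<close> is the square of \<open>(1 + M) / sqrt 2\<close>
  (\<open>wedge_odd_power_eq_0\<close>).
\<close>

section \<open>Symmetry of second derivatives\<close>

text \<open>The mean value theorem in the direction \<open>u\<close> and then in the direction \<open>v\<close> turns the mixed increment of
  \<open>f\<close> into a mixed second derivative at an intermediate point. The increment does not change when \<open>u\<close>
  and \<open>v\<close> are exchanged, so the second derivative is symmetric in the limit.\<close>

lemma mixed_increment:
  fixes f :: "'a::real_normed_vector \<Rightarrow> real"
  assumes t: "0 < t"
    and f: "\<And>a b. 0 \<le> a \<Longrightarrow> a \<le> t \<Longrightarrow> 0 \<le> b \<Longrightarrow> b \<le> t \<Longrightarrow>
      f differentiable at (x + a *\<^sub>R u + b *\<^sub>R v)"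
    and fu: "\<And>a b. 0 \<le> a \<Longrightarrow> a \<le> t \<Longrightarrow> 0 \<le> b \<Longrightarrow> b \<le> t \<Longrightarrow>
      (\<lambda>y. frechet_derivative f (at y) u) differentiable at (x + a *\<^sub>R u + b *\<^sub>R v)"
  obtains a b where "0 < a" "a < t" "0 < b" "b < t"
    "f (x + t *\<^sub>R u + t *\<^sub>R v) - f (x + t *\<^sub>R u) - f (x + t *\<^sub>R v) + f x =
     t * (t * frechet_derivative (\<lambda>y. frechet_derivative f (at y) u) (at (x + a *\<^sub>R u + b *\<^sub>R v)) v)"
proof -
  let ?d = "\<lambda>y. frechet_derivative f (at y) u"
  have d1: "((\<lambda>a. f (x + a *\<^sub>R u + b *\<^sub>R v)) has_field_derivative ?d (x + a *\<^sub>R u + b *\<^sub>R v)) (at a)"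
    if "0 \<le> a" "a \<le> t" "0 \<le> b" "b \<le> t" for a b
  proof -
    have F: "(f has_derivative frechet_derivative f (at (x + a *\<^sub>R u + b *\<^sub>R v))) (at (x + a *\<^sub>R u
        + b *\<^sub>R v))"
      using f[OF that] frechet_derivative_works by blast
    have "((\<lambda>a. f (x + a *\<^sub>R u + b *\<^sub>R v)) has_derivative
        (\<lambda>h. frechet_derivative f (at (x + a *\<^sub>R u + b *\<^sub>R v)) (h *\<^sub>R u))) (at a)"
      by (rule has_derivative_compose[where g = f and f
          = "\<lambda>a. x + a *\<^sub>R u + b *\<^sub>R v", OF _ F]) (auto intro!: derivative_eq_intros)
    moreover have "frechet_derivative f (at (x + a *\<^sub>R u + b *\<^sub>R v)) (h *\<^sub>R u)
        = ?d (x + a *\<^sub>R u + b *\<^sub>R v) * h" for h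
      using linear_cmul[OF has_derivative_linear[OF F]] by (simp add: mult.commute)
    ultimately show ?thesis by (simp add: has_field_derivative_def)
  qed
  have d2: "((\<lambda>b. ?d (x + a *\<^sub>R u + b *\<^sub>R v)) has_field_derivative
      frechet_derivative ?d (at (x + a *\<^sub>R u + b *\<^sub>R v)) v) (at b)"
    if "0 \<le> a" "a \<le> t" "0 \<le> b" "b \<le> t" for a b
  proof -
    have F: "(?d has_derivative frechet_derivative ?d (at (x + a *\<^sub>R u + b *\<^sub>R v))) (at (x + a *\<^sub>R u
        + b *\<^sub>R v))"
      using fu[OF that] frechet_derivative_works by blast
    have "((\<lambda>b. ?d (x + a *\<^sub>R u + b *\<^sub>R v)) has_derivative
        (\<lambda>h. frechet_derivative ?d (at (x + a *\<^sub>R u + b *\<^sub>R v)) (h *\<^sub>R v))) (at b)"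
      by (rule has_derivative_compose[where g = ?d
          and f = "\<lambda>b. x + a *\<^sub>R u + b *\<^sub>R v", OF _ F]) (auto intro!: derivative_eq_intros)
    moreover have "frechet_derivative ?d (at (x + a *\<^sub>R u + b *\<^sub>R v)) (h *\<^sub>R v) =
        frechet_derivative ?d (at (x + a *\<^sub>R u + b *\<^sub>R v)) v * h" for h
      using linear_cmul[OF has_derivative_linear[OF F]] by (simp add: mult.commute)
    ultimately show ?thesis by (simp add: has_field_derivative_def)
  qed
  have "\<exists>a>0. a < t \<and> (f (x + t *\<^sub>R u + t *\<^sub>R v) - f (x + t *\<^sub>R u + 0 *\<^sub>R v)) -
      (f (x + 0 *\<^sub>R u + t *\<^sub>R v) - f (x + 0 *\<^sub>R u + 0 *\<^sub>R v)) =
      (t - 0) * (?d (x + a *\<^sub>R u + t *\<^sub>R v) - ?d (x + a *\<^sub>R u + 0 *\<^sub>R v))"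
    by (rule MVT2[OF t, where f = "\<lambda>a. f (x + a *\<^sub>R u + t *\<^sub>R v) - f (x + a *\<^sub>R u + 0 *\<^sub>R v)"])
      (use t in \<open>intro DERIV_diff d1; simp\<close>)
  then obtain a where a: "0 < a" "a < t" and eq: "f (x + t *\<^sub>R u + t *\<^sub>R v) - f (x + t *\<^sub>R u) -
      (f (x + t *\<^sub>R v) - f x) = t * (?d (x + a *\<^sub>R u + t *\<^sub>R v) - ?d (x + a *\<^sub>R u))"
    by auto
  have "\<exists>b>0. b < t \<and> ?d (x + a *\<^sub>R u + t *\<^sub>R v) - ?d (x + a *\<^sub>R u + 0 *\<^sub>R v) =
      (t - 0) * frechet_derivative ?d (at (x + a *\<^sub>R u + b *\<^sub>R v)) v"
    by (rule MVT2[OF t]) (use a in \<open>intro d2; simp\<close>)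
  then obtain b where "0 < b" "b < t"
    "?d (x + a *\<^sub>R u + t *\<^sub>R v) - ?d (x + a *\<^sub>R u)
        = t * frechet_derivative ?d (at (x + a *\<^sub>R u + b *\<^sub>R v)) v"
    by auto
  with a eq show ?thesis by (intro that[of a b]) auto
qed

lemma Ck_on_2D:
  assumes "Ck_on 2 S f"
  shows "x \<in> S \<Longrightarrow> f differentiable at x"
    "x \<in> S \<Longrightarrow> (\<lambda>y. frechet_derivative f (at y) u) differentiable at x"
    "continuous_on S (\<lambda>y. frechet_derivative (\<lambda>y. frechet_derivative f (at y) u) (at y) v)"
  using assms by (auto simp: numeral_2_eq_2)

lemma second_derivative_symmetric_real:
  fixes f :: "'a::real_normed_vector \<Rightarrow> real"
  assumes S: "open S" "x \<in> S" and f: "Ck_on 2 S f"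
  shows "frechet_derivative (\<lambda>y. frechet_derivative f (at y) u) (at x) v =
    frechet_derivative (\<lambda>y. frechet_derivative f (at y) v) (at x) u"
proof -
  let ?a = "\<lambda>y. frechet_derivative (\<lambda>y. frechet_derivative f (at y) u) (at y) v"
  let ?b = "\<lambda>y. frechet_derivative (\<lambda>y. frechet_derivative f (at y) v) (at y) u"
  have ca: "isCont ?a x" and cb: "isCont ?b x"
    using Ck_on_2D(3)[OF f] S by (simp_all add: continuous_on_eq_continuous_at)
  have "\<bar>?a x - ?b x\<bar> < e" if e: "e > 0" for e
  proof -
    obtain d1 where d1: "d1 > 0" "\<And>y. dist y x < d1 \<Longrightarrow> dist (?a y) (?a x) < e / 2"
      using ca e unfolding continuous_at_eps_delta by (meson half_gt_zero)
    obtain d2 where d2: "d2 > 0" "\<And>y. dist y x < d2 \<Longrightarrow> dist (?b y) (?b x) < e / 2"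
      using cb e unfolding continuous_at_eps_delta by (meson half_gt_zero)
    obtain d3 where d3: "d3 > 0" "ball x d3 \<subseteq> S" using S open_contains_ball by metis
    define d where "d = min d1 (min d2 d3)"
    have d: "d > 0" using d1 d2 d3 by (simp add: d_def)
    \<comment> \<open>all increments up to \<open>t\<close> in both directions stay within distance \<open>d / 2\<close> of \<open>x\<close>\<close>
    define c where "c = norm u + norm v + 1"
    have pos: "c > 0" by (simp add: c_def add_nonneg_pos)
    define t where "t = d / (2 * c)"
    have t: "t > 0" using d pos by (simp add: t_def)
    have near: "dist (x + a *\<^sub>R u + b *\<^sub>R v) x < d" if "0 \<le> a" "a \<le> t" "0 \<le> b" "b \<le> t" for a b
    proof -
      have "dist (x + a *\<^sub>R u + b *\<^sub>R v) x = norm (a *\<^sub>R u + b *\<^sub>R v)" by (simp add: dist_norm)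
      also have "\<dots> \<le> a * norm u + b * norm v" using that by
          (intro order_trans[OF norm_triangle_ineq]) simp
      also have "\<dots> \<le> t * norm u + t * norm v" using that by (intro add_mono mult_right_mono) auto
      also have "\<dots> \<le> t * c" using t by (simp add: c_def algebra_simps)
      also have "\<dots> = d / 2" using pos by (simp add: t_def)
      finally show ?thesis using d by simp
    qed
    have inS: "x + a *\<^sub>R u + b *\<^sub>R v \<in> S" if "0 \<le> a" "a \<le> t" "0 \<le> b" "b \<le> t" for a b
      using near[OF that] d3 by (auto simp: d_def dist_commute)
    have inS': "x + a *\<^sub>R v + b *\<^sub>R u \<in> S" if "0 \<le> a" "a \<le> t" "0 \<le> b" "b \<le> t" for a b
      using inS[of b a] that by (simp add: add.commute add.left_commute)
    obtain a b where ab: "0 < a" "a < t" "0 < b" "b < t"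
      "f (x + t *\<^sub>R u + t *\<^sub>R v) - f (x + t *\<^sub>R u) - f (x + t *\<^sub>R v) + f x
          = t * (t * ?a (x + a *\<^sub>R u + b *\<^sub>R v))"
      by (rule mixed_increment[of t f x u v]) (use t inS Ck_on_2D(1,2)[OF f] in blast)+
    obtain a' b' where ab': "0 < a'" "a' < t" "0 < b'" "b' < t"
      "f (x + t *\<^sub>R v + t *\<^sub>R u) - f (x + t *\<^sub>R v) - f (x + t *\<^sub>R u) + f x
          = t * (t * ?b (x + a' *\<^sub>R v + b' *\<^sub>R u))"
      by (rule mixed_increment[of t f x v u]) (use t inS' Ck_on_2D(1,2)[OF f] in blast)+
    have "t * (t * ?a (x + a *\<^sub>R u + b *\<^sub>R v)) = t * (t * ?b (x + a' *\<^sub>R v + b' *\<^sub>R u))"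
      using ab(5) ab'(5) by (simp add: algebra_simps)
    then have "?a (x + a *\<^sub>R u + b *\<^sub>R v) = ?b (x + b' *\<^sub>R u + a' *\<^sub>R v)"
      using t by (simp add: algebra_simps)
    moreover have "dist (?a (x + a *\<^sub>R u + b *\<^sub>R v)) (?a x) < e / 2"
      using near[of a b] ab by (intro d1(2)) (simp add: d_def)
    moreover have "dist (?b (x + b' *\<^sub>R u + a' *\<^sub>R v)) (?b x) < e / 2"
      using near[of b' a'] ab' by (intro d2(2)) (simp add: d_def)
    ultimately show ?thesis unfolding dist_real_def by linarith
  qed
  then have "\<not> \<bar>?a x - ?b x\<bar> > 0" by blast
  then show ?thesis by simp
qed

lemma frechet_derivative_inner_right:
  assumes "f differentiable at x"
  shows "frechet_derivative (\<lambda>y. f y \<bullet> i) (at x) v = frechet_derivative f (at x) v \<bullet> i"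
    "(\<lambda>y. f y \<bullet> i) differentiable at x"
proof -
  have "((\<lambda>y. f y \<bullet> i) has_derivative (\<lambda>v. frechet_derivative f (at x) v \<bullet> i)) (at x)"
    using assms by (intro has_derivative_inner_left) (simp add: frechet_derivative_works)
  then show "frechet_derivative (\<lambda>y. f y \<bullet> i) (at x) v = frechet_derivative f (at x) v \<bullet> i"
    "(\<lambda>y. f y \<bullet> i) differentiable at x"
    by (auto simp: frechet_derivative_at[symmetric] differentiable_def dest: frechet_derivative_at)
qed

lemma frechet_derivative_cong_open:
  assumes "open S" "x \<in> S" "\<And>y. y \<in> S \<Longrightarrow> f y = g y"
  shows "frechet_derivative f (at x) = frechet_derivative g (at x)"
    "f differentiable at x \<longleftrightarrow> g differentiable at x"
proof -
  have "(f has_derivative F) (at x) \<longleftrightarrow> (g has_derivative F) (at x)" for F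
    using assms has_derivative_transform_within_open by (metis (no_types, lifting))
  then show "frechet_derivative f (at x) = frechet_derivative g (at x)"
    "f differentiable at x \<longleftrightarrow> g differentiable at x"
    by (simp_all add: frechet_derivative_def differentiable_def)
qed

lemma Ck_on_cong_open:
  assumes "open S" "\<And>y. y \<in> S \<Longrightarrow> f y = g y"
  shows "Ck_on k S f \<longleftrightarrow> Ck_on k S g"
  using assms(2)
proof (induction k arbitrary: f g)
  case 0
  then show ?case by (auto cong: continuous_on_cong)
next
  case (Suc k)
  have "frechet_derivative f (at y) = frechet_derivative g (at y)" if "y \<in> S" for y
    using frechet_derivative_cong_open(1)[OF assms(1) that] Suc.prems by blast
  then have "Ck_on k S (\<lambda>y. frechet_derivative f (at y) v)
      \<longleftrightarrow> Ck_on k S (\<lambda>y. frechet_derivative g (at y) v)" for v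
    by (intro Suc.IH) simp
  moreover have "f differentiable at y \<longleftrightarrow> g differentiable at y" if "y \<in> S" for y
    using frechet_derivative_cong_open(2)[OF assms(1) that] Suc.prems by blast
  ultimately show ?case by simp
qed

lemma Ck_on_inner_right:
  assumes "open S" "Ck_on k S f"
  shows "Ck_on k S (\<lambda>y. f y \<bullet> i)"
  using assms(2)
proof (induction k arbitrary: f)
  case 0
  then show ?case by (auto intro!: continuous_intros)
next
  case (Suc k)
  have "Ck_on k S (\<lambda>y. frechet_derivative (\<lambda>y. f y \<bullet> i) (at y) v)" for v
  proof -
    have "Ck_on k S (\<lambda>y. frechet_derivative f (at y) v \<bullet> i)" using Suc by simp
    moreover have "frechet_derivative (\<lambda>y. f y \<bullet> i) (at y) v
        = frechet_derivative f (at y) v \<bullet> i" if "y \<in> S" for y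
      using Suc.prems that by (intro frechet_derivative_inner_right) simp
    ultimately show ?thesis
      using Ck_on_cong_open[OF assms(1), of "\<lambda>y. frechet_derivative (\<lambda>y. f y \<bullet> i) (at y) v"
          "\<lambda>y. frechet_derivative f (at y) v \<bullet> i" k] by simp
  qed
  with Suc.prems show ?case by (simp add: frechet_derivative_inner_right)
qed

text \<open>This symmetry is what makes the exterior derivative commute with pullbacks.\<close>

lemma second_derivative_symmetric:
  fixes f :: "'a::real_normed_vector \<Rightarrow> 'b::euclidean_space"
  assumes S: "open S" "x \<in> S" and f: "Ck_on 2 S f"
  shows "frechet_derivative (\<lambda>y. frechet_derivative f (at y) u) (at x) v =
    frechet_derivative (\<lambda>y. frechet_derivative f (at y) v) (at x) u"
proof (rule euclidean_eqI)
  fix i :: 'b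
  have *: "frechet_derivative (\<lambda>y. frechet_derivative f (at y) u) (at x) v \<bullet> i =
      frechet_derivative (\<lambda>y. frechet_derivative (\<lambda>y. f y \<bullet> i) (at y) u) (at x) v" for u v
  proof -
    have "frechet_derivative (\<lambda>y. frechet_derivative (\<lambda>y. f y \<bullet> i) (at y) u) (at x) =
        frechet_derivative (\<lambda>y. frechet_derivative f (at y) u \<bullet> i) (at x)"
      using Ck_on_2D(1)[OF f] by (intro frechet_derivative_cong_open(1)[OF S]
          frechet_derivative_inner_right)
    then show ?thesis using Ck_on_2D(2)[OF f S(2)] by (simp add: frechet_derivative_inner_right)
  qed
  show "frechet_derivative (\<lambda>y. frechet_derivative f (at y) u) (at x) v \<bullet> i =
    frechet_derivative (\<lambda>y. frechet_derivative f (at y) v) (at x) u \<bullet> i"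
    unfolding * by (rule second_derivative_symmetric_real[OF S Ck_on_inner_right[OF S(1) f]])
qed

section \<open>Alternating forms of top degree\<close>

definition multilinear :: "nat \<Rightarrow> ((nat \<Rightarrow> 'v::real_vector) \<Rightarrow> 'b::real_vector) \<Rightarrow> bool" where
  "multilinear k \<alpha> \<longleftrightarrow> (\<forall>v w. (\<forall>i<k. v i = w i) \<longrightarrow> \<alpha> v = \<alpha> w) \<and>
     (\<forall>i<k. \<forall>v. linear (\<lambda>x. \<alpha> (v(i := x))))"

lemma multilinear_cong: "multilinear k \<alpha> \<Longrightarrow> (\<And>i. i < k \<Longrightarrow> v i = w i) \<Longrightarrow> \<alpha> v = \<alpha> w"
  by (simp add: multilinear_def)

lemma multilinear_linear: "multilinear k \<alpha> \<Longrightarrow> i < k \<Longrightarrow> linear (\<lambda>x. \<alpha> (v(i := x)))"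
  by (simp add: multilinear_def)

definition alternating :: "nat \<Rightarrow> ((nat \<Rightarrow> 'v::real_vector) \<Rightarrow> 'b::real_vector) \<Rightarrow> bool" where
  "alternating k \<alpha> \<longleftrightarrow> (\<forall>\<pi> v. \<pi> permutes {..<k} \<longrightarrow> \<alpha> (v \<circ> \<pi>) = of_int (sign \<pi>) *\<^sub>R \<alpha> v)"

text \<open>Composing with \<open>\<pi>\<close> permutes the summands of the wedge product, whatever the two factors are.\<close>

lemma alternating_wedge: "alternating (k + l) (wedge k l \<alpha> \<beta>)"
  unfolding alternating_def
proof (intro allI impI)
  fix \<pi> v
  assume \<pi>: "\<pi> permutes {..<k + l}"
  let ?t = "\<lambda>\<sigma>. (of_int (sign \<sigma>) * \<beta> (\<lambda>i. v (\<sigma> (k + i)))) *\<^sub>R \<alpha> (\<lambda>i. v (\<sigma> i))"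
  have s: "of_int (sign \<pi>) * (of_int (sign \<pi>) :: real) = 1"
    by (simp add: sign_def)
  have "(\<Sum>\<sigma> | \<sigma> permutes {..<k + l}. ?t \<sigma>) = (\<Sum>\<sigma> | \<sigma> permutes {..<k + l}. ?t (\<pi> \<circ> \<sigma>))"
    by (rule setum_permutations_compose_left[OF \<pi>])
  also have "\<dots> = (\<Sum>\<sigma> | \<sigma> permutes {..<k + l}. of_int (sign \<pi>) *\<^sub>R
      ((of_int (sign \<sigma>) * \<beta> (\<lambda>i. (v \<circ> \<pi>) (\<sigma> (k + i)))) *\<^sub>R \<alpha> (\<lambda>i. (v \<circ> \<pi>) (\<sigma> i))))"
  proof (rule sum.cong[OF refl])
    fix \<sigma> assume "\<sigma> \<in> {\<sigma>. \<sigma> permutes {..<k + l}}"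
    then have "sign (\<pi> \<circ> \<sigma>) = sign \<pi> * sign \<sigma>"
      using \<pi> by (intro sign_compose) (auto intro: permutes_imp_permutation[of "{..<k + l}"])
    then show "?t (\<pi> \<circ> \<sigma>) = of_int (sign \<pi>) *\<^sub>R
      ((of_int (sign \<sigma>) * \<beta> (\<lambda>i. (v \<circ> \<pi>) (\<sigma> (k + i)))) *\<^sub>R \<alpha> (\<lambda>i. (v \<circ> \<pi>) (\<sigma> i)))"
      by (simp add: mult.assoc)
  qed
  also have "\<dots> = of_int (sign \<pi>) *\<^sub>R (\<Sum>\<sigma> | \<sigma> permutes {..<k + l}.
      (of_int (sign \<sigma>) * \<beta> (\<lambda>i. (v \<circ> \<pi>) (\<sigma> (k + i)))) *\<^sub>R \<alpha> (\<lambda>i. (v \<circ> \<pi>) (\<sigma> i)))"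
    by (rule scaleR_sum_right[symmetric])
  finally have "wedge k l \<alpha> \<beta> v = of_int (sign \<pi>) *\<^sub>R wedge k l \<alpha> \<beta> (v \<circ> \<pi>)"
    unfolding wedge_def by (simp only: scaleR_scaleR mult.commute)
  then show "wedge k l \<alpha> \<beta> (v \<circ> \<pi>) = of_int (sign \<pi>) *\<^sub>R wedge k l \<alpha> \<beta> v"
    by (simp add: s)
qed

lemma multilinear_wedge:
  assumes \<alpha>: "multilinear k \<alpha>" and \<beta>: "multilinear l \<beta>"
  shows "multilinear (k + l) (wedge k l \<alpha> \<beta>)"
  unfolding multilinear_def
proof (intro conjI allI impI)
  fix v w :: "nat \<Rightarrow> 'a"
  assume vw: "\<forall>i<k + l. v i = w i"
  have "\<alpha> (\<lambda>i. v (\<sigma> i)) = \<alpha> (\<lambda>i. w (\<sigma> i))" "\<beta> (\<lambda>i. v (\<sigma> (k + i))) = \<beta> (\<lambda>i. w (\<sigma> (k + i)))"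
    if "\<sigma> permutes {..<k + l}" for \<sigma>
  proof -
    have "\<sigma> i < k + l" if "i < k + l" for i
      using permutes_in_image[OF \<open>\<sigma> permutes {..<k + l}\<close>, of i] that by simp
    then show "\<alpha> (\<lambda>i. v (\<sigma> i)) = \<alpha> (\<lambda>i. w (\<sigma> i))"
      "\<beta> (\<lambda>i. v (\<sigma> (k + i))) = \<beta> (\<lambda>i. w (\<sigma> (k + i)))"
      using vw by (auto intro!: multilinear_cong[OF \<alpha>] multilinear_cong[OF \<beta>])
  qed
  then show "wedge k l \<alpha> \<beta> v = wedge k l \<alpha> \<beta> w"
    unfolding wedge_def by (intro arg_cong2[where f = scaleR] sum.cong) auto
next
  fix i and v :: "nat \<Rightarrow> 'a" assume i: "i < k + l"
  let ?v = "\<lambda>x. v(i := x)"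
  let ?t = "\<lambda>\<sigma> x. (of_int (sign \<sigma>) * \<beta> (\<lambda>m. ?v x (\<sigma> (k + m)))) *\<^sub>R \<alpha> (\<lambda>m. ?v x (\<sigma> m))"
  have "linear (?t \<sigma>)" if \<sigma>: "\<sigma> permutes {..<k + l}" for \<sigma>
  proof -
    define m where "m = inv_into UNIV \<sigma> i"
    have m: "m < k + l" using permutes_in_image[OF permutes_inv[OF \<sigma>], of i] i by (simp add: m_def)
    have v: "?v x (\<sigma> q) = ((v \<circ> \<sigma>)(m := x)) q" for x q
      using permutes_inverses[OF \<sigma>] by (auto simp: m_def)
    show ?thesis
    proof (cases "m < k")
      case True
      \<comment> \<open>the argument \<open>x\<close> ends up in the first factor, and the second does not depend on it\<close>
      have const: "\<beta> (\<lambda>q. ?v x (\<sigma> (k + q))) = \<beta> (\<lambda>q. v (\<sigma> (k + q)))" for x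
        unfolding v using True by simp
      have "linear (\<lambda>x. \<alpha> ((v \<circ> \<sigma>)(m := x)))"
        by (rule multilinear_linear[OF \<alpha> True])
      then show ?thesis unfolding const unfolding v by (rule linear_compose_scale_right)
    next
      case False
      have const: "\<alpha> (\<lambda>q. ?v x (\<sigma> q)) = \<alpha> (\<lambda>q. v (\<sigma> q))" for x
        unfolding v using False by (intro multilinear_cong[OF \<alpha>]) auto
      have eq: "\<beta> (\<lambda>q. ?v x (\<sigma> (k + q))) = \<beta> ((\<lambda>q. v (\<sigma> (k + q)))(m - k := x))" for x
        unfolding v using False by (intro arg_cong[where f = \<beta>]) (auto simp: fun_eq_iff)
      have lin: "linear (\<lambda>x. \<beta> ((\<lambda>q. v (\<sigma> (k + q)))(m - k := x)))"
        using False m by (intro multilinear_linear[OF \<beta>]) simp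
      show ?thesis unfolding const eq
        by (rule linearI) (simp_all add: linear_add[OF lin] linear_cmul[OF lin] distrib_left
            scaleR_add_left mult.left_commute)
    qed
  qed
  then have "linear (\<lambda>x. \<Sum>\<sigma> | \<sigma> permutes {..<k + l}. ?t \<sigma> x)"
    by (intro linear_compose_sum) auto
  then show "linear (\<lambda>x. wedge k l \<alpha> \<beta> (?v x))"
    unfolding wedge_def by (rule linear_compose_scale_right)
qed

lemma multilinear_as_form:
  assumes "bilinear \<beta>"
  shows "multilinear 2 (as_form \<beta>)"
  unfolding multilinear_def
proof (intro conjI allI impI)
  fix v w :: "nat \<Rightarrow> 'a" assume "\<forall>i<2. v i = w i"
  then show "as_form \<beta> v = as_form \<beta> w" by (simp add: as_form_def)
next
  fix i :: nat and v :: "nat \<Rightarrow> 'a" assume "i < 2"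
  then consider "i = 0" | "i = 1" by linarith
  then show "linear (\<lambda>x. as_form \<beta> (v(i := x)))"
    using assms by cases (simp_all add: as_form_def bilinear_def)
qed

lemma multilinear_wedge_power:
  assumes "bilinear \<omega>"
  shows "multilinear (2 * m) (wedge_power \<omega> m)"
proof (induction m)
  case 0
  then show ?case by (simp add: multilinear_def)
next
  case (Suc m)
  show ?case using multilinear_wedge[OF multilinear_as_form[OF assms] Suc] by simp
qed

text \<open>Multilinearity replaces the arguments by members of the basis, one position at a time. If two of these
  basis vectors agree, their transposition shows that the value is its own negative; otherwise they
  are a permutation of the whole basis.\<close>

lemma top_form_eq_0:
  fixes \<Omega> :: "(nat \<Rightarrow> 'v::euclidean_space) \<Rightarrow> 'b::real_vector"
  assumes ml: "multilinear D \<Omega>" and alt: "alternating D \<Omega>"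
    and b: "span (b ` {..<D}) = UNIV" "\<Omega> b = 0"
  shows "\<Omega> v = 0"
proof -
  have basis: "\<Omega> (b \<circ> f) = 0" if f: "f ` {..<D} \<subseteq> {..<D}" for f
  proof (cases "inj_on f {..<D}")
    case True
    define \<pi> where "\<pi> i = (if i < D then f i else i)" for i
    have "f ` {..<D} = {..<D}" using True f by (simp add: endo_inj_surj)
    then have "bij_betw f {..<D} {..<D}" using True by (simp add: bij_betw_def)
    then have "bij_betw \<pi> {..<D} {..<D}" by (rule bij_betw_cong[THEN iffD1, rotated]) (simp add: \<pi>_def)
    then have "\<pi> permutes {..<D}" by (intro bij_imp_permutes) (auto simp: \<pi>_def)
    then have "\<Omega> (b \<circ> \<pi>) = 0" using alt b by (simp add: alternating_def)
    moreover have "\<Omega> (b \<circ> \<pi>) = \<Omega> (b \<circ> f)" by (rule multilinear_cong[OF ml]) (simp add: \<pi>_def)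
    ultimately show ?thesis by simp
  next
    case False
    then obtain i j where ij: "i < D" "j < D" "i \<noteq> j" "f i = f j" by (auto simp: inj_on_def)
    have "\<Omega> ((b \<circ> f) \<circ> Transposition.transpose i j) = - \<Omega> (b \<circ> f)"
      using alt ij permutes_swap_id[of i "{..<D}" j] by (simp add: alternating_def sign_swap_id)
    moreover have "(b \<circ> f) \<circ> Transposition.transpose i j = b \<circ> f"
      using ij by (auto simp: Transposition.transpose_def fun_eq_iff)
    ultimately have "\<Omega> (b \<circ> f) = - \<Omega> (b \<circ> f)" by simp
    then have "(2::real) *\<^sub>R \<Omega> (b \<circ> f) = 0" unfolding scaleR_2 by (metis add.right_inverse)
    then show ?thesis by simp
  qed
  \<comment> \<open>the arguments from position \<open>k\<close> on are already members of the basis\<close>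
  have "\<Omega> v = 0" if "k \<le> D" "\<And>i. k \<le> i \<Longrightarrow> i < D \<Longrightarrow> v i \<in> b ` {..<D}" for k v
    using that
  proof (induction k arbitrary: v)
    case 0
    then have "\<forall>i<D. \<exists>j<D. v i = b j" by auto
    then obtain f where "\<And>i. i < D \<Longrightarrow> f i < D \<and> v i = b (f i)" by metis
    then have "\<Omega> v = \<Omega> (b \<circ> f)" "f ` {..<D} \<subseteq> {..<D}" by (auto intro: multilinear_cong[OF ml])
    then show ?case using basis by simp
  next
    case (Suc k)
    have "linear (\<lambda>x. \<Omega> (v(k := x)))" using Suc.prems by (intro multilinear_linear[OF ml]) simp
    moreover have "\<Omega> (v(k := x)) = 0" if "x \<in> b ` {..<D}" for x
      using Suc.prems that by (intro Suc.IH) (auto simp: Suc_le_eq)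
    ultimately have "\<Omega> (v(k := v k)) = 0"
      by (rule linear_eq_0_on_span[where b = "b ` {..<D}"]) (use b in auto)
    then show ?case by simp
  qed
  from this[of D v] show ?thesis by simp
qed

lemma multilinear_comp_linear:
  assumes "multilinear k \<alpha>" "linear R"
  shows "multilinear k (\<lambda>v. \<alpha> (R \<circ> v))"
  unfolding multilinear_def
proof (intro conjI allI impI)
  fix v w :: "nat \<Rightarrow> 'c" assume "\<forall>i<k. v i = w i"
  then show "\<alpha> (R \<circ> v) = \<alpha> (R \<circ> w)" by (intro multilinear_cong[OF assms(1)]) simp
next
  fix i and v :: "nat \<Rightarrow> 'c" assume "i < k"
  then have "linear (\<lambda>y. \<alpha> ((R \<circ> v)(i := y)))" by (rule multilinear_linear[OF assms(1)])
  from linear_compose[OF assms(2) this] show "linear (\<lambda>x. \<alpha> (R \<circ> v(i := x)))"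
    by (simp add: comp_def fun_upd_def if_distrib[of R])
qed

lemma alternating_comp: "alternating k \<alpha> \<Longrightarrow> alternating k (\<lambda>v. \<alpha> (R \<circ> v))"
  by (simp add: alternating_def comp_assoc[symmetric] o_assoc)

text \<open>The factor is the determinant of \<open>R\<close>, found as the ratio of the values on one basis: the difference of
  both sides is again an alternating form of top degree, and it vanishes on that basis.\<close>

lemma real_top_form_pullback:
  fixes \<Omega> :: "(nat \<Rightarrow> 'v::euclidean_space) \<Rightarrow> real"
  assumes ml: "multilinear DIM('v) \<Omega>" and alt: "alternating DIM('v) \<Omega>" and R: "linear R"
  obtains d where "\<And>v. \<Omega> (R \<circ> v) = d * \<Omega> v"
proof -
  obtain b where "bij_betw b {..<DIM('v)} (Basis :: 'v set)"
    using ex_bij_betw_nat_finite[of "Basis :: 'v set"] by (auto simp: atLeast0LessThan)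
  then have b: "span (b ` {..<DIM('v)}) = UNIV" by (simp add: bij_betw_def)
  show ?thesis
  proof (cases "\<Omega> b = 0")
    case True
    then have "\<Omega> v = 0" for v by (rule top_form_eq_0[OF ml alt b])
    then show ?thesis by (intro that[of 0]) simp
  next
    case False
    define d where "d = \<Omega> (R \<circ> b) / \<Omega> b"
    have lin: "linear (\<lambda>x. f x - d * g x)" if "linear f" "linear g" for f g :: "'v \<Rightarrow> real"
      using linear_compose_sub[OF that(1) linear_compose_scale_right[OF that(2), of d]] by simp
    have "multilinear DIM('v) (\<lambda>v. \<Omega> (R \<circ> v) - d * \<Omega> v)"
      unfolding multilinear_def
      by (intro conjI allI impI lin multilinear_linear[OF ml] multilinear_linear[OF
          multilinear_comp_linear[OF ml R]]
          arg_cong2[where f = minus] arg_cong2[where f = times] refl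
          multilinear_cong[OF ml] multilinear_cong[OF multilinear_comp_linear[OF ml R]]) auto
    moreover have "alternating DIM('v) (\<lambda>v. \<Omega> (R \<circ> v) - d * \<Omega> v)"
      using alt alternating_comp[OF alt, of R] by (simp add: alternating_def algebra_simps)
    moreover have "\<Omega> (R \<circ> b) - d * \<Omega> b = 0" using False by (simp add: d_def)
    ultimately have "\<Omega> (R \<circ> v) - d * \<Omega> v = 0" for v by (rule top_form_eq_0[OF _ _ b])
    then show ?thesis by (intro that[of d]) simp
  qed
qed

text \<open>A complex structure \<open>M\<close> is the square of \<open>R = (1 + M) / sqrt 2\<close>, so its determinant is a square and
  cannot be \<open>- 1\<close>.\<close>

lemma top_form_complex_structure:
  fixes \<Omega> :: "(nat \<Rightarrow> 'v::euclidean_space) \<Rightarrow> 'b::real_vector"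
  assumes ml: "multilinear DIM('v) \<Omega>" and alt: "alternating DIM('v) \<Omega>"
    and M: "linear M" "\<And>u. M (M u) = - u" and neg: "\<And>v. \<Omega> (M \<circ> v) = - \<Omega> v"
  shows "\<Omega> v = 0"
proof (rule ccontr)
  assume "\<Omega> v \<noteq> 0"
  then have "independent {\<Omega> v}" by simp
  \<comment> \<open>a linear functional reduces the claim to real-valued forms\<close>
  then obtain \<phi> :: "'b \<Rightarrow> real" where \<phi>: "linear \<phi>" "\<phi> (\<Omega> v) = 1"
    using linear_independent_extend[of "{\<Omega> v}" "\<lambda>_. 1 :: real"] by auto
  define R where "R u = (1 / sqrt 2) *\<^sub>R (u + M u)" for u
  have R: "linear R" using M(1) unfolding R_def
    by (intro linear_compose_scale_right linear_compose_add linear_ident)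
  have "R (R u) = M u" for u
    by (simp add: R_def linear_add[OF M(1)] linear_cmul[OF M(1)] M(2) algebra_simps scaleR_2[symmetric])
  then have RR: "R \<circ> (R \<circ> v) = M \<circ> v" for v :: "nat \<Rightarrow> 'v" by (simp add: fun_eq_iff)
  have "multilinear DIM('v) (\<lambda>v. \<phi> (\<Omega> v))"
    using linear_compose[OF multilinear_linear[OF ml] \<phi>(1)] unfolding multilinear_def comp_def
    by (auto intro!: arg_cong[where f = \<phi>] multilinear_cong[OF ml])
  moreover have "alternating DIM('v) (\<lambda>v. \<phi> (\<Omega> v))"
    using alt by (simp add: alternating_def linear_cmul[OF \<phi>(1)])
  ultimately obtain d where d: "\<And>v. \<phi> (\<Omega> (R \<circ> v)) = d * \<phi> (\<Omega> v)"
    by (rule real_top_form_pullback[OF _ _ R]) blast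
  have "d * (d * \<phi> (\<Omega> v)) = \<phi> (\<Omega> (M \<circ> v))" using d by (simp flip: RR)
  also have "\<dots> = - \<phi> (\<Omega> v)" by (simp add: neg linear_neg[OF \<phi>(1)])
  finally show False using \<phi>(2) by (smt (verit) mult_cancel_left1 zero_le_square mult.assoc mult_1_right)
qed

lemma wedge_power_anti_invariant:
  assumes "\<And>u v. \<omega> (M u) (M v) = - \<omega> u v"
  shows "wedge_power \<omega> m (M \<circ> v) = (- 1) ^ m * wedge_power \<omega> m v"
proof (induction m arbitrary: v)
  case (Suc m)
  have "wedge_power \<omega> m (\<lambda>i. M (v (\<sigma> (2 + i)))) = (- 1) ^ m * wedge_power \<omega> m (\<lambda>i. v (\<sigma> (2 + i)))" for \<sigma>
    using Suc[of "\<lambda>i. v (\<sigma> (2 + i))"] by (simp add: comp_def)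
  then show ?case
    by (simp add: wedge_def as_form_def assms sum_distrib_left mult_ac)
qed simp

text \<open>The complex structure \<open>M\<close> fixes \<open>\<beta>\<close> and reverses \<open>\<omega>\<close>, so it reverses \<open>\<beta> \<and> \<omega>\<^sup>m\<close> for odd \<open>m\<close>, although it has
  to preserve this form of top degree. Thus a form that is invariant under a quaternionic structure is
  primitive without any computation of traces.\<close>

lemma wedge_odd_power_eq_0:
  fixes \<beta> :: "'v::euclidean_space \<Rightarrow> 'v \<Rightarrow> 'b::real_vector"
  assumes dim: "DIM('v) = 2 + 2 * m" and m: "odd m"
    and bil: "bilinear \<beta>" "bilinear \<omega>"
    and M: "linear M" "\<And>u. M (M u) = - u"
    and \<beta>: "\<And>u v. \<beta> (M u) (M v) = \<beta> u v" and \<omega>: "\<And>u v. \<omega> (M u) (M v) = - \<omega> u v"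
  shows "wedge 2 (2 * m) (as_form \<beta>) (wedge_power \<omega> m) v = 0"
proof (rule top_form_complex_structure[OF _ _ M])
  show "multilinear DIM('v) (wedge 2 (2 * m) (as_form \<beta>) (wedge_power \<omega> m))"
    unfolding dim by (intro multilinear_wedge multilinear_as_form multilinear_wedge_power bil)
  show "alternating DIM('v) (wedge 2 (2 * m) (as_form \<beta>) (wedge_power \<omega> m))"
    unfolding dim by (rule alternating_wedge)
  fix v :: "nat \<Rightarrow> 'v"
  have "wedge_power \<omega> m (\<lambda>i. M (v (\<sigma> (2 + i)))) = - wedge_power \<omega> m (\<lambda>i. v (\<sigma> (2 + i)))" for \<sigma>
    using wedge_power_anti_invariant[where \<omega> = \<omega> and M
        = M, OF \<omega>, of m "\<lambda>i. v (\<sigma> (2 + i))"] m by (simp add: comp_def)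
  then show "wedge 2 (2 * m) (as_form \<beta>) (wedge_power \<omega> m) (M \<circ> v)
      = - wedge 2 (2 * m) (as_form \<beta>) (wedge_power \<omega> m) v"
    by (simp add: wedge_def as_form_def \<beta> sum_negf)
qed

section \<open>Forms on a quaternionic vector space\<close>

text \<open>A vector \<open>a\<close> is the real part of the (1,0)-vector \<open>a - \<i> L a\<close>, which is the pair \<open>(a, - L a)\<close>. The complexified
  form takes two such vectors to a number with real part \<open>\<beta> a c - \<beta> (L a) (L c)\<close>.\<close>

lemma type11_invariant:
  assumes "type11 V L \<beta>" "a \<in> V" "c \<in> V" "L a \<in> V" "L c \<in> V"
    and "L (L a) = - a" "L (L c) = - c" "bilinear \<beta>" "\<And>x. x \<in> V \<Longrightarrow> - x \<in> V" "\<And>x. x \<in> V \<Longrightarrow> L (- x) = - L x"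
  shows "\<beta> (L a) (L c) = \<beta> a c"
proof -
  have "(a, - L a) \<in> holo V L" "(c, - L c) \<in> holo V L"
    using assms by (auto simp: holo_def)
  then have "complexify \<beta> (a, - L a) (c, - L c) = 0"
    using assms(1) unfolding type11_def by blast
  then have "\<beta> a c - \<beta> (- L a) (- L c) = 0" by (simp add: complexify_def zero_prod_def)
  then show ?thesis using assms(8) by (simp add: bilinear_lneg bilinear_rneg)
qed

lemma type11_UNIV_iff:
  assumes L: "linear L" "\<And>u. L (L u) = - u" and \<beta>: "bilinear \<beta>"
  shows "type11 UNIV L \<beta> \<longleftrightarrow> (\<forall>u v. \<beta> (L u) (L v) = \<beta> u v)"
proof
  assume "type11 UNIV L \<beta>"
  then show "\<forall>u v. \<beta> (L u) (L v) = \<beta> u v"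
    using type11_invariant[of UNIV L \<beta>] L \<beta> by (simp add: linear_neg)
next
  assume inv: "\<forall>u v. \<beta> (L u) (L v) = \<beta> u v"
  have skew: "\<beta> (L u) v = - \<beta> u (L v)" for u v
    using inv[rule_format, of u "L v"] \<beta> by (simp add: L(2) bilinear_rneg minus_equation_iff)
  have 1: "\<beta> a c - \<beta> b d = 0 \<and> \<beta> a d + \<beta> b c = 0" if "L a = - b" "L b = a" "L c = - d" "L d
      = c" for a b c d
  proof -
    have "\<beta> a c = \<beta> b d" using inv[rule_format, of b d] that by simp
    moreover have "\<beta> a d = - \<beta> b c" using skew[of b d] that by simp
    ultimately show ?thesis by simp
  qed
  have 2: "\<beta> a c - \<beta> b d = 0 \<and> \<beta> a d + \<beta> b c = 0" if "L a = b" "L b = - a" "L c = d" "L d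
      = - c" for a b c d
  proof -
    have "\<beta> b d = \<beta> a c" using inv[rule_format, of a c] that by simp
    moreover have "\<beta> b c = - \<beta> a d" using skew[of a c] that by simp
    ultimately show ?thesis by simp
  qed
  have "complexify \<beta> Z W = 0" if "Z \<in> holo UNIV L" "W \<in> holo UNIV L" for Z W
    using that 1[of "fst Z" "snd Z" "fst W" "snd W"]
    by (simp add: holo_def complexify_def zero_prod_def case_prod_unfold)
  moreover have "complexify \<beta> Z W = 0" if "Z \<in> antiholo UNIV L" "W \<in> antiholo UNIV L" for Z W
    using that 2[of "fst Z" "snd Z" "fst W" "snd W"]
    by (simp add: antiholo_def complexify_def zero_prod_def case_prod_unfold)
  ultimately show "type11 UNIV L \<beta>" by (simp add: type11_def)
qed

lemma bilinear_comp_linear: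
  assumes "bilinear \<beta>" "linear f"
  shows "bilinear (\<lambda>u v. \<beta> (f u) (f v))"
  using assms linear_compose[OF assms(2), of "\<beta> (f _)"] linear_compose[OF assms(2), of "\<lambda>u. \<beta> u (f _)"]
  unfolding bilinear_def comp_def by blast

lemma two_form_comp_linear:
  "two_form \<beta> \<Longrightarrow> linear f \<Longrightarrow> two_form (\<lambda>u v. \<beta> (f u) (f v))"
  by (simp add: two_form_def bilinear_comp_linear)

locale quaternionic =
  fixes I J K :: "'v::real_vector \<Rightarrow> 'v"
  assumes complex_structure: "L \<in> {I, J, K} \<Longrightarrow> linear L \<and> L (L u) = - u"
    and IJ: "I (J u) = K u"
begin

lemma linear_L: "L \<in> {I, J, K} \<Longrightarrow> linear L"
  and L_L: "L \<in> {I, J, K} \<Longrightarrow> L (L u) = - u"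
  using complex_structure by auto

lemmas IJK_square = L_L[of I, simplified] L_L[of J, simplified] L_L[of K, simplified]

lemmas IJK_minus = linear_neg[OF linear_L[of I], simplified] linear_neg[OF linear_L[of J], simplified]
  linear_neg[OF linear_L[of K], simplified]

text \<open>The square of \<open>K = I J\<close> is \<open>- 1\<close>, which forces \<open>I\<close> and \<open>J\<close> to anticommute.\<close>

lemma JI: "J (I u) = - K u"
proof -
  have "I (J (I (J v))) = - v" for v using L_L[of K] by (simp add: IJ)
  from this[of "J (I u)"] show ?thesis by (simp add: IJK_minus IJK_square IJ minus_equation_iff)
qed

lemma quaternion_relations:
  "I (K u) = - J u" "K (I u) = J u" "J (K u) = I u" "K (J u) = - I u"
proof -
  have K: "K v = - J (I v)" for v by (simp add: JI)
  show "I (K u) = - J u" by (simp add: IJK_square flip: IJ)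
  show "K (I u) = J u" by (simp add: K IJK_minus IJK_square)
  show "J (K u) = I u" by (simp add: K IJK_minus IJK_square)
  show "K (J u) = - I u" by (simp add: IJK_minus IJK_square flip: IJ)
qed

text \<open>Such an \<open>M\<close> reverses the Kaehler form of \<open>L\<close>, as \<open>wedge_odd_power_eq_0\<close> requires.\<close>

lemma anticommuting_partner:
  assumes "L \<in> {I, J, K}"
  obtains M where "M \<in> {I, J, K}" "\<And>u. L (M u) = - M (L u)"
proof -
  have "I (J u) = - J (I u)" "J (I u) = - I (J u)" "K (I u) = - I (K u)" for u
    by (simp_all add: IJ JI quaternion_relations)
  then show ?thesis using that[of I] that[of J] assms by blast
qed

end

lemma quaternionic_primitive:
  fixes \<beta> :: "'v::euclidean_space \<Rightarrow> 'v \<Rightarrow> 'b::real_vector"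
  assumes "quaternionic I J K" and L: "L \<in> {I, J, K}" and dim: "DIM('v) = 2 + 2 * m" "odd m"
    and G: "bilinear G" "\<And>M u v. M \<in> {I, J, K} \<Longrightarrow> G (M u) (M v) = G u v"
    and \<beta>: "bilinear \<beta>" "\<And>M u v. M \<in> {I, J, K} \<Longrightarrow> \<beta> (M u) (M v) = \<beta> u v"
  shows "wedge 2 (2 * m) (as_form \<beta>) (wedge_power (\<lambda>u v. G (L u) v) m) v = 0"
proof -
  interpret quaternionic I J K by fact
  obtain M where M: "M \<in> {I, J, K}" "\<And>u. L (M u) = - M (L u)" by (rule anticommuting_partner[OF L]) blast
  have "bilinear (\<lambda>u v. G (L u) v)"
    using G(1) linear_compose[OF linear_L[OF L], of "\<lambda>u. G u _"] unfolding bilinear_def comp_def by blast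
  then show ?thesis
    using G(2)[OF M(1)] \<beta>(2)[OF M(1)]
    by (intro wedge_odd_power_eq_0[OF dim \<beta>(1) _ linear_L[OF M(1)] L_L[OF M(1)]])
      (simp_all add: M(2) bilinear_lneg[OF G(1)])
qed

text \<open>The tangent space \<open>'v\<close> of a hyperkaehler cone at a point of radius 1 and the tangent space \<open>'w\<close> of its link:
  \<open>p\<close> and \<open>q\<close> are the differentials of the projections to the half line and to the link, \<open>s\<close> is the
  differential of the inclusion of the link, and \<open>E\<close> is the radial unit vector.\<close>

locale quaternionic_cone = quaternionic I J K
  for I J K :: "'v::real_vector \<Rightarrow> 'v" +
  fixes p :: "'v \<Rightarrow> real" and q :: "'v \<Rightarrow> 'w::real_vector" and s :: "'w \<Rightarrow> 'v" and E :: 'v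
    and g :: "'w \<Rightarrow> 'w \<Rightarrow> real" and G :: "'v \<Rightarrow> 'v \<Rightarrow> real"
  assumes linear_s: "linear s" and linear_q: "linear q"
    and q_s: "q (s w) = w" and p_s: "p (s w) = 0" and p_E: "p E = 1" and q_E: "q E = 0"
    and decompose: "u = p u *\<^sub>R E + s (q u)"
    and bilinear_G: "bilinear G" and G_def: "G u v = p u * p v + g (q u) (q v)"
    and G_sym: "G u v = G v u" and G_pos: "u \<noteq> 0 \<Longrightarrow> G u u > 0"
    and G_L_L: "L \<in> {I, J, K} \<Longrightarrow> G (L u) (L v) = G u v"
begin

definition H where "H = {w. \<forall>L\<in>{I, J, K}. G (L E) (s w) = 0}"

lemmas G_simps = bilinear_ladd[OF bilinear_G] bilinear_radd[OF bilinear_G] bilinear_lmul[OF bilinear_G]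
  bilinear_rmul[OF bilinear_G] bilinear_lneg[OF bilinear_G] bilinear_rneg[OF bilinear_G]
  bilinear_lsub[OF bilinear_G] bilinear_rsub[OF bilinear_G]

lemma G_s_s: "G (s a) (s b) = g a b"
  by (simp add: G_def p_s q_s)

lemma G_E: "G E u = p u" "G u E = p u"
proof -
  have "g 0 v = 0" for v
    using bilinear_lzero[OF bilinear_G] G_s_s[of 0 v] linear_0[OF linear_s] by simp
  then show "G E u = p u" by (simp add: G_def p_E q_E)
  then show "G u E = p u" by (simp add: G_sym[of u])
qed

lemma G_skew: "L \<in> {I, J, K} \<Longrightarrow> G (L u) v = - G u (L v)"
  using G_L_L[of L "L u" v] by (simp add: L_L G_simps minus_equation_iff)

lemma p_LE: "L \<in> {I, J, K} \<Longrightarrow> p (L E) = 0"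
  using G_skew[of L E E] by (simp add: G_E)

lemmas p_IJK_E = p_LE[of I, simplified] p_LE[of J, simplified] p_LE[of K, simplified]

lemmas IJK_isometry = G_L_L[of I, simplified] G_L_L[of J, simplified] G_L_L[of K, simplified]

lemma vertical_orthonormal:
  "G E E = 1" "G (I E) (I E) = 1" "G (J E) (J E) = 1" "G (K E) (K E) = 1"
  "G E (I E) = 0" "G E (J E) = 0" "G E (K E) = 0" "G (I E) E = 0" "G (J E) E = 0" "G (K E) E = 0"
  "G (I E) (J E) = 0" "G (J E) (I E) = 0" "G (I E) (K E) = 0" "G (K E) (I E) = 0"
  "G (J E) (K E) = 0" "G (K E) (J E) = 0"
proof -
  show "G (I E) (J E) = 0" "G (I E) (K E) = 0" "G (J E) (K E) = 0"
    using G_skew[of I E "J E"] G_skew[of I E "K E"] G_skew[of J E "K E"]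
    by (simp_all add: IJ quaternion_relations G_E p_IJK_E G_simps)
  then show "G (J E) (I E) = 0" "G (K E) (I E) = 0" "G (K E) (J E) = 0"
    by (simp_all add: G_sym[of "J E" "I E"] G_sym[of "K E" "I E"] G_sym[of "K E" "J E"])
qed (simp_all add: IJK_isometry G_E p_E p_IJK_E)

text \<open>The orthogonal projection along the quaternionic line spanned by \<open>E\<close>. Its values are the lifts of the
  members of \<open>H\<close>.\<close>

definition P where
  "P u = u - (G u E *\<^sub>R E + G u (I E) *\<^sub>R I E + G u (J E) *\<^sub>R J E + G u (K E) *\<^sub>R K E)"

lemma P_orthogonal: "G (P u) E = 0" "L \<in> {I, J, K} \<Longrightarrow> G (P u) (L E) = 0"
  by (auto simp: P_def G_simps vertical_orthonormal)

lemma s_q: "p u = 0 \<Longrightarrow> s (q u) = u"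
  using decompose[of u] by simp

lemma P_horizontal: "s (q (P u)) = P u" "q (P u) \<in> H"
proof -
  show *: "s (q (P u)) = P u" using P_orthogonal(1)[of u] by (intro s_q) (simp add: G_E)
  show "q (P u) \<in> H"
    using P_orthogonal(2)[of _ u] by (simp add: H_def * G_sym[of _ "P u"])
qed

lemma L_horizontal:
  assumes L: "L \<in> {I, J, K}" and w: "w \<in> H"
  shows "s (q (L (s w))) = L (s w)" "q (L (s w)) \<in> H"
proof -
  have w0: "G E (s w) = 0" "\<And>L. L \<in> {I, J, K} \<Longrightarrow> G (L E) (s w) = 0"
    using w by (auto simp: H_def G_E p_s)
  show *: "s (q (L (s w))) = L (s w)"
    using G_skew[OF L, of E "s w"] w0(2)[OF L] by (intro s_q) (simp add: G_E)
  have "G (L' E) (L (s w)) = 0" if "L' \<in> {I, J, K}" for L'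
  proof -
    have "G (L' E) (L (s w)) = - G (L (L' E)) (s w)" using G_skew[OF L, of "L' E" "s w"] by simp
    also have "G (L (L' E)) (s w) = 0"
      using L that w0(1) w0(2)[of I] w0(2)[of J] w0(2)[of K]
      by (auto simp: IJK_square IJ JI quaternion_relations G_simps)
    finally show ?thesis by simp
  qed
  then show "q (L (s w)) \<in> H" by (simp add: H_def *)
qed

lemma q_L_L:
  assumes "L \<in> {I, J, K}" "w \<in> H"
  shows "q (L (s (q (L (s w))))) = - w"
  by (simp only: L_horizontal[OF assms] L_L[OF assms(1)] linear_neg[OF linear_q] q_s)

text \<open>The space spanned by \<open>E, I E, J E, K E\<close> is invariant under \<open>I, J, K\<close>. A form that annihilates it only sees the
  horizontal part of its argument, before and after the application of \<open>L\<close>.\<close>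

lemma vertical_kernel:
  assumes \<gamma>: "bilinear \<gamma>" and E: "\<And>v. \<gamma> E v = 0" and LE: "\<forall>L\<in>{I, J, K}. \<forall>v. \<gamma> (L E) v = 0"
  shows "\<gamma> u v = \<gamma> (P u) v" "L \<in> {I, J, K} \<Longrightarrow> \<gamma> (L u) v = \<gamma> (L (P u)) v"
proof -
  note simps = bilinear_ladd[OF \<gamma>] bilinear_lsub[OF \<gamma>] bilinear_lmul[OF \<gamma>] bilinear_lneg[OF \<gamma>]
  have IJK: "\<gamma> (I E) v = 0" "\<gamma> (J E) v = 0" "\<gamma> (K E) v = 0" using LE by auto
  show "\<gamma> u v = \<gamma> (P u) v" by (simp add: P_def simps E IJK)
  assume L: "L \<in> {I, J, K}"
  have 0: "\<gamma> (L (L' E)) v = 0" if "L' \<in> {I, J, K}" for L'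
    using L that by (auto simp: IJK_square IJ JI quaternion_relations simps E IJK)
  show "\<gamma> (L u) v = \<gamma> (L (P u)) v"
    using linear_L[OF L] by (simp add: P_def linear_diff linear_add linear_cmul simps 0[of I,
        simplified] 0[of J, simplified]
        0[of K, simplified] LE[rule_format, OF L])
qed

text \<open>The forms of \<open>tri_contact_forms\<close> in terms of the abstract tangent space.\<close>

definition tri_contact :: "('w \<Rightarrow> 'w \<Rightarrow> 'b::real_vector) \<Rightarrow> bool" where
  "tri_contact \<beta> \<longleftrightarrow> two_form \<beta> \<and> (\<forall>u. (\<forall>w\<in>H. g u w = 0) \<longrightarrow> (\<forall>v. \<beta> u v = 0)) \<and>
     (\<forall>L\<in>{I, J, K}. type11 H (\<lambda>w. q (L (s w))) \<beta>)"

text \<open>As \<open>\<beta>\<close> is invariant under \<open>L\<close>, it annihilates \<open>L E\<close> together with \<open>E\<close>. A vector \<open>u\<close> that is orthogonal to all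
  horizontal vectors is orthogonal to its own horizontal part, so \<open>s u\<close> is a combination of \<open>I E, J E, K E\<close>.\<close>

lemma tri_contact_restrict:
  assumes \<beta>: "two_form \<beta>" and type: "\<And>L. L \<in> {I, J, K} \<Longrightarrow> type11 UNIV L \<beta>" and E: "\<And>v. \<beta> E v = 0"
  shows "tri_contact (\<lambda>u v. \<beta> (s u) (s v))"
  unfolding tri_contact_def
proof (intro conjI allI ballI impI)
  have bil: "bilinear \<beta>" using \<beta> by (simp add: two_form_def)
  have "\<beta> (L E) v = 0" if "L \<in> {I, J, K}" for L v
  proof -
    have "\<beta> (L (L E)) (L v) = \<beta> (L E) v"
      using type11_UNIV_iff[OF linear_L[OF that] L_L[OF that] bil] type[OF that] by blast
    then show ?thesis using L_L[OF that] by (simp add: bilinear_lneg[OF bil] E)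
  qed
  then have LE: "\<forall>L\<in>{I, J, K}. \<forall>v. \<beta> (L E) v = 0" by blast
  show "two_form (\<lambda>u v. \<beta> (s u) (s v))"
    by (rule two_form_comp_linear[OF \<beta> linear_s])
  fix u v assume u: "\<forall>w\<in>H. g u w = 0"
  define a where "a = P (s u)"
  have "g u (q a) = 0" using u P_horizontal by (simp add: a_def)
  then have "G a (s u) = 0"
    using P_horizontal(1)[of "s u"] G_s_s[of u "q a"] G_sym[of a "s u"] by (simp add: a_def)
  \<comment> \<open>\<open>a\<close> differs from \<open>s u\<close> by vertical vectors, which are orthogonal to \<open>a\<close>\<close>
  moreover have "G a E = 0" "G a (I E) = 0" "G a (J E) = 0" "G a (K E) = 0"
    by (simp_all add: a_def P_orthogonal(1) P_orthogonal(2)[of I] P_orthogonal(2)[of J]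
        P_orthogonal(2)[of K])
  moreover have "G a a = G a (s u - (G (s u) E *\<^sub>R E + G (s u) (I E) *\<^sub>R I E +
      G (s u) (J E) *\<^sub>R J E + G (s u) (K E) *\<^sub>R K E))"
    by (rule arg_cong[where f = "G a"]) (simp add: a_def P_def)
  ultimately have "G a a = 0" by (simp add: G_simps)
  then have "P (s u) = 0" using G_pos[of a] by (auto simp: a_def)
  then show "\<beta> (s u) (s v) = 0" using vertical_kernel(1)[OF bil E LE, of "s u" "s v"]
    by (simp add: bilinear_lzero[OF bil])
next
  fix L assume L: "L \<in> {I, J, K}"
  have "(s a, s b) \<in> holo UNIV L" if "(a, b) \<in> holo H (\<lambda>w. q (L (s w)))" for a b
    using that L_horizontal[OF L, of a] L_horizontal[OF L, of b] by
        (auto simp: holo_def linear_neg[OF linear_s])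
  moreover have "(s a, s b) \<in> antiholo UNIV L" if "(a, b) \<in> antiholo H (\<lambda>w. q (L (s w)))" for a b
    using that L_horizontal[OF L, of a] L_horizontal[OF L, of b] by
        (auto simp: antiholo_def linear_neg[OF linear_s])
  moreover have "complexify (\<lambda>u v. \<beta> (s u) (s v)) (a, b) (c, d)
      = complexify \<beta> (s a, s b) (s c, s d)" for a b c d
    by (simp add: complexify_def)
  ultimately show "type11 H (\<lambda>w. q (L (s w))) (\<lambda>u v. \<beta> (s u) (s v))"
    using type[OF L] unfolding type11_def by fastforce
qed

text \<open>The vectors \<open>L E\<close> are the metric duals of the contact forms and hence orthogonal to \<open>H\<close>, so the lift of \<open>\<beta>\<close>
  annihilates them. On horizontal vectors the lift is invariant because \<open>\<beta>\<close> has type (1,1) there.\<close>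

lemma tri_contact_lift:
  assumes \<beta>: "tri_contact \<beta>" and L: "L \<in> {I, J, K}"
  shows "\<beta> (q (L u)) (q (L v)) = \<beta> (q u) (q v)"
proof -
  define \<gamma> where "\<gamma> u v = \<beta> (q u) (q v)" for u v
  have bil: "bilinear \<beta>" and alt: "\<And>w. \<beta> w w = 0" using \<beta> by (auto simp: tri_contact_def two_form_def)
  have \<gamma>: "bilinear \<gamma>"
    unfolding \<gamma>_def[abs_def] by (rule bilinear_comp_linear[OF bil linear_q])
  have skew: "\<gamma> u v = - \<gamma> v u" for u v
    using alt[of "q u + q v"] alt[of "q u"] alt[of "q v"]
    by (simp add: \<gamma>_def bilinear_ladd[OF bil] bilinear_radd[OF bil] eq_neg_iff_add_eq_0 add.commute)
  have E: "\<gamma> E v = 0" for v by (simp add: \<gamma>_def q_E bilinear_lzero[OF bil])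
  have "\<gamma> (L' E) v = 0" if "L' \<in> {I, J, K}" for L' v
  proof -
    have "g (q (L' E)) w = 0" if "w \<in> H" for w
    proof -
      have "g (q (L' E)) w = G (L' E) (s w)" using s_q[OF p_LE[OF \<open>L' \<in> _\<close>]] G_s_s[of
          "q (L' E)" w] by simp
      then show ?thesis using that \<open>L' \<in> _\<close> by (auto simp: H_def)
    qed
    then show ?thesis using \<beta> by (simp add: tri_contact_def \<gamma>_def)
  qed
  then have LE: "\<forall>L\<in>{I, J, K}. \<forall>v. \<gamma> (L E) v = 0" by blast
  note kernel = vertical_kernel[OF \<gamma> E LE]
  let ?a = "q (P u)" and ?c = "q (P v)"
  have "\<gamma> (L u) (L v) = \<gamma> (L (P u)) (L (P v))"
    using kernel(2)[OF L, of u "L v"] kernel(2)[OF L, of v "L (P u)"] skew by metis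
  also have "\<dots> = \<beta> (q (L (s ?a))) (q (L (s ?c)))" by (simp add: P_horizontal \<gamma>_def)
  also have "\<dots> = \<beta> ?a ?c"
  proof (rule type11_invariant[where L = "\<lambda>w. q (L (s w))" and V = H])
    show "type11 H (\<lambda>w. q (L (s w))) \<beta>" using \<beta> L unfolding tri_contact_def by blast
    show "- x \<in> H" "q (L (s (- x))) = - q (L (s x))" if "x \<in> H" for x
      using that by (simp_all add: H_def linear_neg[OF linear_s] linear_neg[OF linear_q]
          linear_neg[OF linear_L[OF L]] G_simps)
  qed (rule bil P_horizontal(2) L_horizontal(2)[OF L P_horizontal(2)] q_L_L[OF L P_horizontal(2)])+
  also have "\<dots> = \<gamma> u v" using kernel(1)[of u v] kernel(1)[of v "P u"] skew by (metis \<gamma>_def)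
  finally show ?thesis by (simp add: \<gamma>_def)
qed

end

section \<open>Tangent maps\<close>

abbreviation chart_rep :: "('a, 'e) chart \<Rightarrow> ('b, 'f) chart \<Rightarrow> ('a \<Rightarrow> 'b) \<Rightarrow> 'e \<Rightarrow> 'f" where
  "chart_rep c d f \<equiv> snd d \<circ> f \<circ> chart_inv c"

lemma chartD:
  assumes "smooth_atlas \<A>" "c \<in> \<A>"
  shows "open (fst c)" "open (snd c ` fst c)"
    "homeomorphism (fst c) (snd c ` fst c) (snd c) (chart_inv c)"
    "x \<in> fst c \<Longrightarrow> chart_inv c (snd c x) = x"
    "y \<in> snd c ` fst c \<Longrightarrow> chart_inv c y \<in> fst c"
    "y \<in> snd c ` fst c \<Longrightarrow> snd c (chart_inv c y) = y"
    "x \<in> fst c \<Longrightarrow> isCont (chart_inv c) (snd c x)"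
proof -
  show o: "open (fst c)" "open (snd c ` fst c)" and
    h: "homeomorphism (fst c) (snd c ` fst c) (snd c) (chart_inv c)"
    using assms by (auto simp: smooth_atlas_def)
  show "x \<in> fst c \<Longrightarrow> chart_inv c (snd c x) = x"
    "y \<in> snd c ` fst c \<Longrightarrow> chart_inv c y \<in> fst c"
    "y \<in> snd c ` fst c \<Longrightarrow> snd c (chart_inv c y) = y"
    using h by (auto simp: homeomorphism_def)
  show "x \<in> fst c \<Longrightarrow> isCont (chart_inv c) (snd c x)"
    using h o(2) by (auto simp: homeomorphism_def continuous_on_eq_continuous_at)
qed

lemma open_chart_image:
  assumes "smooth_atlas \<A>" "c \<in> \<A>" "open S"
  shows "open (snd c ` (fst c \<inter> S))"
proof -
  have "snd c ` (fst c \<inter> S) = snd c ` fst c \<inter> chart_inv c -` S"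
    using chartD(4-6)[OF assms(1,2)] by auto
  moreover have "open (snd c ` fst c \<inter> chart_inv c -` S)"
    using chartD(2,3)[OF assms(1,2)] assms(3)
    by (intro continuous_open_preimage) (auto simp: homeomorphism_def)
  ultimately show ?thesis by simp
qed

lemma open_points: "smooth_atlas \<A> \<Longrightarrow> open (points \<A>)"
  unfolding points_def by (auto dest: chartD(1))

lemma chart_at:
  assumes "x \<in> points \<A>"
  shows "chart_at \<A> x \<in> \<A>" "x \<in> fst (chart_at \<A> x)"
proof -
  have "\<exists>c. c \<in> \<A> \<and> x \<in> fst c" using assms by (auto simp: points_def)
  then show "chart_at \<A> x \<in> \<A>" "x \<in> fst (chart_at \<A> x)"
    unfolding chart_at_def by (metis (mono_tags, lifting) someI_ex)+
qed

lemma points_chart: "c \<in> \<A> \<Longrightarrow> x \<in> fst c \<Longrightarrow> x \<in> points \<A>"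
  by (auto simp: points_def)

text \<open>Continuity of \<open>f\<close> keeps a neighbourhood of \<open>x\<close> inside the domain of \<open>d\<close>, where \<open>d\<close> and its inverse cancel.\<close>

lemma chart_rep_chain:
  assumes "smooth_atlas \<A>" "smooth_atlas \<B>" "c \<in> \<A>" "d \<in> \<B>" "x \<in> fst c" "f x \<in> fst d" "isCont f x"
    and F: "(chart_rep c d f has_derivative F) (at (snd c x))"
    and G: "(chart_rep d e g has_derivative G) (at (snd d (f x)))"
  shows "(chart_rep c e (g \<circ> f) has_derivative G \<circ> F) (at (snd c x))"
proof -
  have x: "chart_inv c (snd c x) = x" using chartD(4) assms by blast
  have "((chart_rep d e g \<circ> chart_rep c d f) has_derivative G \<circ> F) (at (snd c x))"
    using F G by (intro diff_chain_at) (simp_all add: x)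
  moreover have "eventually (\<lambda>y. f (chart_inv c y) \<in> fst d) (at (snd c x))"
  proof -
    have "isCont (\<lambda>y. f (chart_inv c y)) (snd c x)"
      by (rule isCont_o2[OF chartD(7)[OF assms(1,3,5)]]) (simp only: x assms(7))
    then show ?thesis
      using chartD(1)[OF assms(2,4)] assms(6) unfolding isCont_def x by (rule topological_tendstoD)
  qed
  then have "eventually (\<lambda>y. (chart_rep d e g \<circ> chart_rep c d f) y
      = chart_rep c e (g \<circ> f) y) (at (snd c x))"
    by eventually_elim (simp add: chartD(4)[OF assms(2,4)])
  moreover have "(chart_rep d e g \<circ> chart_rep c d f) (snd c x) = chart_rep c e (g \<circ> f) (snd c x)"
    using assms by (simp add: x chartD(4))
  ultimately show ?thesis by (rule has_derivative_transform_eventually) simp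
qed

lemma chart_rep_differentiable_chain:
  assumes "smooth_atlas \<A>" "smooth_atlas \<B>" "c \<in> \<A>" "d \<in> \<B>" "x \<in> fst c" "f x \<in> fst d" "isCont f x"
    and "chart_rep c d f differentiable at (snd c x)" "chart_rep d e g differentiable at (snd d (f x))"
  shows "chart_rep c e (g \<circ> f) differentiable at (snd c x)"
    "frechet_derivative (chart_rep c e (g \<circ> f)) (at (snd c x)) v =
     frechet_derivative (chart_rep d e g) (at (snd d (f x))) (frechet_derivative (chart_rep c d f)
         (at (snd c x)) v)"
proof -
  note * = chart_rep_chain[OF assms(1-7) assms(8,9)[unfolded frechet_derivative_works]]
  show "chart_rep c e (g \<circ> f) differentiable at (snd c x)" using * by (auto simp: differentiable_def)
  show "frechet_derivative (chart_rep c e (g \<circ> f)) (at (snd c x)) v =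
     frechet_derivative (chart_rep d e g) (at (snd d (f x))) (frechet_derivative (chart_rep c d f)
         (at (snd c x)) v)"
    using frechet_derivative_at[OF *] by (simp add: fun_eq_iff)
qed

lemma transition_smooth:
  assumes "smooth_atlas \<A>" "c \<in> \<A>" "d \<in> \<A>"
  shows "smooth_on (snd c ` (fst c \<inter> fst d)) (chart_rep c d id)"
  using assms by (simp add: smooth_atlas_def)

lemma smooth_on_differentiable: "smooth_on S f \<Longrightarrow> x \<in> S \<Longrightarrow> f differentiable at x"
proof -
  assume "smooth_on S f" "x \<in> S"
  then have "Ck_on (Suc 0) S f" by (simp only: smooth_on_def)
  with \<open>x \<in> S\<close> show ?thesis by simp
qed

lemma transition_differentiable:
  assumes "smooth_atlas \<A>" "c \<in> \<A>" "d \<in> \<A>" "x \<in> fst c" "x \<in> fst d"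
  shows "chart_rep c d id differentiable at (snd c x)"
  using assms by (intro smooth_on_differentiable[OF transition_smooth]) auto

text \<open>Differentiability at a single point, for which tangent maps are already functorial. Continuity is
  required separately: without it the coordinate expression could be differentiable although \<open>f\<close> leaves
  the domain of the chart arbitrarily close to \<open>x\<close>.\<close>

definition diff_at :: "('a::t2_space, 'e::real_normed_vector) atlas \<Rightarrow>
    ('b::topological_space, 'f::real_normed_vector) atlas \<Rightarrow> ('a \<Rightarrow> 'b) \<Rightarrow> 'a \<Rightarrow> bool" where
  "diff_at \<A> \<B> f x \<longleftrightarrow> x \<in> points \<A> \<and> f x \<in> points \<B> \<and> isCont f x \<and>
     chart_rep (chart_at \<A> x) (chart_at \<B> (f x)) f differentiable at (snd (chart_at \<A> x) x)"

lemma chart_rep_change: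
  assumes "smooth_atlas \<A>" "smooth_atlas \<B>" "c \<in> \<A>" "d \<in> \<B>" "x \<in> fst c" "f x \<in> fst d" "isCont f x"
    and "c' \<in> \<A>" "d' \<in> \<B>" "x \<in> fst c'" "f x \<in> fst d'"
    and f: "chart_rep c d f differentiable at (snd c x)"
  shows "chart_rep c' d' f differentiable at (snd c' x)"
proof -
  have "chart_rep c d' (id \<circ> f) differentiable at (snd c x)"
    using assms by (intro chart_rep_differentiable_chain(1)[where d = d and \<A> = \<A>
        and \<B> = \<B>] transition_differentiable)
  then have "chart_rep c' d' (f \<circ> id) differentiable at (snd c' x)"
    using assms
    by (intro chart_rep_differentiable_chain(1)[where d = c and \<A> = \<A>
        and \<B> = \<A>] transition_differentiable[of \<A>]) auto
  then show ?thesis by simp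
qed

text \<open>The chosen charts in the definition may be replaced by any others, because the transition maps are
  smooth.\<close>

lemma diff_at_charts:
  assumes "smooth_atlas \<A>" "smooth_atlas \<B>" "c \<in> \<A>" "d \<in> \<B>" "x \<in> fst c" "f x \<in> fst d"
  shows "diff_at \<A> \<B> f x \<longleftrightarrow> isCont f x \<and> chart_rep c d f differentiable at (snd c x)"
proof -
  have p: "x \<in> points \<A>" "f x \<in> points \<B>"
    using points_chart[OF assms(3,5)] points_chart[OF assms(4,6)] by simp_all
  note c = chart_at[OF p(1)] and d = chart_at[OF p(2)]
  show ?thesis
  proof
    assume "diff_at \<A> \<B> f x"
    then have "isCont f x" "chart_rep (chart_at \<A> x) (chart_at \<B> (f x)) f differentiable at (snd
        (chart_at \<A> x) x)"
      by (simp_all add: diff_at_def)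
    then show "isCont f x \<and> chart_rep c d f differentiable at (snd c x)"
      using chart_rep_change[of \<A> \<B> "chart_at \<A> x" "chart_at \<B> (f x)" x f c d] assms c d by blast
  next
    assume "isCont f x \<and> chart_rep c d f differentiable at (snd c x)"
    then show "diff_at \<A> \<B> f x"
      using chart_rep_change[of \<A> \<B> c d x f "chart_at \<A> x" "chart_at \<B> (f x)"] assms c d p
      unfolding diff_at_def by blast
  qed
qed

lemma smooth_map_diff_at:
  assumes "smooth_atlas \<A>" "smooth_map \<A> \<B> f" "x \<in> points \<A>"
  shows "diff_at \<A> \<B> f x"
proof -
  have p: "f x \<in> points \<B>" and c: "isCont f x"
    using assms open_points[OF assms(1)] by (auto simp: smooth_map_def continuous_on_eq_continuous_at)
  have "smooth_on (snd (chart_at \<A> x) ` (fst (chart_at \<A> x) \<inter> f -` fst (chart_at \<B> (f x))))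
      (chart_rep (chart_at \<A> x) (chart_at \<B> (f x)) f)"
    using assms(2) chart_at[OF assms(3)] chart_at[OF p] by (auto simp: smooth_map_def)
  then show ?thesis
    using p c assms(3) chart_at[OF assms(3)] chart_at[OF p]
    unfolding diff_at_def by (auto elim!: smooth_on_differentiable)
qed

lemma linear_tangent_map: "diff_at \<A> \<B> f x \<Longrightarrow> linear (tangent_map \<A> \<B> f x)"
  unfolding diff_at_def tangent_map_def by (auto simp: linear_frechet_derivative)

lemma diff_at_compose:
  assumes "smooth_atlas \<A>" "smooth_atlas \<B>" "diff_at \<A> \<B> f x" "diff_at \<B> \<C> g (f x)"
  shows "diff_at \<A> \<C> (g \<circ> f) x"
    "tangent_map \<A> \<C> (g \<circ> f) x v = tangent_map \<B> \<C> g (f x) (tangent_map \<A> \<B> f x v)"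
proof -
  have p: "x \<in> points \<A>" "f x \<in> points \<B>" "g (f x) \<in> points \<C>" "isCont f x" "isCont g (f x)"
    using assms by (auto simp: diff_at_def)
  note * = chart_rep_differentiable_chain[of \<A> \<B> "chart_at \<A> x" "chart_at \<B> (f x)" x f
      "chart_at \<C> (g (f x))" g, OF assms(1,2) chart_at(1)[OF p(1)] chart_at(1)[OF p(2)]
      chart_at(2)[OF p(1)] chart_at(2)[OF p(2)] p(4)]
  show "diff_at \<A> \<C> (g \<circ> f) x"
    using assms(3,4) * p isCont_o2[OF p(4,5)] by (simp add: diff_at_def comp_def)
  show "tangent_map \<A> \<C> (g \<circ> f) x v = tangent_map \<B> \<C> g (f x) (tangent_map \<A> \<B> f x v)"
    using assms(3,4) * by (simp add: diff_at_def tangent_map_def)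
qed

lemma tangent_map_cong:
  fixes \<A> :: "('a::{t2_space,second_countable_topology}, 'e::real_normed_vector) atlas"
    and \<B> :: "('b::topological_space, 'f::real_normed_vector) atlas"
  assumes "smooth_atlas \<A>" "x \<in> points \<A>" "open S" "x \<in> S" "\<And>y. y \<in> S \<Longrightarrow> f y = g y"
  shows "tangent_map \<A> \<B> f x = tangent_map \<A> \<B> g x" "diff_at \<A> \<B> f x \<longleftrightarrow> diff_at \<A> \<B> g x"
proof -
  let ?c = "chart_at \<A> x"
  note c = chart_at[OF assms(2)]
  have o: "open (snd ?c ` (fst ?c \<inter> S))" using assms c by (intro open_chart_image)
  have x: "snd ?c x \<in> snd ?c ` (fst ?c \<inter> S)" using assms c by auto
  let ?d = "chart_at \<B> (g x)"
  have eq: "chart_rep ?c ?d f y = chart_rep ?c ?d g y" if "y \<in> snd ?c ` (fst ?c \<inter> S)" for y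
    using that assms(5) chartD(4)[OF assms(1) c(1)] by auto
  have *: "frechet_derivative (chart_rep ?c ?d f) (at (snd ?c x))
      = frechet_derivative (chart_rep ?c ?d g) (at (snd ?c x))"
    by (rule frechet_derivative_cong_open(1)[OF o x]) (rule eq)
  have **: "chart_rep ?c ?d f differentiable at (snd ?c x)
      \<longleftrightarrow> chart_rep ?c ?d g differentiable at (snd ?c x)"
    by (rule frechet_derivative_cong_open(2)[OF o x]) (rule eq)
  have "isCont f x \<longleftrightarrow> isCont g x"
    using assms(3-5) by (intro isCont_cong) (auto simp: eventually_nhds)
  with * ** assms(4,5) show "tangent_map \<A> \<B> f x = tangent_map \<A> \<B> g x" "diff_at \<A> \<B> f x
      \<longleftrightarrow> diff_at \<A> \<B> g x"
    by (simp_all add: tangent_map_def diff_at_def)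
qed

text \<open>The coordinate expression of the identity is the identity only on the image of the chart.\<close>

lemma tangent_map_id:
  assumes "smooth_atlas \<A>" "x \<in> points \<A>"
  shows "tangent_map \<A> \<A> (\<lambda>x. x) x v = v" "diff_at \<A> \<A> (\<lambda>x. x) x"
proof -
  let ?c = "chart_at \<A> x"
  note c = chart_at[OF assms(2)]
  have "snd ?c x \<in> snd ?c ` fst ?c" using c(2) by (rule imageI)
  then have "frechet_derivative (chart_rep ?c ?c (\<lambda>x. x)) (at (snd ?c x))
      = frechet_derivative (\<lambda>y. y) (at (snd ?c x))"
    by (intro frechet_derivative_cong_open(1)[OF chartD(2)[OF assms(1) c(1)]])
        (simp_all add: chartD(6)[OF assms(1) c(1)])
  then show "tangent_map \<A> \<A> (\<lambda>x. x) x v = v" by (simp add: tangent_map_def frechet_derivative_id)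
  show "diff_at \<A> \<A> (\<lambda>x. x) x"
    using diff_at_charts[of \<A> \<A> ?c ?c x "\<lambda>x. x"] assms(1) c
      transition_differentiable[OF assms(1) c(1,1)] by (simp add: id_def)
qed

lemma tangent_map_const:
  assumes "smooth_atlas \<A>" "x \<in> points \<A>" "b \<in> points \<B>"
  shows "tangent_map \<A> \<B> (\<lambda>x. b) x v = 0" "diff_at \<A> \<B> (\<lambda>x. b) x"
  using assms by (simp_all add: tangent_map_def diff_at_def comp_def)

text \<open>The chosen charts in which tangent vectors are represented cancel: in arbitrary charts, too, a pullback
  is computed with the derivative of the coordinate expression of the map.\<close>

lemma form1_rep_pullback:
  assumes "smooth_atlas \<A>" "smooth_atlas \<B>" "c \<in> \<A>" "d \<in> \<B>" "x \<in> fst c" "f x \<in> fst d"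
      and f: "diff_at \<A> \<B> f x"
  shows "form1_rep \<A> c (pullback1 \<A> \<B> f b) (snd c x) v =
    form1_rep \<B> d b (snd d (f x)) (frechet_derivative (chart_rep c d f) (at (snd c x)) v)"
proof -
  let ?c = "chart_at \<A> x" and ?d = "chart_at \<B> (f x)"
  have p: "x \<in> points \<A>" "f x \<in> points \<B>" "isCont f x" using f by (auto simp: diff_at_def)
  note c = chart_at[OF p(1)] and d = chart_at[OF p(2)]
  have cd: "chart_rep c d f differentiable at (snd c x)" using diff_at_charts[of \<A> \<B> c d x f] assms
      by simp
  have f': "chart_rep ?c ?d f differentiable at (snd ?c x)" using f by (simp add: diff_at_def)
  have "tangent_map \<A> \<B> f x (from_chart \<A> c (snd c x) v)
      = frechet_derivative (chart_rep c ?d (f \<circ> id)) (at (snd c x)) v"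
    unfolding tangent_map_def from_chart_def chartD(4)[OF assms(1,3,5)]
    using chart_rep_differentiable_chain(2)[of \<A> \<A> c ?c x id ?d f v] assms
      transition_differentiable[OF assms(1,3) c(1) assms(5) c(2)] c f' by simp
  also have "\<dots> = frechet_derivative (chart_rep c ?d (id \<circ> f)) (at (snd c x)) v" by simp
  also have "\<dots> = from_chart \<B> d (snd d (f x)) (frechet_derivative (chart_rep c d f) (at (snd c x)) v)"
    unfolding from_chart_def chartD(4)[OF assms(2,4,6)]
    using chart_rep_differentiable_chain(2)[of \<A> \<B> c d x f ?d id v] assms p cd
      transition_differentiable[OF assms(2,4) d(1) assms(6) d(2)] by simp
  finally show ?thesis
    by (simp add: form1_rep_def pullback1_def chartD(4)[OF assms(1,3,5)] chartD(4)[OF assms(2,4,6)])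
qed

lemma linear_form1_rep:
  assumes "smooth_atlas \<B>" "d \<in> \<B>" "y \<in> snd d ` fst d" "\<And>x. x \<in> points \<B> \<Longrightarrow> linear (b x)"
  shows "linear (form1_rep \<B> d b y)"
proof -
  obtain x where x: "x \<in> fst d" "y = snd d x" using assms(3) by auto
  have p: "x \<in> points \<B>" using x assms by (auto simp: points_def)
  have "linear (from_chart \<B> d y)"
    using transition_differentiable[OF assms(1,2) chart_at(1)[OF p] x(1) chart_at(2)[OF p]]
    unfolding from_chart_def x(2) chartD(4)[OF assms(1,2) x(1)] by (simp add: linear_frechet_derivative)
  from linear_compose[OF this assms(4)[OF p]] show ?thesis
    unfolding form1_rep_def[abs_def] x(2) chartD(4)[OF assms(1,2) x(1)] by (simp add: comp_def)
qed

section \<open>Pullback and exterior derivative\<close>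

text \<open>This is the product rule. As \<open>\<beta> z w\<close> is only known to be differentiable in \<open>z\<close> for each fixed \<open>w\<close>, the second
  argument is first expanded in a basis, which leaves a finite sum of products of real functions with
  \<open>\<beta> z i\<close>.\<close>

lemma bilinear_rep_derivative:
  fixes \<psi> :: "'a::real_normed_vector \<Rightarrow> 'f::euclidean_space" and \<beta> :: "'f \<Rightarrow> 'f \<Rightarrow> 'b::real_normed_vector"
  assumes U: "open U" "y0 \<in> U" and V: "open V" "\<psi> ` U \<subseteq> V"
    and \<psi>: "\<psi> differentiable at y0" "\<And>v. (\<lambda>y. frechet_derivative \<psi> (at y) v) differentiable at y0"
    and lin: "\<And>z. z \<in> V \<Longrightarrow> linear (\<beta> z)"
    and \<beta>: "\<And>w. (\<lambda>z. \<beta> z w) differentiable at (\<psi> y0)"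
  shows "((\<lambda>y. \<beta> (\<psi> y) (frechet_derivative \<psi> (at y) v)) has_derivative
    (\<lambda>u. \<beta> (\<psi> y0) (frechet_derivative (\<lambda>y. frechet_derivative \<psi> (at y) v) (at y0) u) +
         frechet_derivative (\<lambda>z. \<beta> z (frechet_derivative \<psi> (at y0) v)) (at (\<psi> y0))
             (frechet_derivative \<psi> (at y0) u))) (at y0)"
proof -
  let ?D = "\<lambda>y. frechet_derivative \<psi> (at y) v"
  let ?D2 = "frechet_derivative ?D (at y0)"
  let ?B = "\<lambda>w. frechet_derivative (\<lambda>z. \<beta> z w) (at (\<psi> y0))"
  have expand: "\<beta> z w = (\<Sum>i\<in>Basis. (w \<bullet> i) *\<^sub>R \<beta> z i)" if "z \<in> V" for z w
    using linear_sum[OF lin[OF that], of "\<lambda>i. (w \<bullet> i) *\<^sub>R i" Basis]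
    by (simp add: euclidean_representation linear_cmul[OF lin[OF that]])
  have z0: "\<psi> y0 \<in> V" using U V by auto
  have d\<beta>: "((\<lambda>z. \<beta> z w) has_derivative ?B w) (at (\<psi> y0))" for w
    using \<beta> by (simp add: frechet_derivative_works)
  have d\<psi>: "(\<psi> has_derivative frechet_derivative \<psi> (at y0)) (at y0)"
    using \<psi>(1) by (simp add: frechet_derivative_works)
  have dD: "(?D has_derivative ?D2) (at y0)"
    using \<psi>(2) by (simp add: frechet_derivative_works)
  have B: "?B w = (\<lambda>h. \<Sum>i\<in>Basis. (w \<bullet> i) *\<^sub>R ?B i h)" for w
  proof -
    have "((\<lambda>z. \<Sum>i\<in>Basis. (w \<bullet> i) *\<^sub>R \<beta> z i) has_derivative
        (\<lambda>h. \<Sum>i\<in>Basis. (w \<bullet> i) *\<^sub>R ?B i h)) (at (\<psi> y0))"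
      by (intro has_derivative_sum has_derivative_scaleR_right d\<beta>)
    then have "((\<lambda>z. \<beta> z w) has_derivative (\<lambda>h. \<Sum>i\<in>Basis. (w \<bullet> i) *\<^sub>R ?B i h)) (at (\<psi> y0))"
      by (rule has_derivative_transform_within_open[OF _ V(1) z0]) (simp add: expand[symmetric])
    from has_derivative_unique[OF d\<beta> this] show ?thesis .
  qed
  have "((\<lambda>y. \<Sum>i\<in>Basis. (?D y \<bullet> i) *\<^sub>R \<beta> (\<psi> y) i) has_derivative
      (\<lambda>u. \<Sum>i\<in>Basis. (?D y0 \<bullet> i) *\<^sub>R ?B i (frechet_derivative \<psi> (at y0) u)
          + (?D2 u \<bullet> i) *\<^sub>R \<beta> (\<psi> y0) i)) (at y0)"
    by (intro has_derivative_sum has_derivative_scaleR has_derivative_inner_left dD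
        has_derivative_compose[where f = \<psi>, OF d\<psi> d\<beta>])
  then have "((\<lambda>y. \<beta> (\<psi> y) (?D y)) has_derivative
      (\<lambda>u. \<Sum>i\<in>Basis. (?D y0 \<bullet> i) *\<^sub>R ?B i (frechet_derivative \<psi> (at y0) u)
          + (?D2 u \<bullet> i) *\<^sub>R \<beta> (\<psi> y0) i)) (at y0)"
    by (rule has_derivative_transform_within_open[OF _ U]) (use V in \<open>auto simp: expand[symmetric]\<close>)
  moreover have "(\<Sum>i\<in>Basis. (?D y0 \<bullet> i) *\<^sub>R ?B i (frechet_derivative \<psi> (at y0) u)
      + (?D2 u \<bullet> i) *\<^sub>R \<beta> (\<psi> y0) i) =
      \<beta> (\<psi> y0) (?D2 u) + ?B (?D y0) (frechet_derivative \<psi> (at y0) u)" for u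
    using expand[OF z0, of "?D2 u"] fun_cong[OF B[of "?D y0"], of "frechet_derivative \<psi> (at y0) u"]
    by (simp add: sum.distrib)
  ultimately show ?thesis by simp
qed

text \<open>A condition on 1-forms that suffices for the exterior derivative at \<open>x\<close> and that is inherited by pullbacks
  as soon as the map is twice differentiable, so that pullbacks of smooth forms can be pulled back again
  without an analysis of their higher derivatives.\<close>

definition diff_form1_at :: "('a, 'e::real_normed_vector) atlas \<Rightarrow>
    ('a \<Rightarrow> 'e \<Rightarrow> 'b::real_normed_vector) \<Rightarrow> 'a \<Rightarrow> bool" where
  "diff_form1_at \<A> A x \<longleftrightarrow> (\<forall>c\<in>\<A>. x \<in> fst c \<longrightarrow> (\<forall>v. (\<lambda>y. form1_rep \<A> c A y v) differentiable at (snd c x)))"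

text \<open>The summand with the second derivative of \<open>\<psi>\<close> is symmetric in \<open>u\<close> and \<open>v\<close>; the other one is the derivative of
  the form \<open>b\<close> on the image vectors, which is what an exterior derivative has to retain.\<close>

lemma pullback1_derivative:
  fixes \<B> :: "('b::{t2_space,second_countable_topology}, 'f::euclidean_space) atlas"
  assumes A: "smooth_atlas \<A>" and B: "smooth_atlas \<B>" and f: "smooth_map \<A> \<B> f"
    and c: "c \<in> \<A>" "x \<in> fst c" and d: "d \<in> \<B>" "f x \<in> fst d"
    and b: "\<And>y. y \<in> points \<B> \<Longrightarrow> linear (b y)" "diff_form1_at \<B> b (f x)"
  defines "\<psi> \<equiv> chart_rep c d f"
  shows "((\<lambda>y. form1_rep \<A> c (pullback1 \<A> \<B> f b) y v) has_derivative
    (\<lambda>u. form1_rep \<B> d b (snd d (f x)) (frechet_derivative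
        (\<lambda>y. frechet_derivative \<psi> (at y) v) (at (snd c x)) u) +
      frechet_derivative (\<lambda>z. form1_rep \<B> d b z (frechet_derivative \<psi> (at (snd c x)) v)) (at (snd d
          (f x)))
        (frechet_derivative \<psi> (at (snd c x)) u))) (at (snd c x))"
    and "frechet_derivative (\<lambda>y. frechet_derivative \<psi> (at y) v) (at (snd c x)) u =
      frechet_derivative (\<lambda>y. frechet_derivative \<psi> (at y) u) (at (snd c x)) v"
    and "linear (form1_rep \<B> d b (snd d (f x)))"
proof -
  define W where "W = points \<A> \<inter> f -` fst d"
  define U where "U = snd c ` (fst c \<inter> W)"
  have pts: "fst c \<subseteq> points \<A>" using c by (auto simp: points_def)
  have "open W"
    unfolding W_def using f chartD(1)[OF B d(1)] open_points[OF A]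
    by (intro continuous_open_preimage) (auto simp: smooth_map_def)
  then have U: "open U" unfolding U_def by (rule open_chart_image[OF A c(1)])
  have y0: "snd c x \<in> U" using c d pts by (auto simp: U_def W_def)
  have "smooth_on (snd c ` (fst c \<inter> f -` fst d)) \<psi>" using f c d by (simp add: smooth_map_def \<psi>_def)
  moreover have "fst c \<inter> f -` fst d = fst c \<inter> W" using pts by (auto simp: W_def)
  ultimately have sm: "Ck_on 2 U \<psi>" by (simp add: smooth_on_def U_def)
  have \<psi>: "\<psi> (snd c y) = snd d (f y)" if "y \<in> fst c" for y
    using that by (simp add: \<psi>_def chartD(4)[OF A c(1)])
  have img: "\<psi> ` U \<subseteq> snd d ` fst d" by (auto simp: U_def W_def \<psi>)
  show "frechet_derivative (\<lambda>y. frechet_derivative \<psi> (at y) v) (at (snd c x)) u =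
      frechet_derivative (\<lambda>y. frechet_derivative \<psi> (at y) u) (at (snd c x)) v"
    by (rule second_derivative_symmetric[OF U y0 sm])
  have lin: "linear (form1_rep \<B> d b z)" if "z \<in> snd d ` fst d" for z
    using linear_form1_rep[OF B d(1) that b(1)] .
  show "linear (form1_rep \<B> d b (snd d (f x)))" using lin d by simp
  have "((\<lambda>y. form1_rep \<B> d b (\<psi> y) (frechet_derivative \<psi> (at y) v)) has_derivative
    (\<lambda>u. form1_rep \<B> d b (\<psi> (snd c x)) (frechet_derivative
        (\<lambda>y. frechet_derivative \<psi> (at y) v) (at (snd c x)) u) +
      frechet_derivative (\<lambda>z. form1_rep \<B> d b z (frechet_derivative \<psi> (at (snd c x)) v)) (at (\<psi>
          (snd c x)))
        (frechet_derivative \<psi> (at (snd c x)) u))) (at (snd c x))"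
    using b(2) d unfolding diff_form1_at_def
    by (intro bilinear_rep_derivative[OF U y0 chartD(2)[OF B d(1)] img] Ck_on_2D[OF sm] y0 lin)
        (simp_all add: \<psi>[OF c(2)])
  then have "((\<lambda>y. form1_rep \<A> c (pullback1 \<A> \<B> f b) y v) has_derivative
    (\<lambda>u. form1_rep \<B> d b (\<psi> (snd c x)) (frechet_derivative
        (\<lambda>y. frechet_derivative \<psi> (at y) v) (at (snd c x)) u) +
      frechet_derivative (\<lambda>z. form1_rep \<B> d b z (frechet_derivative \<psi> (at (snd c x)) v)) (at (\<psi>
          (snd c x)))
        (frechet_derivative \<psi> (at (snd c x)) u))) (at (snd c x))"
  proof (rule has_derivative_transform_within_open[OF _ U y0])
    fix y assume "y \<in> U"
    then obtain x' where x': "y = snd c x'" "x' \<in> fst c" "x' \<in> points \<A>"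
        "f x' \<in> fst d" by (auto simp: U_def W_def)
    then show "form1_rep \<B> d b (\<psi> y) (frechet_derivative \<psi> (at y) v)
        = form1_rep \<A> c (pullback1 \<A> \<B> f b) y v"
      using form1_rep_pullback[of \<A> \<B> c d x' f b v] A B c(1) d(1) smooth_map_diff_at[OF A f x'(3)]
      by (simp add: \<psi> flip: \<psi>_def)
  qed
  then show "((\<lambda>y. form1_rep \<A> c (pullback1 \<A> \<B> f b) y v) has_derivative
    (\<lambda>u. form1_rep \<B> d b (snd d (f x)) (frechet_derivative
        (\<lambda>y. frechet_derivative \<psi> (at y) v) (at (snd c x)) u) +
      frechet_derivative (\<lambda>z. form1_rep \<B> d b z (frechet_derivative \<psi> (at (snd c x)) v)) (at (snd d
          (f x)))
        (frechet_derivative \<psi> (at (snd c x)) u))) (at (snd c x))"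
    by (simp add: \<psi>[OF c(2)])
qed

lemma diff_form1_at_pullback:
  fixes \<B> :: "('b::{t2_space,second_countable_topology}, 'f::euclidean_space) atlas"
  assumes "smooth_atlas \<A>" "smooth_atlas \<B>" "smooth_map \<A> \<B> f" "x \<in> points \<A>"
    and "\<And>y. y \<in> points \<B> \<Longrightarrow> linear (b y)" "diff_form1_at \<B> b (f x)"
  shows "diff_form1_at \<A> (pullback1 \<A> \<B> f b) x"
  unfolding diff_form1_at_def
proof (intro ballI impI allI)
  fix c v assume c: "c \<in> \<A>" "x \<in> fst c"
  have "f x \<in> points \<B>" using assms by (auto simp: smooth_map_def)
  note d = chart_at[OF this]
  show "(\<lambda>y. form1_rep \<A> c (pullback1 \<A> \<B> f b) y v) differentiable at (snd c x)"
    using pullback1_derivative(1)[OF assms(1-3) c d assms(5,6)] unfolding differentiable_def by blast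
qed

text \<open>The second derivatives of \<open>f\<close> are symmetric and cancel in the antisymmetrisation that defines the exterior
  derivative.\<close>

lemma ext_deriv1_pullback:
  fixes \<B> :: "('b::{t2_space,second_countable_topology}, 'f::euclidean_space) atlas"
  assumes "smooth_atlas \<A>" "smooth_atlas \<B>" "smooth_map \<A> \<B> f" "x \<in> points \<A>"
    and "\<And>y. y \<in> points \<B> \<Longrightarrow> linear (b y)" "diff_form1_at \<B> b (f x)"
  shows "ext_deriv1 \<A> (pullback1 \<A> \<B> f b) x u v =
    ext_deriv1 \<B> b (f x) (tangent_map \<A> \<B> f x u) (tangent_map \<A> \<B> f x v)"
proof -
  have p: "f x \<in> points \<B>" using assms by (auto simp: smooth_map_def)
  note c = chart_at[OF assms(4)] and d = chart_at[OF p]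
  note D = pullback1_derivative[OF assms(1-3) c d assms(5,6)]
  show ?thesis
    using D(2)[of u v]
    by (simp add: ext_deriv1_def Let_def frechet_derivative_at[OF D(1), symmetric] tangent_map_def)
qed

lemma ext_deriv1_cong:
  assumes "smooth_atlas \<A>" "x \<in> points \<A>" "\<And>y v. y \<in> points \<A> \<Longrightarrow> A y v = A' y v"
  shows "ext_deriv1 \<A> A x u v = ext_deriv1 \<A> A' x u v"
proof -
  let ?c = "chart_at \<A> x"
  note c = chart_at[OF assms(2)]
  have m: "snd ?c x \<in> snd ?c ` fst ?c" using c(2) by (rule imageI)
  have "frechet_derivative (\<lambda>y. form1_rep \<A> ?c A y w) (at (snd ?c x)) =
    frechet_derivative (\<lambda>y. form1_rep \<A> ?c A' y w) (at (snd ?c x))" for w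
  proof (rule frechet_derivative_cong_open(1)[OF chartD(2)[OF assms(1) c(1)] m])
    fix y assume "y \<in> snd ?c ` fst ?c"
    then have "chart_inv ?c y \<in> points \<A>" using chartD(5)[OF assms(1) c(1)] points_chart c(1) by metis
    then show "form1_rep \<A> ?c A y w = form1_rep \<A> ?c A' y w" by (simp add: form1_rep_def assms(3))
  qed
  then show ?thesis by (simp add: ext_deriv1_def Let_def)
qed

lemma smooth_form1_diff_at:
  assumes "smooth_form1 \<A> A"
  shows "diff_form1_at \<A> A x"
  using assms unfolding diff_form1_at_def smooth_form1_def by (blast intro: smooth_on_differentiable)

section \<open>Products of manifolds\<close>

lemma Ck_on_subset: "Ck_on k S f \<Longrightarrow> T \<subseteq> S \<Longrightarrow> Ck_on k T f"
  by (induction k arbitrary: f) (auto intro: continuous_on_subset)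

lemma Ck_on_comp_linear:
  fixes f :: "'b::real_normed_vector \<Rightarrow> 'c::real_normed_vector"
  assumes W: "open W" and l: "bounded_linear l" "l ` W \<subseteq> S" and f: "Ck_on k S f"
  shows "Ck_on k W (\<lambda>p. f (l p))"
  using f
proof (induction k arbitrary: f)
  case 0
  then have "continuous_on S f" by simp
  then show ?case
    using continuous_on_compose2[OF _ linear_continuous_on[OF l(1)] l(2), of f] by simp
next
  case (Suc k)
  have D: "((\<lambda>p. f (l p)) has_derivative (\<lambda>v. frechet_derivative f (at (l p)) (l v))) (at p)" if
      "p \<in> W" for p
  proof -
    have "f differentiable at (l p)" using Suc.prems l(2) that by auto
    then have "(f has_derivative frechet_derivative f (at (l p))) (at (l p))" by
        (simp add: frechet_derivative_works)
    from has_derivative_compose[OF bounded_linear_imp_has_derivative[OF l(1)] this] show ?thesis .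
  qed
  have "Ck_on k W (\<lambda>p. frechet_derivative f (at (l p)) (l v))" for v
    using Suc.IH[of "\<lambda>q. frechet_derivative f (at q) (l v)"] Suc.prems by simp
  then have "Ck_on k W (\<lambda>p. frechet_derivative (\<lambda>p. f (l p)) (at p) v)" for v
    using Ck_on_cong_open[OF W, of "\<lambda>p. frechet_derivative (\<lambda>p. f (l p)) (at p) v"
        "\<lambda>p. frechet_derivative f (at (l p)) (l v)" k]
    by (simp add: frechet_derivative_at[OF D, symmetric])
  moreover have "(\<lambda>p. f (l p)) differentiable at p" if "p \<in> W" for p
    using D[OF that] unfolding differentiable_def by blast
  ultimately show ?case by simp
qed

lemma frechet_derivative_Pair:
  assumes "f differentiable at x" "g differentiable at x"
  shows "(\<lambda>x. (f x, g x)) differentiable at x"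
    "frechet_derivative (\<lambda>x. (f x, g x)) (at x) v = (frechet_derivative f
        (at x) v, frechet_derivative g (at x) v)"
proof -
  have *: "((\<lambda>x. (f x, g x)) has_derivative (\<lambda>v. (frechet_derivative f
      (at x) v, frechet_derivative g (at x) v))) (at x)"
    using assms by (intro has_derivative_Pair) (simp_all add: frechet_derivative_works)
  then show "(\<lambda>x. (f x, g x)) differentiable at x" by (auto simp: differentiable_def)
  show "frechet_derivative (\<lambda>x. (f x, g x)) (at x) v
      = (frechet_derivative f (at x) v, frechet_derivative g (at x) v)"
    by (simp add: frechet_derivative_at[OF *, symmetric])
qed

lemma Ck_on_Pair:
  assumes "open W" "Ck_on k W f" "Ck_on k W g"
  shows "Ck_on k W (\<lambda>p. (f p, g p))"
  using assms(2,3)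
proof (induction k arbitrary: f g)
  case 0
  then show ?case by (auto intro!: continuous_intros)
next
  case (Suc k)
  then have "Ck_on k W (\<lambda>p. (frechet_derivative f (at p) v, frechet_derivative g
      (at p) v))" for v by simp
  then have "Ck_on k W (\<lambda>p. frechet_derivative (\<lambda>p. (f p, g p)) (at p) v)" for v
    using Suc.prems Ck_on_cong_open[OF assms(1), of "\<lambda>p. frechet_derivative (\<lambda>p. (f p, g p)) (at p) v"
        "\<lambda>p. (frechet_derivative f (at p) v, frechet_derivative g (at p) v)" k]
    by (simp add: frechet_derivative_Pair)
  then show ?case using Suc.prems by (auto intro: frechet_derivative_Pair)
qed

definition prod_chart :: "('a, 'e) chart \<Rightarrow> ('b, 'f) chart \<Rightarrow> ('a \<times> 'b, 'e \<times> 'f) chart" where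
  "prod_chart c d = (fst c \<times> fst d, map_prod (snd c) (snd d))"

lemma prod_atlas_charts: "e \<in> prod_atlas \<A> \<B> \<longleftrightarrow> (\<exists>c\<in>\<A>. \<exists>d\<in>\<B>. e = prod_chart c d)"
  by (auto simp: prod_atlas_def prod_chart_def)

lemma fst_prod_chart [simp]: "fst (prod_chart c d) = fst c \<times> fst d"
  and snd_prod_chart [simp]: "snd (prod_chart c d) = map_prod (snd c) (snd d)"
  by (simp_all add: prod_chart_def)

lemma points_prod_atlas: "points (prod_atlas \<A> \<B>) = points \<A> \<times> points \<B>"
  by (auto simp: points_def prod_atlas_def; force)

lemma prod_chart_image: "snd (prod_chart c d) ` fst (prod_chart c d) = (snd c ` fst c) \<times> (snd d ` fst d)"
  by (auto simp: image_iff; blast)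

lemma chart_inv_prod:
  assumes "smooth_atlas \<A>" "smooth_atlas \<B>" "c \<in> \<A>" "d \<in> \<B>" "y \<in> (snd c ` fst c) \<times> (snd d ` fst d)"
  shows "chart_inv (prod_chart c d) y = (chart_inv c (fst y), chart_inv d (snd y))"
proof -
  have y: "fst y \<in> snd c ` fst c" "snd y \<in> snd d ` fst d" using assms(5) by auto
  have inj: "inj_on (snd c) (fst c)" "inj_on (snd d) (fst d)"
    using chartD(4)[OF assms(1,3)] chartD(4)[OF assms(2,4)] by (metis inj_onI)+
  then have "inj_on (snd (prod_chart c d)) (fst (prod_chart c d))"
    by (auto simp: inj_on_def)
  then show ?thesis
    unfolding chart_inv_def[of "prod_chart c d"]
    by (rule inv_into_f_eq)
      (use chartD(5,6)[OF assms(1,3) y(1)] chartD(5,6)[OF assms(2,4) y(2)] in \<open>simp_all add: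
          map_prod_def\<close>)
qed

lemma smooth_atlas_prod:
  fixes \<A> :: "('a::{t2_space,second_countable_topology}, 'e::real_normed_vector) atlas"
    and \<B> :: "('b::{t2_space,second_countable_topology}, 'f::real_normed_vector) atlas"
  assumes A: "smooth_atlas \<A>" and B: "smooth_atlas \<B>"
  shows "smooth_atlas (prod_atlas \<A> \<B>)"
  unfolding smooth_atlas_def
proof (intro conjI ballI)
  fix e assume "e \<in> prod_atlas \<A> \<B>"
  then obtain c d where c: "c \<in> \<A>" and d: "d \<in> \<B>" and e: "e
      = prod_chart c d" by (auto simp: prod_atlas_charts)
  let ?U = "(snd c ` fst c) \<times> (snd d ` fst d)"
  note inv = chart_inv_prod[OF A B c d]
  show "open (fst e)" using chartD(1)[OF A c] chartD(1)[OF B d] by (simp add: e open_Times)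
  show "open (snd e ` fst e)"
    unfolding e prod_chart_image using chartD(2)[OF A c] chartD(2)[OF B d] by (simp add: open_Times)
  show "homeomorphism (fst e) (snd e ` fst e) (snd e) (chart_inv e)"
  proof (rule homeomorphismI)
    have "continuous_on (fst c) (snd c)" "continuous_on (fst d) (snd d)"
      using chartD(3)[OF A c] chartD(3)[OF B d] by (auto simp: homeomorphism_def)
    then show "continuous_on (fst e) (snd e)"
      unfolding e snd_prod_chart fst_prod_chart map_prod_def case_prod_unfold
      by (intro continuous_on_Pair continuous_on_compose2[OF _ continuous_on_fst[OF continuous_on_id]]
          continuous_on_compose2[OF _ continuous_on_snd[OF continuous_on_id]]) auto
    have "continuous_on (snd c ` fst c) (chart_inv c)" "continuous_on (snd d ` fst d) (chart_inv d)"
      using chartD(3)[OF A c] chartD(3)[OF B d] by (auto simp: homeomorphism_def)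
    then have "continuous_on ?U (\<lambda>y. (chart_inv c (fst y), chart_inv d (snd y)))"
      by (intro continuous_on_Pair continuous_on_compose2[OF _ continuous_on_fst[OF continuous_on_id]]
          continuous_on_compose2[OF _ continuous_on_snd[OF continuous_on_id]]) auto
    then show "continuous_on (snd e ` fst e) (chart_inv e)"
      unfolding e prod_chart_image by (rule continuous_on_eq) (simp add: inv)
    show "chart_inv e ` (snd e ` fst e) \<subseteq> fst e"
      unfolding e prod_chart_image using chartD(5)[OF A c] chartD(5)[OF B d] by (auto simp: inv)
    show "chart_inv e (snd e x) = x" if "x \<in> fst e" for x
      using that chartD(4)[OF A c] chartD(4)[OF B d] by (auto simp: e inv)
    show "snd e (chart_inv e y) = y" if "y \<in> snd e ` fst e" for y
      using that chartD(6)[OF A c] chartD(6)[OF B d] unfolding e prod_chart_image by (auto simp: inv)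
  qed simp
next
  fix e e' assume "e \<in> prod_atlas \<A> \<B>" "e' \<in> prod_atlas \<A> \<B>"
  then obtain c d c' d' where c: "c \<in> \<A>" "c' \<in> \<A>" and d: "d \<in> \<B>" "d' \<in> \<B>"
    and e: "e = prod_chart c d" "e' = prod_chart c' d'" by (auto simp: prod_atlas_charts)
  let ?W = "(snd c ` (fst c \<inter> fst c')) \<times> (snd d ` (fst d \<inter> fst d'))"
  have W: "snd e ` (fst e \<inter> fst e') = ?W" by (auto simp: e image_iff; blast)
  have o: "open ?W"
    by (intro open_Times open_chart_image[OF A c(1) chartD(1)[OF A c(2)]] open_chart_image[OF B d(1)
        chartD(1)[OF B d(2)]])
  have "Ck_on k ?W (\<lambda>y. (chart_rep c c' id (fst y), chart_rep d d' id (snd y)))" for k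
    using transition_smooth[OF A c] transition_smooth[OF B d] unfolding smooth_on_def
    by (intro Ck_on_Pair[OF o] Ck_on_comp_linear[OF o bounded_linear_fst, of "snd c ` (fst c \<inter> fst c')"]
        Ck_on_comp_linear[OF o bounded_linear_snd, of "snd d ` (fst d \<inter> fst d')"]) (auto simp: comp_def)
  moreover have "(snd e' \<circ> chart_inv e) y = (chart_rep c c' id (fst y), chart_rep d d' id
      (snd y))" if "y \<in> ?W" for y
    using that chart_inv_prod[OF A B c(1) d(1), of y] by (auto simp: e)
  ultimately show "smooth_on (snd e ` (fst e \<inter> fst e')) (snd e' \<circ> chart_inv e)"
    unfolding W smooth_on_def
    using Ck_on_cong_open[OF o, of "snd e' \<circ> chart_inv e"
        "\<lambda>y. (chart_rep c c' id (fst y), chart_rep d d' id (snd y))"]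
    by blast
qed

lemma smooth_map_snd:
  fixes \<A> :: "('a::{t2_space,second_countable_topology}, 'e::real_normed_vector) atlas"
    and \<B> :: "('b::{t2_space,second_countable_topology}, 'f::real_normed_vector) atlas"
  assumes A: "smooth_atlas \<A>" and B: "smooth_atlas \<B>"
  shows "smooth_map (prod_atlas \<A> \<B>) \<B> snd"
  unfolding smooth_map_def
proof (intro conjI ballI)
  show "snd ` points (prod_atlas \<A> \<B>) \<subseteq> points \<B>" by (auto simp: points_prod_atlas)
  show "continuous_on (points (prod_atlas \<A> \<B>)) snd" by (intro continuous_intros)
  fix e d' assume "e \<in> prod_atlas \<A> \<B>" and d': "d' \<in> \<B>"
  then obtain c d where c: "c \<in> \<A>" and d: "d \<in> \<B>" and e: "e
      = prod_chart c d" by (auto simp: prod_atlas_charts)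
  let ?W = "(snd c ` fst c) \<times> (snd d ` (fst d \<inter> fst d'))"
  have W: "snd e ` (fst e \<inter> snd -` fst d') = ?W" by (auto simp: e image_iff; blast)
  have o: "open ?W"
    by (intro open_Times chartD(2)[OF A c] open_chart_image[OF B d chartD(1)[OF B d']])
  have "Ck_on k ?W (\<lambda>y. chart_rep d d' id (snd y))" for k
    using transition_smooth[OF B d d'] unfolding smooth_on_def
    by (intro Ck_on_comp_linear[OF o bounded_linear_snd, of
        "snd d ` (fst d \<inter> fst d')"]) (auto simp: comp_def)
  moreover have "chart_rep e d' snd y = chart_rep d d' id (snd y)" if "y \<in> ?W" for y
    using that chart_inv_prod[OF A B c d, of y] by (auto simp: e)
  ultimately show "smooth_on (snd e ` (fst e \<inter> snd -` fst d')) (chart_rep e d' snd)"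
    unfolding W smooth_on_def
    using Ck_on_cong_open[OF o, of "chart_rep e d' snd" "\<lambda>y. chart_rep d d' id (snd y)"] by blast
qed

text \<open>In a product chart the projections have constant derivative, namely themselves.\<close>

lemma chart_rep_projections:
  fixes \<A> :: "('a::{t2_space,second_countable_topology}, 'e::real_normed_vector) atlas"
    and \<B> :: "('b::{t2_space,second_countable_topology}, 'f::real_normed_vector) atlas"
  assumes A: "smooth_atlas \<A>" and B: "smooth_atlas \<B>" and c: "c \<in> \<A>" "x \<in> fst c"
      and d: "d \<in> \<B>" "y \<in> fst d"
  shows "(chart_rep (prod_chart c d) c fst has_derivative fst) (at (snd c x, snd d y))"
    "(chart_rep (prod_chart c d) d snd has_derivative snd) (at (snd c x, snd d y))"
proof -
  let ?W = "(snd c ` fst c) \<times> (snd d ` fst d)"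
  have o: "open ?W" by (intro open_Times chartD(2)[OF A c(1)] chartD(2)[OF B d(1)])
  have m: "(snd c x, snd d y) \<in> ?W" using c d by auto
  have "(fst has_derivative fst) (at (snd c x, snd d y))" by (auto intro!: derivative_eq_intros)
  then show "(chart_rep (prod_chart c d) c fst has_derivative fst) (at (snd c x, snd d y))"
    by (rule has_derivative_transform_within_open[OF _ o m])
      (auto simp: chart_inv_prod[OF A B c(1) d(1)] chartD(4)[OF A c(1)])
  have "(snd has_derivative snd) (at (snd c x, snd d y))" by (auto intro!: derivative_eq_intros)
  then show "(chart_rep (prod_chart c d) d snd has_derivative snd) (at (snd c x, snd d y))"
    by (rule has_derivative_transform_within_open[OF _ o m])
      (auto simp: chart_inv_prod[OF A B c(1) d(1)] chartD(4)[OF B d(1)])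
qed

context
  fixes \<A> :: "('a::{t2_space,second_countable_topology}, 'e::real_normed_vector) atlas"
    and \<B> :: "('b::{t2_space,second_countable_topology}, 'f::real_normed_vector) atlas"
  assumes A: "smooth_atlas \<A>" and B: "smooth_atlas \<B>"
begin

lemma diff_at_fst: "p \<in> points (prod_atlas \<A> \<B>) \<Longrightarrow> diff_at (prod_atlas \<A> \<B>) \<A> fst p"
proof -
  assume "p \<in> points (prod_atlas \<A> \<B>)"
  then have p: "fst p \<in> points \<A>" "snd p \<in> points \<B>" by (auto simp: points_prod_atlas)
  note c = chart_at[OF p(1)] and d = chart_at[OF p(2)]
  let ?e = "prod_chart (chart_at \<A> (fst p)) (chart_at \<B> (snd p))"
  have "?e \<in> prod_atlas \<A> \<B>" using c d by (auto simp: prod_atlas_charts)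
  moreover have "chart_rep ?e (chart_at \<A> (fst p)) fst differentiable at (snd ?e p)"
    using chart_rep_projections(1)[OF A B c d] by (auto simp: differentiable_def map_prod_def
        case_prod_unfold)
  moreover have "p \<in> fst ?e" using c d by (cases p) auto
  moreover have "isCont fst p" by (intro continuous_intros)
  ultimately show ?thesis
    using diff_at_charts[of "prod_atlas \<A> \<B>" \<A> ?e "chart_at \<A>
        (fst p)" p fst] c A smooth_atlas_prod[OF A B] by blast
qed

lemma diff_at_snd: "p \<in> points (prod_atlas \<A> \<B>) \<Longrightarrow> diff_at (prod_atlas \<A> \<B>) \<B> snd p"
  by (rule smooth_map_diff_at[OF smooth_atlas_prod[OF A B] smooth_map_snd[OF A B]])

lemma diff_at_Pair:
  assumes C: "smooth_atlas \<C>" and f: "diff_at \<C> \<A> f x" and g: "diff_at \<C> \<B> g x"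
  shows "diff_at \<C> (prod_atlas \<A> \<B>) (\<lambda>x. (f x, g x)) x"
proof -
  have p: "x \<in> points \<C>" "f x \<in> points \<A>" "g x \<in> points \<B>" "isCont f x" "isCont g x"
    using f g by (auto simp: diff_at_def)
  note b = chart_at[OF p(1)] and c = chart_at[OF p(2)] and d = chart_at[OF p(3)]
  let ?b = "chart_at \<C> x" and ?c = "chart_at \<A> (f x)" and ?d = "chart_at \<B> (g x)"
  have e: "prod_chart ?c ?d \<in> prod_atlas \<A> \<B>" using c d by (auto simp: prod_atlas_charts)
  have "chart_rep ?b (prod_chart ?c ?d) (\<lambda>x. (f x, g x))
      = (\<lambda>y. (chart_rep ?b ?c f y, chart_rep ?b ?d g y))"
    by (simp add: fun_eq_iff)
  moreover have "(\<lambda>y. (chart_rep ?b ?c f y, chart_rep ?b ?d g y)) differentiable at (snd ?b x)"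
    using f g by (intro frechet_derivative_Pair) (simp_all add: diff_at_def comp_def)
  moreover have "(f x, g x) \<in> fst (prod_chart ?c ?d)" using c d by simp
  moreover have "isCont (\<lambda>x. (f x, g x)) x" using p by (intro continuous_intros)
  ultimately show ?thesis
    using diff_at_charts[of \<C> "prod_atlas \<A> \<B>" ?b "prod_chart ?c ?d" x
        "\<lambda>x. (f x, g x)"] b e C smooth_atlas_prod[OF A B]
    by simp
qed

text \<open>A product chart need not consist of the chosen charts of the factors, so the differentials of the two
  projections are the coordinate projections only up to the derivatives of transition maps. These are
  invertible, and the components of \<open>X\<close> are recovered from its two images.\<close>

lemma tangent_vector_zero:
  assumes p: "p \<in> points (prod_atlas \<A> \<B>)" and X: "tangent_map (prod_atlas \<A> \<B>) \<A> fst p X = 0"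
    "tangent_map (prod_atlas \<A> \<B>) \<B> snd p X = 0"
  shows "X = 0"
proof -
  note AB = smooth_atlas_prod[OF A B]
  have q: "fst p \<in> points \<A>" "snd p \<in> points \<B>" using p by (auto simp: points_prod_atlas)
  note e = chart_at[OF p] and c' = chart_at[OF q(1)] and d' = chart_at[OF q(2)]
  obtain c d where c: "c \<in> \<A>" and d: "d \<in> \<B>" and e': "chart_at (prod_atlas \<A> \<B>) p = prod_chart c d"
    using e(1) by (auto simp: prod_atlas_charts)
  have cd: "fst p \<in> fst c" "snd p \<in> fst d" using e(2) by (auto simp: e')
  have se: "snd (prod_chart c d) p = (snd c (fst p), snd d (snd p))" by
      (simp add: map_prod_def case_prod_unfold)
  note f = diff_at_fst[OF p] and s = diff_at_snd[OF p]
  have "fst X = frechet_derivative (chart_rep (prod_chart c d) c (id \<circ> fst)) (at (snd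
      (prod_chart c d) p)) X"
    using frechet_derivative_at[OF chart_rep_projections(1)[OF A B c cd(1) d cd(2)]] by
        (simp add: se del: snd_prod_chart)
  also have "\<dots> = frechet_derivative (chart_rep (chart_at \<A> (fst p)) c id) (at (snd (chart_at \<A>
      (fst p)) (fst p)))
      (tangent_map (prod_atlas \<A> \<B>) \<A> fst p X)"
    unfolding tangent_map_def e'
    using chart_rep_differentiable_chain(2)[of "prod_atlas \<A> \<B>" \<A> "prod_chart c d"
        "chart_at \<A> (fst p)" p fst c id X]
      AB A e c' f transition_differentiable[OF A c'(1) c c'(2) cd(1)] by (simp add: e' diff_at_def)
  also have "\<dots> = 0"
    using transition_differentiable[OF A c'(1) c c'(2) cd(1)] by
        (simp add: X(1) linear_0[OF linear_frechet_derivative])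
  finally have 1: "fst X = 0" .
  have "snd X = frechet_derivative (chart_rep (prod_chart c d) d (id \<circ> snd)) (at (snd
      (prod_chart c d) p)) X"
    using frechet_derivative_at[OF chart_rep_projections(2)[OF A B c cd(1) d cd(2)]] by
        (simp add: se del: snd_prod_chart)
  also have "\<dots> = frechet_derivative (chart_rep (chart_at \<B> (snd p)) d id) (at (snd (chart_at \<B>
      (snd p)) (snd p)))
      (tangent_map (prod_atlas \<A> \<B>) \<B> snd p X)"
    unfolding tangent_map_def e'
    using chart_rep_differentiable_chain(2)[of "prod_atlas \<A> \<B>" \<B> "prod_chart c d"
        "chart_at \<B> (snd p)" p snd d id X]
      AB B e d' s transition_differentiable[OF B d'(1) d d'(2) cd(2)] by (simp add: e' diff_at_def)
  also have "\<dots> = 0"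
    using transition_differentiable[OF B d'(1) d d'(2) cd(2)] by
        (simp add: X(2) linear_0[OF linear_frechet_derivative])
  finally show ?thesis using 1 by (simp add: prod_eq_iff)
qed

lemma diff_at_insert:
  assumes "a \<in> points \<A>" "b \<in> points \<B>"
  shows "diff_at \<A> (prod_atlas \<A> \<B>) (\<lambda>x. (x, b)) a" "diff_at \<B> (prod_atlas \<A> \<B>) (\<lambda>y. (a, y)) b"
  using assms A B by (auto intro!: diff_at_Pair tangent_map_id tangent_map_const)

lemma tangent_map_insert:
  assumes "a \<in> points \<A>" "b \<in> points \<B>"
  shows "tangent_map (prod_atlas \<A> \<B>) \<A> fst (a, b) (tangent_map \<A> (prod_atlas \<A> \<B>) (\<lambda>x. (x, b)) a u) = u"
    "tangent_map (prod_atlas \<A> \<B>) \<B> snd (a, b) (tangent_map \<A> (prod_atlas \<A> \<B>) (\<lambda>x. (x, b)) a u) = 0"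
    "tangent_map (prod_atlas \<A> \<B>) \<A> fst (a, b) (tangent_map \<B> (prod_atlas \<A> \<B>) (\<lambda>y. (a, y)) b v) = 0"
    "tangent_map (prod_atlas \<A> \<B>) \<B> snd (a, b) (tangent_map \<B> (prod_atlas \<A> \<B>) (\<lambda>y. (a, y)) b v) = v"
proof -
  have p: "(a, b) \<in> points (prod_atlas \<A> \<B>)" using assms by (simp add: points_prod_atlas)
  note AB = smooth_atlas_prod[OF A B]
  note i = diff_at_insert[OF assms] and f = diff_at_fst[OF p] and s = diff_at_snd[OF p]
  show "tangent_map (prod_atlas \<A> \<B>) \<A> fst (a, b) (tangent_map \<A> (prod_atlas \<A> \<B>) (\<lambda>x. (x, b)) a u) = u"
    using diff_at_compose(2)[OF A AB i(1), of \<A> fst u] f tangent_map_id[OF A assms(1)] by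
        (simp add: comp_def)
  show "tangent_map (prod_atlas \<A> \<B>) \<B> snd (a, b) (tangent_map \<A> (prod_atlas \<A> \<B>) (\<lambda>x. (x, b)) a u) = 0"
    using diff_at_compose(2)[OF A AB i(1), of \<B> snd u] s tangent_map_const[OF A assms] by
        (simp add: comp_def)
  show "tangent_map (prod_atlas \<A> \<B>) \<A> fst (a, b) (tangent_map \<B> (prod_atlas \<A> \<B>) (\<lambda>y. (a, y)) b v) = 0"
    using diff_at_compose(2)[OF B AB i(2), of \<A> fst v] f tangent_map_const[OF B assms(2,1)] by
        (simp add: comp_def)
  show "tangent_map (prod_atlas \<A> \<B>) \<B> snd (a, b) (tangent_map \<B> (prod_atlas \<A> \<B>) (\<lambda>y. (a, y)) b v) = v"
    using diff_at_compose(2)[OF B AB i(2), of \<B> snd v] s tangent_map_id[OF B assms(2)] by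
        (simp add: comp_def)
qed

text \<open>Both sides have the same images under the differentials of the two projections.\<close>

lemma tangent_map_decompose:
  assumes "a \<in> points \<A>" "b \<in> points \<B>"
  shows "X = tangent_map \<A> (prod_atlas \<A> \<B>) (\<lambda>x. (x, b)) a (tangent_map (prod_atlas \<A> \<B>) \<A> fst
      (a, b) X) +
    tangent_map \<B> (prod_atlas \<A> \<B>) (\<lambda>y. (a, y)) b (tangent_map (prod_atlas \<A> \<B>) \<B> snd (a, b) X)" (is
        "X = ?Y")
proof -
  have p: "(a, b) \<in> points (prod_atlas \<A> \<B>)" using assms by (simp add: points_prod_atlas)
  note lin = linear_tangent_map[OF diff_at_fst[OF p]] linear_tangent_map[OF diff_at_snd[OF p]]
  have "X - ?Y = 0"
    by (rule tangent_vector_zero[OF p])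
      (simp_all add: linear_diff[OF lin(1)] linear_diff[OF lin(2)] linear_add[OF lin(1)]
          linear_add[OF lin(2)]
        tangent_map_insert[OF assms])
  then show ?thesis by simp
qed

end

section \<open>Open subsets, bundle projections and the half line\<close>

lemma chart_inv_restrict:
  assumes A: "smooth_atlas \<A>" "c \<in> \<A>" and y: "y \<in> snd c ` (fst c \<inter> S)"
  shows "chart_inv (fst c \<inter> S, snd c) y = chart_inv c y"
proof -
  obtain x where x: "x \<in> fst c \<inter> S" "y = snd c x" using y by auto
  have "inj_on (snd c) (fst c \<inter> S)" using chartD(4)[OF A] by (metis Int_iff inj_onI)
  then have "chart_inv (fst c \<inter> S, snd c) y = x"
    unfolding chart_inv_def by (intro inv_into_f_eq) (use x in auto)
  then show ?thesis using x chartD(4)[OF A] by auto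
qed

lemma points_restrict_atlas: "points (restrict_atlas \<A> S) = points \<A> \<inter> S"
  by (auto simp: points_def restrict_atlas_def)

lemma smooth_atlas_restrict:
  assumes A: "smooth_atlas \<A>" and S: "open (points \<A> \<inter> S)"
  shows "smooth_atlas (restrict_atlas \<A> S)"
  unfolding smooth_atlas_def
proof (intro conjI ballI)
  have eq: "fst c \<inter> S = fst c \<inter> (points \<A> \<inter> S)" if "c \<in> \<A>" for c
    using that by (auto simp: points_def)
  have op: "open (fst c \<inter> S)" if "c \<in> \<A>" for c
    using chartD(1)[OF A that] S eq[OF that] by (metis open_Int)
  {
    fix e assume "e \<in> restrict_atlas \<A> S"
    then obtain c where c: "c \<in> \<A>" and e: "e = (fst c \<inter> S, snd c)" by (auto simp: restrict_atlas_def)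
    show "open (fst e)" using op[OF c] by (simp add: e)
    show "open (snd e ` fst e)" using open_chart_image[OF A c S] eq[OF c] by (simp add: e)
    have "homeomorphism (fst c \<inter> S) (snd c ` (fst c \<inter> S)) (snd c) (chart_inv c)"
      by (rule homeomorphism_of_subsets[OF chartD(3)[OF A c]]) auto
    then have "homeomorphism (fst c \<inter> S) (snd c ` (fst c \<inter> S)) (snd c) (chart_inv (fst c \<inter> S, snd c))"
      by (rule homeomorphism_cong) (auto simp: chart_inv_restrict[OF A c])
    then show "homeomorphism (fst e) (snd e ` fst e) (snd e) (chart_inv e)" by (simp add: e)
  }
  fix e e' assume "e \<in> restrict_atlas \<A> S" "e' \<in> restrict_atlas \<A> S"
  then obtain c c' where c: "c \<in> \<A>" "c' \<in> \<A>" and e: "e = (fst c \<inter> S, snd c)" "e' = (fst c' \<inter> S, snd c')"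
    by (auto simp: restrict_atlas_def)
  have W: "open (snd c ` (fst c \<inter> (fst c' \<inter> S)))" by (rule open_chart_image[OF A c(1) op[OF c(2)]])
  have "Ck_on k (snd c ` (fst c \<inter> (fst c' \<inter> S))) (snd c' \<circ> chart_inv (fst c \<inter> S, snd c))" for k
  proof -
    have "Ck_on k (snd c ` (fst c \<inter> (fst c' \<inter> S))) (chart_rep c c' id)"
      using transition_smooth[OF A c] unfolding smooth_on_def by (blast intro: Ck_on_subset)
    moreover have "chart_rep c c' id y = (snd c' \<circ> chart_inv (fst c \<inter> S, snd c)) y"
      if "y \<in> snd c ` (fst c \<inter> (fst c' \<inter> S))" for y
      using that by (auto simp: chart_inv_restrict[OF A c(1)])
    ultimately show ?thesis using Ck_on_cong_open[OF W] by blast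
  qed
  moreover have "fst e \<inter> fst e' = fst c \<inter> (fst c' \<inter> S)" by (auto simp: e)
  ultimately show "smooth_on (snd e ` (fst e \<inter> fst e')) (snd e' \<circ> chart_inv e)"
    by (simp add: smooth_on_def e)
qed

text \<open>The restricted atlas makes its own choice of a chart around \<open>x\<close>, so the tangent spaces at \<open>x\<close> of a manifold
  and of an open subset are related by the tangent map of the identity.\<close>

lemma diff_at_restrict:
  assumes A: "smooth_atlas \<A>" and S: "open (points \<A> \<inter> S)" and x: "x \<in> points \<A>" "x \<in> S"
  shows "diff_at (restrict_atlas \<A> S) \<A> (\<lambda>x. x) x" "diff_at \<A> (restrict_atlas \<A> S) (\<lambda>x. x) x"
proof -
  note R = smooth_atlas_restrict[OF A S]
  let ?c = "chart_at \<A> x" and ?e = "(fst (chart_at \<A> x) \<inter> S, snd (chart_at \<A> x))"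
  note c = chart_at[OF x(1)]
  have e: "?e \<in> restrict_atlas \<A> S" "x \<in> fst ?e" using c x by (auto simp: restrict_atlas_def)
  have cont: "isCont (\<lambda>x. x) x" by simp
  have id: "chart_rep ?c ?c id differentiable at (snd ?c x)"
    by (rule transition_differentiable[OF A c(1) c(1) c(2) c(2)])
  have W: "open (snd ?c ` (fst ?c \<inter> (points \<A> \<inter> S)))" "snd ?c x \<in> snd ?c ` (fst ?c \<inter> (points \<A> \<inter> S))"
    using open_chart_image[OF A c(1) S] c x by auto
  have "chart_rep ?e ?c (\<lambda>x. x) differentiable at (snd ?c x)
      \<longleftrightarrow> chart_rep ?c ?c id differentiable at (snd ?c x)"
  proof (rule frechet_derivative_cong_open(2)[OF W])
    fix y assume "y \<in> snd ?c ` (fst ?c \<inter> (points \<A> \<inter> S))"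
    then have "chart_inv ?e y = chart_inv ?c y" by (intro chart_inv_restrict[OF A c(1)]) auto
    then show "chart_rep ?e ?c (\<lambda>x. x) y = chart_rep ?c ?c id y" by simp
  qed
  then show "diff_at (restrict_atlas \<A> S) \<A> (\<lambda>x. x) x"
    using diff_at_charts[of "restrict_atlas \<A> S" \<A> ?e ?c x "\<lambda>x. x"] R A e c id cont by simp
  have "chart_rep ?c ?e (\<lambda>x. x) differentiable at (snd ?c x)" using id by (simp add: id_def)
  then show "diff_at \<A> (restrict_atlas \<A> S) (\<lambda>x. x) x"
    using diff_at_charts[of \<A> "restrict_atlas \<A> S" ?c ?e x "\<lambda>x. x"] R A e c cont by simp
qed

text \<open>A local trivialisation provides a local section through \<open>p\<close>, namely the preimages of the points \<open>(y, h)\<close> for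
  the fixed group component \<open>h\<close> of \<open>p\<close>. Its differential is a right inverse of that of the projection.\<close>

lemma tangent_proj_surj:
  fixes G :: "('h::{t2_space,second_countable_topology}, 'g::real_normed_vector) lie_struct"
    and \<B> :: "('b::{t2_space,second_countable_topology}, 'e::real_normed_vector) atlas"
    and P :: "('p::{t2_space,second_countable_topology}, 'q::real_normed_vector, 'b, 'h) bundle_struct"
  assumes P: "principal_bundle G \<B> P" and p: "p \<in> points (tot P)"
  obtains X where "tangent_map (tot P) \<B> (proj P) p X = Y"
proof -
  have B: "smooth_atlas \<B>" and T: "smooth_atlas (tot P)" and G: "smooth_atlas (atlas G)"
    and proj: "smooth_map (tot P) \<B> (proj P)"
    using P by (auto simp: principal_bundle_def lie_group_def)
  define x where "x = proj P p"
  have x: "x \<in> points \<B>" using proj p by (auto simp: smooth_map_def x_def)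
  have "\<exists>U \<tau>. open U \<and> x \<in> U \<and> U \<subseteq> points \<B> \<and>
      diffeo (restrict_atlas (tot P) (proj P -` U)) (prod_atlas (restrict_atlas \<B> U) (atlas G)) \<tau> \<and>
      (\<forall>p\<in>points (tot P). proj P p \<in> U \<longrightarrow> fst (\<tau> p) = proj P p \<and>
        (\<forall>a\<in>carrier G. \<tau> (act P p a) = (proj P p, snd (\<tau> p) \<otimes>\<^bsub>G\<^esub> a)))"
    using P unfolding principal_bundle_def by (elim conjE) (erule bspec[OF _ x])
  then obtain U \<tau> where U: "open U" "x \<in> U" "U \<subseteq> points \<B>"
    and \<tau>: "diffeo (restrict_atlas (tot P) (proj P -` U)) (prod_atlas (restrict_atlas \<B> U) (atlas G)) \<tau>"
    and \<tau>': "\<forall>p\<in>points (tot P). proj P p \<in> U \<longrightarrow> fst (\<tau> p) = proj P p \<and>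
        (\<forall>a\<in>carrier G. \<tau> (act P p a) = (proj P p, snd (\<tau> p) \<otimes>\<^bsub>G\<^esub> a))"
    by (elim exE conjE) (rule that)
  have fst\<tau>: "fst (\<tau> p) = proj P p" if "p \<in> points (tot P)" "proj P p \<in> U" for p
    using \<tau>' that by simp
  define R where "R = restrict_atlas (tot P) (proj P -` U)"
  define V where "V = restrict_atlas \<B> U"
  define W where "W = prod_atlas V (atlas G)"
  have oU: "open (points \<B> \<inter> U)" using U open_points[OF B] by blast
  have oT: "open (points (tot P) \<inter> proj P -` U)"
    using proj U(1) open_points[OF T] by (intro continuous_open_preimage) (auto simp: smooth_map_def)
  have R: "smooth_atlas R" and V: "smooth_atlas V" and W: "smooth_atlas W"
    using smooth_atlas_restrict[OF T oT] smooth_atlas_restrict[OF B oU] smooth_atlas_prod[OF _ G]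
    by (auto simp: R_def V_def W_def)
  have pR: "p \<in> points R" using p U by (simp add: R_def points_restrict_atlas x_def)
  have bij: "bij_betw \<tau> (points R) (points W)" and inv: "smooth_map W R (inv_into (points R) \<tau>)"
    using \<tau> by (simp_all add: diffeo_def R_def W_def V_def)
  define h where "h = snd (\<tau> p)"
  have \<tau>p: "\<tau> p = (x, h)" using fst\<tau>[OF p] U by (simp add: prod_eq_iff h_def x_def)
  then have xh: "(x, h) \<in> points W" using bij_betwE[OF bij] pR by metis
  then have xV: "x \<in> points V" and h: "h \<in> points (atlas G)" by (auto simp: W_def points_prod_atlas)
  define \<sigma> where "\<sigma> y = inv_into (points R) \<tau> (y, h)" for y
  have \<sigma>x: "\<sigma> x = p" using bij pR by (simp add: \<sigma>_def bij_betw_def flip: \<tau>p)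
  have lifts: "proj P (\<sigma> y) = y" if "y \<in> U" for y
  proof -
    have "(y, h) \<in> points W" using that U h by (auto simp: W_def V_def points_prod_atlas
        points_restrict_atlas)
    then have "(y, h) \<in> \<tau> ` points R" using bij by (simp add: bij_betw_def)
    then have "\<sigma> y \<in> points R" "\<tau> (\<sigma> y) = (y, h)"
      unfolding \<sigma>_def by (rule inv_into_into, rule f_inv_into_f)
    then show ?thesis using fst\<tau>[of "\<sigma> y"] by (simp add: R_def points_restrict_atlas)
  qed
  have "diff_at V W (\<lambda>y. (y, h)) x" unfolding W_def by (rule diff_at_insert[OF V G xV h])
  then have "diff_at V R (inv_into (points R) \<tau> \<circ> (\<lambda>y. (y, h))) x"
    by (rule diff_at_compose(1)[OF V W]) (rule smooth_map_diff_at[OF W inv xh])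
  then have \<sigma>V: "diff_at V R \<sigma> x" by (simp add: \<sigma>_def[abs_def] comp_def)
  \<comment> \<open>the section is first differentiable for the restricted atlases; composing with identities changes to the full ones\<close>
  have "diff_at \<B> R (\<sigma> \<circ> (\<lambda>x. x)) x"
    by (rule diff_at_compose(1)[OF B V]) (use \<sigma>V diff_at_restrict(2)[OF B oU x U(2)] in \<open>simp_all
        add: V_def\<close>)
  then have "diff_at \<B> (tot P) ((\<lambda>x. x) \<circ> (\<sigma> \<circ> (\<lambda>x. x))) x"
    by (rule diff_at_compose(1)[OF B R]) (use diff_at_restrict(1)[OF T oT p] U in \<open>simp add: R_def
        \<sigma>x flip: x_def\<close>)
  then have \<sigma>: "diff_at \<B> (tot P) \<sigma> x" by (simp add: comp_def)
  have "tangent_map (tot P) \<B> (proj P) p (tangent_map \<B> (tot P) \<sigma> x Y)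
      = tangent_map \<B> \<B> (proj P \<circ> \<sigma>) x Y"
    using diff_at_compose(2)[OF B T \<sigma>, of \<B> "proj P" Y] smooth_map_diff_at[OF T proj p] by (simp add: \<sigma>x)
  also have "\<dots> = tangent_map \<B> \<B> (\<lambda>x. x) x Y"
    using tangent_map_cong(1)[OF B x U(1,2), of "proj P \<circ> \<sigma>" "\<lambda>x. x" \<B>] lifts by simp
  also have "\<dots> = Y" by (rule tangent_map_id(1)[OF B x])
  finally show ?thesis by (rule that)
qed

lemma diffeo_tangent:
  assumes A: "smooth_atlas \<A>" and B: "smooth_atlas \<B>" and f: "diffeo \<A> \<B> f" and x: "x \<in> points \<A>"
  shows "tangent_map \<B> \<A> (inv_into (points \<A>) f) (f x) (tangent_map \<A> \<B> f x v) = v"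
    "tangent_map \<A> \<B> f x (tangent_map \<B> \<A> (inv_into (points \<A>) f) (f x) w) = w"
proof -
  let ?i = "inv_into (points \<A>) f"
  have bij: "bij_betw f (points \<A>) (points \<B>)" using f by (simp add: diffeo_def)
  have y: "f x \<in> points \<B>" using bij x by (auto simp: bij_betw_def)
  have i: "?i (f y) = y" if "y \<in> points \<A>" for y using bij that by (simp add: bij_betw_def)
  have i': "f (?i y) = y" if "y \<in> points \<B>" for y using bij that by (metis bij_betw_inv_into_right)
  have d: "diff_at \<A> \<B> f x" "diff_at \<B> \<A> ?i (f x)"
    using f smooth_map_diff_at[OF A _ x] smooth_map_diff_at[OF B _ y] by (auto simp: diffeo_def)
  show "tangent_map \<B> \<A> ?i (f x) (tangent_map \<A> \<B> f x v) = v"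
    using diff_at_compose(2)[OF A B d, of v] tangent_map_id(1)[OF A x, of v]
      tangent_map_cong(1)[OF A x open_points[OF A] x, of "?i \<circ> f" "\<lambda>x. x" \<A>] i by simp
  show "tangent_map \<A> \<B> f x (tangent_map \<B> \<A> ?i (f x) w) = w"
    using diff_at_compose(2)[OF B A d(2), of \<B> f w] d(1) tangent_map_id(1)[OF B y, of w]
      tangent_map_cong(1)[OF B y open_points[OF B] y, of "f \<circ> ?i" "\<lambda>x. x" \<B>] i[OF x] i' by simp
qed

lemma Ck_on_const: "Ck_on k S (\<lambda>_. c)"
  by (induction k arbitrary: c) (simp_all add: frechet_derivative_const)

lemma Ck_on_ident: "Ck_on k S (\<lambda>x. x)"
  by (cases k) (simp_all add: frechet_derivative_ident Ck_on_const continuous_on_id)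

lemma smooth_atlas_half_line: "smooth_atlas half_line"
proof -
  have inv: "chart_inv ({0<..}, \<lambda>r. r) y = y" if "0 < y" for y :: real
    unfolding chart_inv_def using that by (intro inv_into_f_eq) auto
  have "Ck_on k {0<..} ((\<lambda>r. r) \<circ> chart_inv ({0<..}, \<lambda>r::real. r)) \<longleftrightarrow> Ck_on k {0<..} (\<lambda>r::real. r)" for k
    by (rule Ck_on_cong_open) (simp_all add: inv)
  then have "Ck_on k {0<..} ((\<lambda>r. r) \<circ> chart_inv ({0<..}, \<lambda>r::real. r))" for k
    by (simp only: Ck_on_ident)
  moreover have "continuous_on {0<..} (chart_inv ({0<..}, \<lambda>r::real. r))"
    by (rule continuous_on_eq[OF continuous_on_id]) (simp add: inv)
  ultimately show ?thesis
    by (auto simp: smooth_atlas_def half_line_def smooth_on_def inv intro!: homeomorphismI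
        continuous_intros)
qed

lemma points_half_line: "points half_line = {0<..}"
  by (simp add: points_def half_line_def)

section \<open>Radial connections and their curvature\<close>

lemma points_cone: "points (cone \<M>) = {0<..} \<times> points \<M>"
  by (simp add: points_prod_atlas points_half_line)

lemma smooth_atlas_cone:
  fixes \<M> :: "('a::{t2_space,second_countable_topology}, 'e::real_normed_vector) atlas"
  shows "smooth_atlas \<M> \<Longrightarrow> smooth_atlas (cone \<M>)"
  by (rule smooth_atlas_prod[OF smooth_atlas_half_line])

text \<open>A dilation-invariant connection in temporal gauge over the cone, where \<open>\<Phi>\<close> compares the slices of different
  radius and \<open>j\<close> is its restriction to the slice of radius 1.\<close>

locale radial_connection =
  fixes \<M> :: "('a::{t2_space,second_countable_topology}, 'e::euclidean_space) atlas"
    and G :: "('h::{t2_space,second_countable_topology}, 'g::real_normed_vector) lie_struct"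
    and P :: "('p::{t2_space,second_countable_topology}, 'q::euclidean_space, real \<times> 'a, 'h)
        bundle_struct"
    and Q :: "('s::{t2_space,second_countable_topology}, 't::euclidean_space, 'a, 'h) bundle_struct"
    and j :: "'s \<Rightarrow> 'p"
    and \<Phi> :: "real \<times> 's \<Rightarrow> 'p"
    and A :: "'p \<Rightarrow> 'q \<Rightarrow> 'g"
  assumes M: "smooth_atlas \<M>"
    and P: "principal_bundle G (cone \<M>) P"
    and Q: "pullback_bundle G \<M> (slice 1) P Q j"
    and \<Phi>: "radial_identification G P Q \<Phi>" and \<Phi>_1: "\<And>z. z \<in> points (tot Q) \<Longrightarrow> \<Phi> (1, z) = j z"
    and A: "connection G P A"
    and temporal: "temporal_gauge P Q \<Phi> A"
    and invariant: "dilation_invariant P Q \<Phi> A"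
begin

abbreviation "N \<equiv> tot Q"
abbreviation "T \<equiv> tot P"
abbreviation "B \<equiv> pullback1 N T j A"

text \<open>The map \<open>\<Psi> : P \<rightarrow> Q\<close> forgets the radius in the identification of \<open>P\<close> with \<open>\<real>\<^sup>+ \<times> Q\<close>. It is a left inverse of \<open>j\<close>.\<close>

definition \<Theta> where "\<Theta> = inv_into (points (cone N)) \<Phi>"
definition \<Psi> where "\<Psi> = snd \<circ> \<Theta>"

lemma smooth_atlases: "smooth_atlas T" "smooth_atlas N" "smooth_atlas (cone \<M>)" "smooth_atlas (cone N)"
proof -
  show "smooth_atlas T" using P unfolding principal_bundle_def by blast
  show N: "smooth_atlas N" using Q unfolding pullback_bundle_def principal_bundle_def by blast
  show "smooth_atlas (cone \<M>)" "smooth_atlas (cone N)" using M N by (simp_all add: smooth_atlas_cone)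
qed

lemma smooth_maps: "smooth_map T (cone \<M>) (proj P)" "smooth_map N \<M> (proj Q)" "smooth_map N T j"
  using P Q unfolding pullback_bundle_def principal_bundle_def by blast+

lemma diffeo_\<Phi>: "diffeo (cone N) T \<Phi>"
  using \<Phi> by (simp add: radial_identification_def)

lemma bij_\<Phi>: "bij_betw \<Phi> (points (cone N)) (points T)"
  using diffeo_\<Phi> by (simp add: diffeo_def)

lemma point_cases:
  assumes "q \<in> points T"
  obtains r z where "r > 0" "z \<in> points N" "q = \<Phi> (r, z)"
proof -
  have "q \<in> \<Phi> ` points (cone N)" using assms bij_\<Phi> by (simp add: bij_betw_def)
  then obtain y where "y \<in> points (cone N)" "q = \<Phi> y" by auto
  then show ?thesis by (intro that[of "fst y" "snd y"]) (auto simp: points_cone)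
qed

lemma \<Phi>_point: "r > 0 \<Longrightarrow> z \<in> points N \<Longrightarrow> \<Phi> (r, z) \<in> points T"
  using bij_betwE[OF bij_\<Phi>] by (simp add: points_cone)

lemma \<Theta>_\<Phi>: "r > 0 \<Longrightarrow> z \<in> points N \<Longrightarrow> \<Theta> (\<Phi> (r, z)) = (r, z)"
  using bij_\<Phi> by (simp add: \<Theta>_def bij_betw_def points_cone)

lemma \<Psi>_\<Phi>: "r > 0 \<Longrightarrow> z \<in> points N \<Longrightarrow> \<Psi> (\<Phi> (r, z)) = z"
  by (simp add: \<Psi>_def \<Theta>_\<Phi>)

lemma \<Psi>_point: "q \<in> points T \<Longrightarrow> \<Psi> q \<in> points N"
  by (erule point_cases) (simp add: \<Psi>_\<Phi>)

lemma \<Theta>_point: "q \<in> points T \<Longrightarrow> \<Theta> q \<in> points (cone N)"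
  by (erule point_cases) (simp add: \<Theta>_\<Phi> points_cone)

lemma j_point: "z \<in> points N \<Longrightarrow> j z \<in> points T"
  using \<Phi>_point[of 1 z] by (simp add: \<Phi>_1)

lemma \<Psi>_j: "z \<in> points N \<Longrightarrow> \<Psi> (j z) = z"
  using \<Psi>_\<Phi>[of 1 z] by (simp add: \<Phi>_1)

lemma smooth_\<Theta>: "smooth_map T (cone N) \<Theta>"
  using diffeo_\<Phi> by (simp add: diffeo_def \<Theta>_def)

lemma smooth_snd: "smooth_map (cone N) N snd"
  by (rule smooth_map_snd[OF smooth_atlas_half_line smooth_atlases(2)])

lemma \<Psi>_apply: "\<Psi> q = snd (\<Theta> q)"
  by (simp add: \<Psi>_def)

lemma diff_\<Psi>:
  assumes q: "q \<in> points T"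
  shows "diff_at T N \<Psi> q"
    "tangent_map T N \<Psi> q X = tangent_map (cone N) N snd (\<Theta> q) (tangent_map T (cone N) \<Theta> q X)"
  unfolding \<Psi>_def
  by (intro diff_at_compose[OF smooth_atlases(1,4)] smooth_map_diff_at[OF smooth_atlases(1) smooth_\<Theta> q]
      smooth_map_diff_at[OF smooth_atlases(4) smooth_snd \<Theta>_point[OF q]])+

lemma diff_at_insert_N:
  assumes "r > 0" "z \<in> points N"
  shows "diff_at half_line (cone N) (\<lambda>s. (s, z)) r" "diff_at N (cone N) (\<lambda>y. (r, y)) z"
      "diff_at (cone N) T \<Phi> (r, z)"
proof -
  show "diff_at half_line (cone N) (\<lambda>s. (s, z)) r" "diff_at N (cone N) (\<lambda>y. (r, y)) z"
    using assms by (auto intro!: diff_at_insert smooth_atlas_half_line smooth_atlases simp: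
        points_half_line)
  show "diff_at (cone N) T \<Phi> (r, z)"
    using assms diffeo_\<Phi> by (intro smooth_map_diff_at smooth_atlases)
        (simp_all add: diffeo_def points_cone)
qed

lemma diff_ray:
  assumes "r > 0" "z \<in> points N"
  shows "diff_at half_line T (\<lambda>s. \<Phi> (s, z)) r"
    "tangent_map half_line T (\<lambda>s. \<Phi> (s, z)) r a =
      tangent_map (cone N) T \<Phi> (r, z) (tangent_map half_line (cone N) (\<lambda>s. (s, z)) r a)"
  using diff_at_compose[OF smooth_atlas_half_line smooth_atlases(4), of
      "\<lambda>s. (s, z)" r T \<Phi>] diff_at_insert_N[OF assms]
  by (simp_all add: comp_def)

lemma diff_slice:
  assumes "r > 0" "z \<in> points N"
  shows "diff_at N T (\<lambda>y. \<Phi> (r, y)) z"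
    "tangent_map N T (\<lambda>y. \<Phi> (r, y)) z w =
      tangent_map (cone N) T \<Phi> (r, z) (tangent_map N (cone N) (\<lambda>y. (r, y)) z w)"
  using diff_at_compose[OF smooth_atlases(2,4), of "\<lambda>y. (r, y)" z T \<Phi>] diff_at_insert_N[OF assms]
  by (simp_all add: comp_def)

lemma linear_A: "q \<in> points T \<Longrightarrow> linear (A q)"
  using A by (simp add: connection_def smooth_form1_def)

lemma linear_B: "z \<in> points N \<Longrightarrow> linear (B z)"
  using linear_compose[OF linear_tangent_map[OF smooth_map_diff_at[OF smooth_atlases(2)
      smooth_maps(3)]] linear_A[OF j_point]]
  by (simp add: pullback1_def[abs_def] comp_def)

lemma diff_B: "z \<in> points N \<Longrightarrow> diff_form1_at N B z"
  using A by (intro diff_form1_at_pullback[OF smooth_atlases(2,1) smooth_maps(3)] linear_A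
      smooth_form1_diff_at)
    (simp_all add: connection_def)

text \<open>Dilation invariance makes the restriction of \<open>A\<close> to the slices independent of the radius, and at radius 1
  it is the pullback along \<open>j\<close>.\<close>

lemma gauge_B_constant:
  assumes "r > 0" "z \<in> points N"
  shows "gauge_B P Q \<Phi> A r z w = B z w"
proof -
  have "\<exists>c. \<forall>s\<in>{0<..}. gauge_B P Q \<Phi> A s z w = c"
  proof (rule has_derivative_zero_constant)
    show "convex {0::real<..}" by simp
    fix s :: real assume "s \<in> {0<..}"
    then have "((\<lambda>s. gauge_B P Q \<Phi> A s z w) has_vector_derivative 0) (at s)"
      using invariant assms(2) by (simp add: dilation_invariant_def)
    then show "((\<lambda>s. gauge_B P Q \<Phi> A s z w) has_derivative (\<lambda>h. 0)) (at s within {0<..})"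
      by (auto simp: has_vector_derivative_def intro: has_derivative_at_withinI)
  qed
  then have "gauge_B P Q \<Phi> A r z w = gauge_B P Q \<Phi> A 1 z w" using assms(1) by auto
  also have "\<dots> = B z w"
    using tangent_map_cong(1)[OF smooth_atlases(2) assms(2) open_points[OF smooth_atlases(2)]
        assms(2), of "\<lambda>y. \<Phi> (1, y)" j T]
    by (simp add: gauge_B_def pullback1_def \<Phi>_1 assms(2))
  finally show ?thesis .
qed

text \<open>A tangent vector of \<open>P\<close> is the sum of a radial one, on which \<open>A\<close> vanishes by the temporal gauge, and one that
  is tangent to a slice, where \<open>A\<close> is \<open>B\<close>. So \<open>A\<close> is the pullback of \<open>B\<close> along \<open>\<Psi>\<close>.\<close>

lemma connection_eq:
  assumes q: "q \<in> points T"
  shows "A q X = B (\<Psi> q) (tangent_map T N \<Psi> q X)"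
proof -
  obtain r z where r: "r > 0" and z: "z \<in> points N" and qz: "q = \<Phi> (r, z)" by (rule point_cases[OF q])
  have rp: "r \<in> points half_line" "(r, z) \<in> points (cone N)" using r z by
      (simp_all add: points_half_line points_cone)
  define W where "W = tangent_map T (cone N) \<Theta> q X"
  define a where "a = tangent_map (cone N) half_line fst (r, z) W"
  define w where "w = tangent_map (cone N) N snd (r, z) W"
  have w: "tangent_map T N \<Psi> q X = w"
    using diff_\<Psi>(2)[OF q, of X] by (simp add: w_def W_def qz \<Theta>_\<Phi>[OF r z])
  have "X = tangent_map (cone N) T \<Phi> (r, z) W"
    using diffeo_tangent(2)[OF smooth_atlases(4,1) diffeo_\<Phi> rp(2), of X] by (simp add: W_def \<Theta>_def qz)
  also have "W = tangent_map half_line (cone N) (\<lambda>s. (s, z)) r a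
      + tangent_map N (cone N) (\<lambda>y. (r, y)) z w"
    using tangent_map_decompose[OF smooth_atlas_half_line smooth_atlases(2) rp(1) z, of W] by
        (simp add: a_def w_def)
  finally have X: "X = tangent_map half_line T (\<lambda>s. \<Phi> (s, z)) r a + tangent_map N T (\<lambda>y. \<Phi> (r, y)) z w"
    by (simp add: linear_add[OF linear_tangent_map[OF diff_at_insert_N(3)[OF r z]]] diff_ray(2)[OF r
        z] diff_slice(2)[OF r z])
  have "tangent_map half_line T (\<lambda>s. \<Phi> (s, z)) r a = a *\<^sub>R tangent_map half_line T (\<lambda>s. \<Phi> (s, z)) r 1"
    using linear_cmul[OF linear_tangent_map[OF diff_ray(1)[OF r z]], of a 1] by simp
  moreover have "A q (tangent_map half_line T (\<lambda>s. \<Phi> (s, z)) r 1) = 0"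
    using temporal r z by (simp add: temporal_gauge_def gauge_h_def qz)
  moreover have "A q (tangent_map N T (\<lambda>y. \<Phi> (r, y)) z w) = B z w"
    using gauge_B_constant[OF r z, of w] by (simp add: gauge_B_def pullback1_def qz)
  ultimately have "A q X = B z w"
    by (simp add: X linear_add[OF linear_A[OF q]] linear_cmul[OF linear_A[OF q]])
  then show ?thesis by (simp add: w) (simp add: qz \<Psi>_\<Phi>[OF r z])
qed

text \<open>The pullback along \<open>\<Psi>\<close> is taken in two steps, first along the projection of \<open>\<real>\<^sup>+ \<times> Q\<close> to \<open>Q\<close> and then along \<open>\<Theta>\<close>, so
  that each step uses a map that is known to be smooth.\<close>

lemma curvature_eq:
  assumes q: "q \<in> points T"
  shows "curvature G P A q X Y =
    curvature G Q B (\<Psi> q) (tangent_map T N \<Psi> q X) (tangent_map T N \<Psi> q Y)"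
proof -
  let ?B = "pullback1 (cone N) N snd B"
  have lin: "linear (?B y)" if "y \<in> points (cone N)" for y
    using linear_compose[OF linear_tangent_map[OF smooth_map_diff_at[OF smooth_atlases(4) smooth_snd
        that]] linear_B[of "snd y"]] that
    by (simp add: pullback1_def[abs_def] comp_def points_cone mem_Times_iff)
  have diff: "diff_form1_at (cone N) ?B y" if "y \<in> points (cone N)" for y
    using that by (intro diff_form1_at_pullback[OF smooth_atlases(4,2) smooth_snd] linear_B diff_B)
        (auto simp: points_cone)
  have "ext_deriv1 T A q X Y = ext_deriv1 T (pullback1 T (cone N) \<Theta> ?B) q X Y"
    using connection_eq by (intro ext_deriv1_cong[OF smooth_atlases(1) q])
      (simp add: pullback1_def[of T] pullback1_def[of "cone N"] diff_\<Psi>(2) \<Psi>_apply)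
  also have "\<dots> = ext_deriv1 (cone N) ?B (\<Theta> q) (tangent_map T (cone N) \<Theta> q X) (tangent_map T
      (cone N) \<Theta> q Y)"
    by (rule ext_deriv1_pullback[OF smooth_atlases(1,4) smooth_\<Theta> q lin diff[OF \<Theta>_point[OF q]]])
  also have "\<dots> = ext_deriv1 N B (\<Psi> q) (tangent_map T N \<Psi> q X) (tangent_map T N \<Psi> q Y)"
    using \<Theta>_point[OF q] diff_B[OF \<Psi>_point[OF q]]
    by (simp add: ext_deriv1_pullback[OF smooth_atlases(4,2) smooth_snd _ linear_B] diff_\<Psi>(2)[OF q]
        \<Psi>_apply)
  finally show ?thesis by (simp add: curvature_def connection_eq[OF q])
qed

lemma tangent_\<Psi>_j:
  assumes z: "z \<in> points N"
  shows "tangent_map T N \<Psi> (j z) (tangent_map N T j z X) = X"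
proof -
  have "tangent_map T N \<Psi> (j z) (tangent_map N T j z X) = tangent_map N N (\<Psi> \<circ> j) z X"
    using diff_at_compose(2)[OF smooth_atlases(2,1) smooth_map_diff_at[OF smooth_atlases(2)
        smooth_maps(3) z]
        diff_\<Psi>(1)[OF j_point[OF z]]] by simp
  also have "\<dots> = tangent_map N N (\<lambda>z. z) z X"
    using tangent_map_cong(1)[OF smooth_atlases(2) z open_points[OF smooth_atlases(2)] z, of "\<Psi> \<circ> j"
        "\<lambda>z. z" N]
    by (simp add: \<Psi>_j)
  also have "\<dots> = X" by (rule tangent_map_id(1)[OF smooth_atlases(2) z])
  finally show ?thesis .
qed

lemma proj_\<Phi>: "r > 0 \<Longrightarrow> z \<in> points N \<Longrightarrow> proj P (\<Phi> (r, z)) = (r, proj Q z)"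
  using \<Phi> by (simp add: radial_identification_def)

lemma proj_point: "z \<in> points N \<Longrightarrow> proj Q z \<in> points \<M>" "q \<in> points T \<Longrightarrow> proj P q \<in> points (cone \<M>)"
  using smooth_maps by (auto simp: smooth_map_def)

lemma proj_\<Psi>: "q \<in> points T \<Longrightarrow> snd (proj P q) = proj Q (\<Psi> q)"
  by (erule point_cases) (simp add: proj_\<Phi> \<Psi>_\<Phi>)

text \<open>The map \<open>\<Psi>\<close> covers the projection of the cone to its link.\<close>

lemma tangent_proj_\<Psi>:
  assumes q: "q \<in> points T"
  shows "tangent_map (cone \<M>) \<M> snd (proj P q) (tangent_map T (cone \<M>) (proj P) q X) =
    tangent_map N \<M> (proj Q) (\<Psi> q) (tangent_map T N \<Psi> q X)"
proof -
  have snd: "diff_at (cone \<M>) \<M> snd (proj P q)"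
    by (rule diff_at_snd[OF smooth_atlas_half_line M proj_point(2)[OF q]])
  have "tangent_map (cone \<M>) \<M> snd (proj P q) (tangent_map T (cone \<M>) (proj P) q X)
      = tangent_map T \<M> (snd \<circ> proj P) q X"
    using diff_at_compose(2)[OF smooth_atlases(1,3) smooth_map_diff_at[OF smooth_atlases(1)
        smooth_maps(1) q] snd] by simp
  also have "\<dots> = tangent_map T \<M> (proj Q \<circ> \<Psi>) q X"
    using tangent_map_cong(1)[OF smooth_atlases(1) q open_points[OF smooth_atlases(1)] q, of
        "snd \<circ> proj P" "proj Q \<circ> \<Psi>" \<M>]
    by (simp add: proj_\<Psi>)
  also have "\<dots> = tangent_map N \<M> (proj Q) (\<Psi> q) (tangent_map T N \<Psi> q X)"
    by (rule diff_at_compose(2)[OF smooth_atlases(1,2) diff_\<Psi>(1)[OF q]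
          smooth_map_diff_at[OF smooth_atlases(2) smooth_maps(2) \<Psi>_point[OF q]]])
  finally show ?thesis .
qed

lemma proj_j: "z \<in> points N \<Longrightarrow> proj P (j z) = slice 1 (proj Q z)"
  using proj_\<Phi>[of 1 z] by (simp add: \<Phi>_1 slice_def)

lemma tangent_proj_j:
  assumes z: "z \<in> points N"
  shows "tangent_map T (cone \<M>) (proj P) (j z) (tangent_map N T j z X) =
    tangent_map \<M> (cone \<M>) (slice 1) (proj Q z) (tangent_map N \<M> (proj Q) z X)"
proof -
  have slice: "diff_at \<M> (cone \<M>) (slice 1) (proj Q z)"
    unfolding slice_def[abs_def]
    by (rule diff_at_insert(2)[OF smooth_atlas_half_line M _ proj_point(1)[OF z]])
        (simp add: points_half_line)
  have "tangent_map T (cone \<M>) (proj P) (j z) (tangent_map N T j z X)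
      = tangent_map N (cone \<M>) (proj P \<circ> j) z X"
    using diff_at_compose(2)[OF smooth_atlases(2,1) smooth_map_diff_at[OF smooth_atlases(2)
        smooth_maps(3) z]
        smooth_map_diff_at[OF smooth_atlases(1) smooth_maps(1) j_point[OF z]]] by simp
  also have "\<dots> = tangent_map N (cone \<M>) (slice 1 \<circ> proj Q) z X"
    using tangent_map_cong(1)[OF smooth_atlases(2) z open_points[OF smooth_atlases(2)] z, of
        "proj P \<circ> j" "slice 1 \<circ> proj Q" "cone \<M>"]
    by (simp add: proj_j)
  also have "\<dots> = tangent_map \<M> (cone \<M>) (slice 1) (proj Q z) (tangent_map N \<M> (proj Q) z X)"
    by (rule diff_at_compose(2)[OF smooth_atlases(2) M smooth_map_diff_at[OF smooth_atlases(2)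
        smooth_maps(2) z] slice])
  finally show ?thesis .
qed

text \<open>The velocity of \<open>s \<mapsto> \<Phi> (s, z)\<close> at \<open>s = 1\<close> lifts the Euler field, and \<open>\<Psi>\<close> is constant along this curve.\<close>

lemma radial_vector:
  assumes z: "z \<in> points N"
  obtains X where "tangent_map T N \<Psi> (j z) X = 0"
    "tangent_map T (cone \<M>) (proj P) (j z) X = euler_field \<M> (slice 1 (proj Q z))"
proof -
  have one: "(1::real) \<in> points half_line" "(1::real) > 0" "open {0::real<..}" "(1::real) \<in> {0<..}"
    by (simp_all add: points_half_line)
  note ray = diff_ray(1)[OF one(2) z]
  have jz: "\<Phi> (1, z) = j z" by (rule \<Phi>_1[OF z])
  let ?X = "tangent_map half_line T (\<lambda>s. \<Phi> (s, z)) 1 1"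
  have "tangent_map T N \<Psi> (j z) ?X = tangent_map half_line N (\<Psi> \<circ> (\<lambda>s. \<Phi> (s, z))) 1 1"
    using diff_at_compose(2)[OF smooth_atlas_half_line smooth_atlases(1) ray, of N \<Psi> 1] diff_\<Psi>(1)[OF
        j_point[OF z]] by (simp add: jz)
  also have "\<dots> = tangent_map half_line N (\<lambda>s. z) 1 1"
    using tangent_map_cong(1)[OF smooth_atlas_half_line one(1,3,4), of "\<Psi> \<circ> (\<lambda>s. \<Phi> (s, z))" "\<lambda>s. z" N] z
    by (simp add: \<Psi>_\<Phi>)
  also have "\<dots> = 0" by (rule tangent_map_const(1)[OF smooth_atlas_half_line one(1) z])
  finally have 1: "tangent_map T N \<Psi> (j z) ?X = 0" .
  have "tangent_map T (cone \<M>) (proj P) (j z) ?X = tangent_map half_line (cone \<M>) (proj P \<circ>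
      (\<lambda>s. \<Phi> (s, z))) 1 1"
    using diff_at_compose(2)[OF smooth_atlas_half_line smooth_atlases(1) ray, of "cone \<M>" "proj P" 1]
      smooth_map_diff_at[OF smooth_atlases(1) smooth_maps(1) j_point[OF z]] by (simp add: jz)
  also have "\<dots> = tangent_map half_line (cone \<M>) (\<lambda>s. (s, proj Q z)) 1 1"
    using tangent_map_cong(1)[OF smooth_atlas_half_line one(1,3,4), of "proj P \<circ> (\<lambda>s. \<Phi> (s, z))"
        "\<lambda>s. (s, proj Q z)" "cone \<M>"] z
    by (simp add: proj_\<Phi>)
  also have "\<dots> = euler_field \<M> (slice 1 (proj Q z))" by (simp add: euler_field_def slice_def)
  finally show ?thesis using 1 by (rule that[rotated])
qed

lemma represents_pullback:
  assumes q: "q \<in> points T" and \<beta>: "represents_at \<M> Q (curvature G Q B) (\<Psi> q) \<beta>"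
  shows "represents_at (cone \<M>) P (curvature G P A) q
    (\<lambda>u v. \<beta> (tangent_map (cone \<M>) \<M> snd (proj P q) u) (tangent_map (cone \<M>) \<M> snd (proj P q) v))"
  using \<beta> unfolding represents_at_def by (simp add: curvature_eq[OF q] tangent_proj_\<Psi>[OF q])

lemma represents_restrict:
  assumes z: "z \<in> points N" and \<beta>: "represents_at (cone \<M>) P (curvature G P A) (j z) \<beta>"
  shows "represents_at \<M> Q (curvature G Q B) z
    (\<lambda>u v. \<beta> (tangent_map \<M> (cone \<M>) (slice 1) (proj Q z) u) (tangent_map \<M> (cone \<M>) (slice 1)
        (proj Q z) v))"
  unfolding represents_at_def
proof (intro allI)
  fix X Y
  have "curvature G Q B z X Y = curvature G P A (j z) (tangent_map N T j z X) (tangent_map N T j z Y)"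
    by (simp add: curvature_eq[OF j_point[OF z]] tangent_\<Psi>_j[OF z] \<Psi>_j[OF z])
  then show "curvature G Q B z X Y = \<beta> (tangent_map \<M> (cone \<M>) (slice 1) (proj Q z) (tangent_map N \<M>
      (proj Q) z X))
      (tangent_map \<M> (cone \<M>) (slice 1) (proj Q z) (tangent_map N \<M> (proj Q) z Y))"
    using \<beta> by (simp add: represents_at_def tangent_proj_j[OF z])
qed

text \<open>The curvature is a pullback along \<open>\<Psi>\<close>, and \<open>\<Psi>\<close> collapses a lift of the Euler field. Every second argument
  \<open>v\<close> has a lift, too, because the bundle projection is a submersion.\<close>

lemma curvature_radial:
  assumes z: "z \<in> points N" and \<beta>: "represents_at (cone \<M>) P (curvature G P A) (j z) \<beta>" "bilinear \<beta>"
  shows "\<beta> (euler_field \<M> (slice 1 (proj Q z))) v = 0"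
proof -
  obtain X where X: "tangent_map T N \<Psi> (j z) X = 0"
    "tangent_map T (cone \<M>) (proj P) (j z) X = euler_field \<M> (slice 1 (proj Q z))" by
        (rule radial_vector[OF z])
  obtain Y where Y: "tangent_map T (cone \<M>) (proj P) (j z) Y
      = v" by (rule tangent_proj_surj[OF P j_point[OF z]])
  have "\<beta> (euler_field \<M> (slice 1 (proj Q z))) v = curvature G P A (j z) X Y"
    using \<beta>(1) by (simp add: represents_at_def X Y)
  also have "\<dots> = curvature G Q B z 0 (tangent_map T N \<Psi> (j z) Y)"
    by (simp add: curvature_eq[OF j_point[OF z]] X \<Psi>_j[OF z])
  also have "\<dots> = 0"
  proof -
    have "linear (tangent_map N \<M> (proj Q) z)"
      by (rule linear_tangent_map[OF smooth_map_diff_at[OF smooth_atlases(2) smooth_maps(2) z]])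
    moreover have "linear (tangent_map \<M> (cone \<M>) (slice 1) (proj Q z))"
      unfolding slice_def[abs_def]
      by (rule linear_tangent_map[OF diff_at_insert(2)[OF smooth_atlas_half_line M _
          proj_point(1)[OF z]]])
        (simp add: points_half_line)
    ultimately show ?thesis
      using represents_restrict[OF z \<beta>(1)]
      by (simp add: represents_at_def linear_0 bilinear_lzero[OF \<beta>(2)])
  qed
  finally show ?thesis .
qed

end

section \<open>Tri-contact forms on the link of a hyperkaehler cone\<close>

context
  fixes \<M> :: "('a::{t2_space,second_countable_topology}, 'e::euclidean_space) atlas"
    and g :: "'a \<Rightarrow> 'e \<Rightarrow> 'e \<Rightarrow> real" and I J K :: "real \<times> 'a \<Rightarrow> real \<times> 'e \<Rightarrow> real \<times> 'e"
  assumes M: "smooth_atlas \<M>" and hk: "hyperkaehler_cone \<M> g I J K"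
begin

lemma complex_structures:
  assumes "p \<in> points (cone \<M>)" "L \<in> {I, J, K}"
  shows "linear (L p)" "L p (L p u) = - u" "cone_metric \<M> g p (L p u) (L p v) = cone_metric \<M> g p u v"
proof -
  have "kaehler (cone \<M>) (cone_metric \<M> g) L"
    using hk assms(2) by (auto simp: hyperkaehler_cone_def hyperkaehler_def)
  then show "linear (L p)" "L p (L p u) = - u" "cone_metric \<M> g p (L p u) (L p v)
      = cone_metric \<M> g p u v"
    using assms(1) unfolding kaehler_def smooth_endo_def by blast+
qed

lemma cone_metric_props:
  assumes "p \<in> points (cone \<M>)"
  shows "bilinear (cone_metric \<M> g p)" "cone_metric \<M> g p u v = cone_metric \<M> g p v u"
    "u \<noteq> 0 \<Longrightarrow> cone_metric \<M> g p u u > 0"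
proof -
  have "riemannian_metric (cone \<M>) (cone_metric \<M> g)"
    using hk by (auto simp: hyperkaehler_cone_def hyperkaehler_def kaehler_def)
  then show "bilinear (cone_metric \<M> g p)" "cone_metric \<M> g p u v = cone_metric \<M> g p v u"
    "u \<noteq> 0 \<Longrightarrow> cone_metric \<M> g p u u > 0"
    using assms unfolding riemannian_metric_def by blast+
qed

lemma quaternionic_at:
  assumes "p \<in> points (cone \<M>)"
  shows "quaternionic (I p) (J p) (K p)"
proof
  fix L u assume "L \<in> {I p, J p, K p}"
  then obtain L' where "L' \<in> {I, J, K}" "L = L' p" by blast
  then show "linear L \<and> L (L u) = - u" using complex_structures(1,2)[OF assms] by blast
next
  show "I p (J p u) = K p u" for u
    using hk assms unfolding hyperkaehler_cone_def hyperkaehler_def by blast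
qed

lemma quaternionic_cone_at:
  assumes x: "x \<in> points \<M>"
  shows "quaternionic_cone (I (slice 1 x)) (J (slice 1 x)) (K (slice 1 x))
    (tangent_map (cone \<M>) half_line fst (slice 1 x)) (tangent_map (cone \<M>) \<M> snd (slice 1 x))
    (tangent_map \<M> (cone \<M>) (slice 1) x) (euler_field \<M> (slice 1 x)) (g x) (cone_metric \<M> g (slice 1 x))"
proof -
  have one: "(1::real) \<in> points half_line" by (simp add: points_half_line)
  have p: "slice 1 x \<in> points (cone \<M>)" using x by (simp add: slice_def points_cone)
  have slice: "slice 1 = (\<lambda>y::'a. (1::real, y))" by (simp add: slice_def fun_eq_iff)
  note insert = tangent_map_insert[OF smooth_atlas_half_line M one x]
    and diff = diff_at_insert[OF smooth_atlas_half_line M one x]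
  show ?thesis
  proof (rule quaternionic_cone.intro[OF quaternionic_at[OF p]], rule quaternionic_cone_axioms.intro)
    show "linear (tangent_map \<M> (cone \<M>) (slice 1) x)" unfolding slice by
        (rule linear_tangent_map[OF diff(2)])
    show "linear (tangent_map (cone \<M>) \<M> snd (slice 1 x))"
      by (rule linear_tangent_map[OF diff_at_snd[OF smooth_atlas_half_line M p]])
    fix u v :: "real \<times> 'e" and w :: 'e
    show "tangent_map (cone \<M>) \<M> snd (slice 1 x) (tangent_map \<M> (cone \<M>) (slice 1) x w) = w"
      "tangent_map (cone \<M>) half_line fst (slice 1 x) (tangent_map \<M> (cone \<M>) (slice 1) x w) = 0"
      "tangent_map (cone \<M>) half_line fst (slice 1 x) (euler_field \<M> (slice 1 x)) = 1"
      "tangent_map (cone \<M>) \<M> snd (slice 1 x) (euler_field \<M> (slice 1 x)) = 0"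
      by (simp_all add: slice euler_field_def insert)
    have "tangent_map half_line (cone \<M>) (\<lambda>r. (r, x)) 1 a = a *\<^sub>R euler_field \<M> (slice 1 x)" for a
      using linear_cmul[OF linear_tangent_map[OF diff(1)], of a 1] by (simp add: euler_field_def slice)
    then show "u = tangent_map (cone \<M>) half_line fst (slice 1 x) u *\<^sub>R euler_field \<M> (slice 1 x) +
        tangent_map \<M> (cone \<M>) (slice 1) x (tangent_map (cone \<M>) \<M> snd (slice 1 x) u)"
      using tangent_map_decompose[OF smooth_atlas_half_line M one x, of u] by (simp add: slice)
    show "cone_metric \<M> g (slice 1 x) u v =
        tangent_map (cone \<M>) half_line fst (slice 1 x) u * tangent_map (cone \<M>) half_line fst
            (slice 1 x) v +
        g x (tangent_map (cone \<M>) \<M> snd (slice 1 x) u) (tangent_map (cone \<M>) \<M> snd (slice 1 x) v)"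
      by (simp add: cone_metric_def slice)
    show "bilinear (cone_metric \<M> g (slice 1 x))" by (rule cone_metric_props(1)[OF p])
    show "cone_metric \<M> g (slice 1 x) u v = cone_metric \<M> g (slice 1 x) v u" by
        (rule cone_metric_props(2)[OF p])
    show "u \<noteq> 0 \<Longrightarrow> cone_metric \<M> g (slice 1 x) u u > 0" by (rule cone_metric_props(3)[OF p])
    show "cone_metric \<M> g (slice 1 x) (L u) (L v) = cone_metric \<M> g (slice 1 x) u v"
      if "L \<in> {I (slice 1 x), J (slice 1 x), K (slice 1 x)}" for L
      using that complex_structures(3)[OF p] by blast
  qed
qed

lemma tri_contact_forms_iff:
  assumes x: "x \<in> points \<M>"
  shows "\<beta> \<in> tri_contact_forms \<M> g I J K x \<longleftrightarrow>
    quaternionic_cone.tri_contact (I (slice 1 x)) (J (slice 1 x)) (K (slice 1 x))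
      (tangent_map (cone \<M>) \<M> snd (slice 1 x)) (tangent_map \<M> (cone \<M>) (slice 1) x)
      (euler_field \<M> (slice 1 x)) (g x) (cone_metric \<M> g (slice 1 x)) \<beta>"
proof -
  interpret quaternionic_cone "I (slice 1 x)" "J (slice 1 x)" "K (slice 1 x)"
    "tangent_map (cone \<M>) half_line fst (slice 1 x)" "tangent_map (cone \<M>) \<M> snd (slice 1 x)"
    "tangent_map \<M> (cone \<M>) (slice 1) x" "euler_field \<M> (slice 1 x)" "g x" "cone_metric \<M> g (slice 1 x)"
    by (rule quaternionic_cone_at[OF x])
  have "tri_horizontal \<M> g I J K x = H"
    by (simp add: tri_horizontal_def H_def contact_form_def kaehler_form_def)
  then show ?thesis
    by (simp add: tri_contact_forms_def tri_contact_def link_endo_def[abs_def] Let_def)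
qed

lemma diff_dilation:
  assumes r: "r > 0" and p: "p \<in> points (cone \<M>)"
  shows "diff_at (cone \<M>) (cone \<M>) (dilation r) p"
proof -
  have s: "fst p > 0" using p by (auto simp: points_cone)
  let ?c = "({0::real<..}, \<lambda>r::real. r)"
  have "chart_rep ?c ?c (\<lambda>s. r * s) differentiable at (fst p) \<longleftrightarrow> (\<lambda>s. r * s) differentiable at (fst p)"
  proof (rule frechet_derivative_cong_open(2)[of "{0<..}"])
    fix y :: real assume "y \<in> {0<..}"
    then have "chart_inv ?c y = y" unfolding chart_inv_def by (intro inv_into_f_eq) auto
    then show "chart_rep ?c ?c (\<lambda>s. r * s) y = r * y" by simp
  qed (use s in auto)
  moreover have "(\<lambda>s. r * s) differentiable at (fst p)" by (intro derivative_intros)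
  ultimately have "diff_at half_line half_line (\<lambda>s. r * s) (fst p)"
    using r s diff_at_charts[of half_line half_line ?c ?c "fst p" "\<lambda>s. r * s"] smooth_atlas_half_line
    by (simp add: half_line_def)
  then have "diff_at (cone \<M>) half_line ((\<lambda>s. r * s) \<circ> fst) p"
    by (rule diff_at_compose(1)[OF smooth_atlas_cone[OF M] smooth_atlas_half_line diff_at_fst[OF
        smooth_atlas_half_line M p]])
  then have "diff_at (cone \<M>) (cone \<M>) (\<lambda>p. (r * fst p, snd p)) p"
    by (intro diff_at_Pair[OF smooth_atlas_half_line M smooth_atlas_cone[OF M]] diff_at_snd[OF
        smooth_atlas_half_line M p])
      (simp add: comp_def)
  then show ?thesis by (simp add: dilation_def[abs_def] case_prod_unfold)
qed

text \<open>Dilations commute with the projection to the link, and the dilation by \<open>1 / r\<close> inverts the one by \<open>r\<close>.\<close>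

lemma tangent_dilation:
  assumes r: "r > 0" and x: "x \<in> points \<M>"
  shows "tangent_map (cone \<M>) \<M> snd (r, x) (tangent_map (cone \<M>) (cone \<M>) (dilation r) (1, x) X) =
      tangent_map (cone \<M>) \<M> snd (1, x) X"
    "\<exists>X. tangent_map (cone \<M>) (cone \<M>) (dilation r) (1, x) X = Y"
proof -
  note C = smooth_atlas_cone[OF M]
  have p: "(1, x) \<in> points (cone \<M>)" "(r, x) \<in> points (cone \<M>)" using r x by (simp_all add: points_cone)
  have d: "dilation r (1, x) = (r, x)" "dilation (1 / r) (r, x)
      = (1, x)" using r by (simp_all add: dilation_def)
  have r': "1 / r > 0" using r by simp
  have "snd \<circ> dilation r = (snd :: real \<times> 'a \<Rightarrow> 'a)" by (auto simp: dilation_def)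
  then show "tangent_map (cone \<M>) \<M> snd (r, x) (tangent_map (cone \<M>) (cone \<M>) (dilation r) (1, x) X) =
      tangent_map (cone \<M>) \<M> snd (1, x) X"
    using diff_at_compose(2)[OF C C diff_dilation[OF r p(1)], of \<M> snd X] diff_at_snd[OF
        smooth_atlas_half_line M p(2)]
    unfolding d by simp
  have "dilation r \<circ> dilation (1 / r) = (\<lambda>p :: real \<times> 'a. p)" using r by (auto simp: dilation_def)
  then have "tangent_map (cone \<M>) (cone \<M>) (dilation r) (1, x) (tangent_map (cone \<M>) (cone \<M>)
      (dilation (1 / r)) (r, x) Y) = Y"
    using diff_at_compose(2)[OF C C diff_dilation[OF r' p(2)], of "cone \<M>"
        "dilation r" Y] diff_dilation[OF r p(1)]
      tangent_map_id(1)[OF C p(2)] by (simp add: d)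
  then show "\<exists>X. tangent_map (cone \<M>) (cone \<M>) (dilation r) (1, x) X = Y" by blast
qed

text \<open>For radius 1 this is \<open>tri_contact_lift\<close>. The dilation by \<open>r\<close> carries it to radius \<open>r\<close>: it commutes with \<open>L\<close> and
  does not affect the image of a vector in the link.\<close>

lemma tri_contact_lift_invariant:
  assumes r: "r > 0" and x: "x \<in> points \<M>" and \<beta>: "\<beta> \<in> tri_contact_forms \<M> g I J K x"
      and L: "L \<in> {I, J, K}"
  shows "\<beta> (tangent_map (cone \<M>) \<M> snd (r, x) (L (r, x) u)) (tangent_map (cone \<M>) \<M> snd (r, x) (L
      (r, x) v)) =
    \<beta> (tangent_map (cone \<M>) \<M> snd (r, x) u) (tangent_map (cone \<M>) \<M> snd (r, x) v)"
proof -
  interpret quaternionic_cone "I (slice 1 x)" "J (slice 1 x)" "K (slice 1 x)"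
    "tangent_map (cone \<M>) half_line fst (slice 1 x)" "tangent_map (cone \<M>) \<M> snd (slice 1 x)"
    "tangent_map \<M> (cone \<M>) (slice 1) x" "euler_field \<M> (slice 1 x)" "g x" "cone_metric \<M> g (slice 1 x)"
    by (rule quaternionic_cone_at[OF x])
  let ?\<delta> = "tangent_map (cone \<M>) (cone \<M>) (dilation r) (1, x)"
  obtain u' v' where uv: "u = ?\<delta> u'" "v = ?\<delta> v'" using tangent_dilation(2)[OF r x] by metis
  have "dilation_invariant_endo \<M> L" using hk L by (auto simp: hyperkaehler_cone_def)
  moreover have "(1, x) \<in> points (cone \<M>)" "dilation r (1, x)
      = (r, x)" using x by (simp_all add: points_cone dilation_def)
  ultimately have "L (r, x) (?\<delta> X) = ?\<delta> (L (1, x) X)" for X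
    using r unfolding dilation_invariant_endo_def by metis
  moreover have "L (1, x) \<in> {I (slice 1 x), J (slice 1 x), K (slice 1 x)}" using L by
      (auto simp: slice_def)
  ultimately show ?thesis
    using tri_contact_lift[of \<beta> "L (1, x)" u' v'] \<beta>
    by (simp add: uv tangent_dilation(1)[OF r x] tri_contact_forms_iff[OF x] slice_def)
qed

lemma tri_contact_lift_instanton:
  assumes dim: "DIM('e) = 4 * n + 3" and r: "r > 0" and x: "x \<in> points \<M>"
    and \<beta>: "\<beta> \<in> tri_contact_forms \<M> g I J K x" and L: "L \<in> {I, J, K}"
  defines "\<gamma> \<equiv> \<lambda>u v. \<beta> (tangent_map (cone \<M>) \<M> snd (r, x) u) (tangent_map (cone \<M>) \<M> snd (r, x) v)"
  shows "two_form \<gamma>" "type11 UNIV (L (r, x)) \<gamma>"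
    "wedge 2 (2 * (2 * n + 1)) (as_form \<gamma>) (wedge_power (kaehler_form (cone_metric \<M> g) L (r, x))
        (2 * n + 1)) v = 0"
proof -
  have p: "(r, x) \<in> points (cone \<M>)" using r x by (simp add: points_cone)
  have \<beta>2: "two_form \<beta>" using \<beta> by (simp add: tri_contact_forms_def Let_def)
  show \<gamma>: "two_form \<gamma>"
    unfolding \<gamma>_def by (rule two_form_comp_linear[OF \<beta>2 linear_tangent_map[OF diff_at_snd[OF
        smooth_atlas_half_line M p]]])
  then have bil: "bilinear \<gamma>" by (simp add: two_form_def)
  have inv: "\<gamma> (L (r, x) u) (L (r, x) v) = \<gamma> u v" if "L \<in> {I, J, K}" for L u v
    unfolding \<gamma>_def by (rule tri_contact_lift_invariant[OF r x \<beta> that])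
  show "type11 UNIV (L (r, x)) \<gamma>"
    using type11_UNIV_iff[OF complex_structures(1,2)[OF p L] bil] inv[OF L] by simp
  have "wedge 2 (2 * (2 * n + 1)) (as_form \<gamma>) (wedge_power
      (\<lambda>u v. cone_metric \<M> g (r, x) (L (r, x) u) v) (2 * n + 1)) v = 0"
  proof (rule quaternionic_primitive[OF quaternionic_at[OF p]])
    show "L (r, x) \<in> {I (r, x), J (r, x), K (r, x)}" using L by auto
    show "DIM(real \<times> 'e) = 2 + 2 * (2 * n + 1)" using dim by simp
    show "bilinear (cone_metric \<M> g (r, x))" by (rule cone_metric_props(1)[OF p])
    show "cone_metric \<M> g (r, x) (N u) (N v) = cone_metric \<M> g (r, x) u v"
      "\<gamma> (N u) (N v) = \<gamma> u v" if "N \<in> {I (r, x), J (r, x), K (r, x)}" for N u v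
      using that complex_structures(3)[OF p] inv by blast+
  qed (use bil in auto)
  then show "wedge 2 (2 * (2 * n + 1)) (as_form \<gamma>) (wedge_power (kaehler_form (cone_metric \<M> g) L
      (r, x)) (2 * n + 1)) v = 0"
    by (simp add: kaehler_form_def[abs_def])
qed

end

section \<open>Instantons on the cone and on the link\<close>

theorem proposition6p2:
  fixes n :: nat
    and \<M> :: "('a::{t2_space,second_countable_topology}, 'e::euclidean_space) atlas"
    and g :: "'a \<Rightarrow> 'e \<Rightarrow> 'e \<Rightarrow> real"
    and I J K :: "real \<times> 'a \<Rightarrow> real \<times> 'e \<Rightarrow> real \<times> 'e"
    and G :: "('h::{t2_space,second_countable_topology}, 'g::real_normed_vector) lie_struct"
    and P :: "('p::{t2_space,second_countable_topology}, 'q::euclidean_space, real \<times> 'a, 'h) bundle_struct"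
    and Q :: "('s::{t2_space,second_countable_topology}, 't::euclidean_space, 'a, 'h) bundle_struct"
    and j :: "'s \<Rightarrow> 'p"
    and \<Phi> :: "real \<times> 's \<Rightarrow> 'p"
    and A :: "'p \<Rightarrow> 'q \<Rightarrow> 'g"
  assumes "n \<ge> 1" and "DIM('e) = 4 * n + 3"
    and "smooth_atlas \<M>"
    and "hyperkaehler_cone \<M> g I J K"
    and "principal_bundle G (cone \<M>) P"
    and "pullback_bundle G \<M> (slice 1) P Q j"
    and "radial_identification G P Q \<Phi>" and "\<And>z. z \<in> points (tot Q) \<Longrightarrow> \<Phi> (1, z) = j z"
    and "connection G P A"
    and "temporal_gauge P Q \<Phi> A"
    and "dilation_invariant P Q \<Phi> A"
  shows "Sp_instanton n (cone \<M>) (cone_metric \<M> g) I J K G P A \<longleftrightarrow>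
    tri_contact_instanton \<M> g I J K G Q (pullback1 (tot Q) (tot P) j A)"
proof -
  note M = assms(3) and hk = assms(4)
  interpret radial_connection \<M> G P Q j \<Phi> A
    using assms by unfold_locales
  show ?thesis
  proof
    assume inst: "Sp_instanton n (cone \<M>) (cone_metric \<M> g) I J K G P A"
    show "tri_contact_instanton \<M> g I J K G Q B"
      unfolding tri_contact_instanton_def
    proof
      fix z assume z: "z \<in> points N"
      define x where "x = proj Q z"
      have x: "x \<in> points \<M>" using proj_point(1)[OF z] by (simp add: x_def)
      obtain \<beta> where \<beta>: "represents_at (cone \<M>) P (curvature G P A) (j z) \<beta>" "two_form \<beta>"
        and type: "\<And>L. L \<in> {I, J, K} \<Longrightarrow> type11 UNIV (L (slice 1 x)) \<beta>"
        using inst j_point[OF z] unfolding Sp_instanton_def x_def proj_j[OF z, symmetric] by metis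
      interpret quaternionic_cone "I (slice 1 x)" "J (slice 1 x)" "K (slice 1 x)"
        "tangent_map (cone \<M>) half_line fst (slice 1 x)" "tangent_map (cone \<M>) \<M> snd (slice 1 x)"
        "tangent_map \<M> (cone \<M>) (slice 1) x" "euler_field \<M> (slice 1 x)" "g x"
            "cone_metric \<M> g (slice 1 x)"
        by (rule quaternionic_cone_at[OF M hk x])
      have "bilinear \<beta>" using \<beta>(2) by (simp add: two_form_def)
      then have "\<beta> (euler_field \<M> (slice 1 x)) v = 0" for v
        using curvature_radial[OF z \<beta>(1)] by (simp add: x_def)
      then have "tri_contact (\<lambda>u v. \<beta> (tangent_map \<M> (cone \<M>) (slice 1) x u) (tangent_map \<M> (cone \<M>)
          (slice 1) x v))"
        using type by (intro tri_contact_restrict[OF \<beta>(2)]) auto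
      then show "\<exists>\<beta>. represents_at \<M> Q (curvature G Q B) z \<beta>
          \<and> \<beta> \<in> tri_contact_forms \<M> g I J K (proj Q z)"
        using represents_restrict[OF z \<beta>(1)] tri_contact_forms_iff[OF M hk x] unfolding x_def by blast
    qed
  next
    assume inst: "tri_contact_instanton \<M> g I J K G Q B"
    show "Sp_instanton n (cone \<M>) (cone_metric \<M> g) I J K G P A"
      unfolding Sp_instanton_def
    proof
      fix q assume q: "q \<in> points T"
      obtain r z where r: "r > 0" and z: "z \<in> points N"
          and qz: "q = \<Phi> (r, z)" by (rule point_cases[OF q])
      have pq: "proj P q = (r, proj Q z)" and \<Psi>q: "\<Psi> q
          = z" using proj_\<Phi>[OF r z] \<Psi>_\<Phi>[OF r z] by (simp_all add: qz)
      obtain \<beta> where \<beta>: "represents_at \<M> Q (curvature G Q B) z \<beta>"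
          "\<beta> \<in> tri_contact_forms \<M> g I J K (proj Q z)"
        using inst z unfolding tri_contact_instanton_def by blast
      note lift = tri_contact_lift_instanton[OF M hk assms(2) r proj_point(1)[OF z] \<beta>(2)]
      show "\<exists>\<beta>. represents_at (cone \<M>) P (curvature G P A) q \<beta> \<and> two_form \<beta> \<and>
          (\<forall>L\<in>{I, J, K}. type11 UNIV (L (proj P q)) \<beta> \<and>
            (\<forall>v. wedge 2 (2 * (2 * n + 1)) (as_form \<beta>)
              (wedge_power (kaehler_form (cone_metric \<M> g) L (proj P q)) (2 * n + 1)) v = 0))"
        using represents_pullback[OF q, of \<beta>] \<beta>(1) lift(1)[of I] lift(2,3) unfolding \<Psi>q pq
        by (intro exI conjI ballI allI; assumption?) blast+
    qed
  qed
qed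

end
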